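(* There is a randomized algorithm in the $\mathsf{LOCAL}$ model which, for any packing integer linear programming problem and any $0<\varepsilon<1$, computes a $(1-\varepsilon)$-approximate solution in $O\left(\frac{\log^3(1/\varepsilon)\log n}{\varepsilon}\right)$ rounds with probability $1-1/\operatorname{poly}(n)$, where $n$ is the number of variables.
   Context: A packing problem: given $A\in\mathbb{R}_{\ge0}^{m\times n}$, $b\in\mathbb{R}_{\ge0}^m$, $w\in\mathbb{Z}_{\ge0}^n$, find $x\in\{0,1\}^n$ maximizing $w^\intercal x$ subject to $Ax\le b$. It is assumed that $\|w\|_1=\sum_i w_i$ is polynomial in $n$. A $(1-\varepsilon)$-approximate solution is a feasible $x$ with $w^\intercal x\ge(1-\varepsilon)\cdot\mathrm{OPT}$. Distributed model: the problem is modeled by the hypergraph $H$ whose vertices are the variables $x_1,\dots,x_n$ and whose hyperedges are, for each constraint $j$, the set $\{x_i: A_{j,i}\neq 0\}$. The $\mathsf{LOCAL}$ model on $H$: synchronous rounds, in each round each vertex may exchange messages of arbitrary size with every vertex sharing a hyperedge with it and perform arbitrary local computation; vertices have independent local random bits; each vertex outputs the value of its variable. A polynomial upper bound $\tilde n$ with $\max(n,\mathrm{OPT})\le\tilde n\le\max(n,\mathrm{OPT})^c$ ($c\ge1$ a universal constant) is known to all vertices. "With probability $1-1/\operatorname{poly}(n)$" means with probability at least $1-n^{-c'}$ for a suitably large constant $c'$.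
   Formalization: In the round bound, log(1/ε) is read as max(1, ln(1/ε)); with the literal log(1/ε) and a uniform constant the bound would force 0 rounds as ε tends to 1, which is impossible (e.g. two variables with x₁+x₂≤1). *)

theory Defs
  imports "HOL-Probability.Probability" "Jordan_Normal_Form.Matrix"
begin

definition packing_problem :: "nat \<Rightarrow> nat \<Rightarrow> real mat \<Rightarrow> real vec \<Rightarrow> nat vec \<Rightarrow> bool" where
  "packing_problem m n A b w \<longleftrightarrow>
     A \<in> carrier_mat m n \<and> b \<in> carrier_vec m \<and> w \<in> carrier_vec n \<and>
     (\<forall>j<m. \<forall>i<n. 0 \<le> A $$ (j, i)) \<and> (\<forall>j<m. 0 \<le> b $ j)"

definition feasible :: "real mat \<Rightarrow> real vec \<Rightarrow> nat vec \<Rightarrow> bool" where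
  "feasible A b x \<longleftrightarrow>
     x \<in> carrier_vec (dim_col A) \<and> (\<forall>i<dim_col A. x $ i \<in> {0, 1}) \<and>
     A *\<^sub>v map_vec real x \<le> b"

definition OPT :: "real mat \<Rightarrow> real vec \<Rightarrow> nat vec \<Rightarrow> nat" where
  "OPT A b w = Max {scalar_prod w x | x. feasible A b x}"

definition approx_solution ::
    "real \<Rightarrow> real mat \<Rightarrow> real vec \<Rightarrow> nat vec \<Rightarrow> nat vec \<Rightarrow> bool" where
  "approx_solution \<epsilon> A b w x \<longleftrightarrow>
     feasible A b x \<and> real (scalar_prod w x) \<ge> (1 - \<epsilon>) * real (OPT A b w)"

definition norm1 :: "nat vec \<Rightarrow> nat" where
  "norm1 w = (\<Sum>i<dim_vec w. w $ i)"

definition hyperedge :: "real mat \<Rightarrow> nat \<Rightarrow> nat set" where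
  "hyperedge A j = {i. i < dim_col A \<and> A $$ (j, i) \<noteq> 0}"

definition neighbours :: "real mat \<Rightarrow> nat \<Rightarrow> nat set" where
  "neighbours A v = {u. u \<noteq> v \<and> (\<exists>j<dim_row A. u \<in> hyperedge A j \<and> v \<in> hyperedge A j)}"

text \<open>
  HOL cannot quantify existentially over types, so states and messages are taken from one
  fixed type that is large enough to encode finite structures built from numbers, real
  coefficients and (infinite) random bit sequences.
\<close>

datatype datum = Natural nat | Real real | Bits "nat \<Rightarrow> bool" | Tuple "datum list"

text \<open>
  The arguments of \<open>initial\<close> are everything a vertex knows before the first round: the upper
  bound on \<open>max(n, OPT)\<close>, the accuracy \<open>\<epsilon>\<close>, its own weight, its incident constraints, and
  its own random bits. An incident constraint \<open>j\<close> is presented as a triple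
  \<open>(label of j, A\<^sub>j\<^sub>v, b\<^sub>j)\<close>; the label, an arbitrary name for the hyperedge, is what lets two
  vertices recognize that they share that hyperedge.

  Vertices carry no identifiers, and a vertex broadcasts a single message per round to all its
  neighbours. As messages are unbounded, this loses nothing compared with a
  separate message for each neighbour (distinct identifiers can be drawn from the random bits),
  and it only makes an existence claim for algorithms stronger.

  Local computation is unrestricted: all components are arbitrary functions. The result of
  \<open>answer\<close> is \<open>None\<close> as long as the vertex has not halted.
\<close>

record local_alg =
  initial :: "real \<Rightarrow> real \<Rightarrow> nat \<Rightarrow> (nat \<times> real \<times> real) set \<Rightarrow> (nat \<Rightarrow> bool) \<Rightarrow> datum"
  message :: "datum \<Rightarrow> datum"
  update :: "datum \<Rightarrow> datum multiset \<Rightarrow> datum"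
  answer :: "datum \<Rightarrow> nat option"

definition incident_constraints ::
    "real mat \<Rightarrow> real vec \<Rightarrow> (nat \<Rightarrow> nat) \<Rightarrow> nat \<Rightarrow> (nat \<times> real \<times> real) set" where
  "incident_constraints A b lab v =
     {(lab j, A $$ (j, v), b $ j) | j. j < dim_row A \<and> v \<in> hyperedge A j}"

text \<open>
  \<open>local_run alg N s t v\<close> is the state of vertex \<open>v\<close> after \<open>t\<close> synchronous rounds, for
  neighbourhoods \<open>N\<close> and initial states \<open>s\<close>. The state is frozen once the vertex has halted,
  so outputs are irrevocable.
\<close>

primrec local_run ::
    "local_alg \<Rightarrow> (nat \<Rightarrow> nat set) \<Rightarrow> (nat \<Rightarrow> datum) \<Rightarrow> nat \<Rightarrow> nat \<Rightarrow> datum" where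
  "local_run alg N s 0 v = s v"
| "local_run alg N s (Suc t) v =
     (if answer alg (local_run alg N s t v) \<noteq> None then local_run alg N s t v
      else update alg (local_run alg N s t v)
             {# message alg (local_run alg N s t u). u \<in># mset_set (N v) #})"

text \<open>The random bits are \<open>\<omega> :: nat \<Rightarrow> nat \<Rightarrow> bool\<close>, vertex \<open>v\<close> seeing only \<open>\<omega> v\<close>.\<close>

definition run_output ::
    "local_alg \<Rightarrow> real mat \<Rightarrow> real vec \<Rightarrow> nat vec \<Rightarrow> (nat \<Rightarrow> nat) \<Rightarrow> real \<Rightarrow> real \<Rightarrow>
     (nat \<Rightarrow> nat \<Rightarrow> bool) \<Rightarrow> nat \<Rightarrow> nat \<Rightarrow> nat option" where
  "run_output alg A b w lab ntilde \<epsilon> \<omega> t v =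
     answer alg (local_run alg (neighbours A)
       (\<lambda>u. initial alg ntilde \<epsilon> (w $ u) (incident_constraints A b lab u) (\<omega> u)) t v)"

definition solves_within ::
    "local_alg \<Rightarrow> real mat \<Rightarrow> real vec \<Rightarrow> nat vec \<Rightarrow> (nat \<Rightarrow> nat) \<Rightarrow> real \<Rightarrow> real \<Rightarrow>
     (nat \<Rightarrow> nat \<Rightarrow> bool) \<Rightarrow> nat \<Rightarrow> bool" where
  "solves_within alg A b w lab ntilde \<epsilon> \<omega> t \<longleftrightarrow>
     (\<exists>x. dim_vec x = dim_col A \<and>
          (\<forall>v<dim_col A. run_output alg A b w lab ntilde \<epsilon> \<omega> t v = Some (x $ v)) \<and>
          approx_solution \<epsilon> A b w x)"

definition coin_flips :: "(nat \<Rightarrow> bool) measure" where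
  "coin_flips = Pi\<^sub>M UNIV (\<lambda>_. measure_pmf (bernoulli_pmf (1/2)))"

definition random_bits :: "nat \<Rightarrow> (nat \<Rightarrow> nat \<Rightarrow> bool) measure" where
  "random_bits n = Pi\<^sub>M {..<n} (\<lambda>_. coin_flips)"

text \<open>
  The scale of the round complexity. The expression \<open>ln (1/\<epsilon>)\<close> tends to \<open>0\<close> as \<open>\<epsilon>\<close> tends
  to \<open>1\<close>; as usual in asymptotic notation it is read as being at least a positive constant,
  since otherwise for \<open>\<epsilon>\<close> close to \<open>1\<close> a uniform bound would force \<open>0\<close> rounds.
\<close>

definition round_scale :: "nat \<Rightarrow> real \<Rightarrow> real" where
  "round_scale n \<epsilon> = (max 1 (ln (1 / \<epsilon>))) ^ 3 * ln (real n) / \<epsilon>"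

end

theory Submission
  imports Defs
begin

text \<open>
  The algorithm clusters the graph by first touch: every centre \<open>u\<close> has a key and a radius \<open>r\<close>, and
  a vertex \<open>v\<close> follows the least key among the centres with \<open>d(u, v) \<le> r + 1\<close>; it joins that
  cluster if \<open>d(u, v) \<le> r\<close> and is deleted otherwise. Distinct clusters are never adjacent, so
  solving them separately loses at most what an optimal solution has on deleted vertices.

  With geometric radii (parameter \<open>p = \<epsilon>/9\<close>) each vertex is deleted with probability at most \<open>2p\<close>,
  which controls only the expected loss. But averaging the solutions of many independent
  clusterings gives, with high probability, a fractional solution of value at least \<open>(1 - 5p) OPT\<close>:
  a locally known additive measure \<open>\<mu>\<close> such that every vertex set \<open>C\<close> carries a feasible solution of
  weight at least \<open>\<mu>(C)\<close>. It remains to find a clustering that deletes little \<open>\<mu>\<close>-mass.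

  To this end let \<open>\<nu>(u) = \<mu>(u) / \<mu>(ball around u)\<close>, which is at most 1 on smaller balls. In phase
  \<open>i = 1, \<dots>, T\<close> with \<open>2^T \<ge> 1/p\<close>, centres are sampled at rate \<open>\<kappa> 2^i \<nu>\<close>, and their radii are taken
  from a window that shrinks with \<open>i\<close>, at the layer with the least \<open>\<mu>\<close>-mass. Vertices whose ball has
  \<open>\<nu>\<close>-measure at least \<open>2^-i\<close> are reached in phase \<open>i\<close>, and all others see only \<open>O(\<kappa>)\<close> centres of
  phase \<open>i + 1\<close>, so the layers cost little. A last phase uses geometric radii everywhere; the mass
  deleted there is concentrated because a vertex is lost only if in addition its surroundings
  contain no sample of phase \<open>T\<close>.
\<close>

section \<open>First-touch clusterings and optimal solutions of clusters\<close>

text \<open>Why one clustering is not enough: if an optimal solution has its weight on a few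
  neighbouring vertices, a cut through them can lose everything with probability of order
  \<open>p\<close>, and nothing concentrates. Rates proportional to \<open>\<nu>\<close> detect such
  spots: where much mass sits relative to its surroundings, a centre appears early and chooses its
  cut by measuring the layers instead of by luck.

  Budget: \<open>9 p = 5 p + 4 p\<close>. Averaging may lose \<open>5 p\<close>, the final cut
  \<open>4 p\<close>, of which \<open>p\<close> pays for the layers of all phases, by
  \<open>L \<ge> 7 \<kappa> T / p\<close>, and \<open>3 p\<close> for the last phase. The cubic
  logarithm is the total length \<open>T L\<close> of the windows, of order
  \<open>\<kappa> T^2 / p\<close>, where \<open>T\<close> is of order log (1/\<epsilon>) and
  \<open>\<kappa>\<close> of order log n + T.

  Vertices are anonymous, so identifiers are drawn at random and every quantity is computed from
  images of balls under earlier quantities. Equal views then force equal values, which makes the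
  answer a function of the view without reconstructing the network from it.\<close>

primrec nbhd :: "('v \<Rightarrow> 'v set) \<Rightarrow> nat \<Rightarrow> 'v \<Rightarrow> 'v set" where
  "nbhd N 0 v = {v}"
| "nbhd N (Suc r) v = nbhd N r v \<union> (\<Union>u\<in>N v. nbhd N r u)"

lemma nbhd_mono: "r \<le> s \<Longrightarrow> nbhd N r v \<subseteq> nbhd N s v"
  by (rule lift_Suc_mono_le[of "\<lambda>r. nbhd N r v"]) auto

lemma self_in_nbhd: "v \<in> nbhd N r v"
  using nbhd_mono[of 0 r N v] by auto

lemma nbhd_trans: "u \<in> nbhd N r v \<Longrightarrow> z \<in> nbhd N s u \<Longrightarrow> z \<in> nbhd N (r + s) v"
proof (induction r arbitrary: v)
  case (Suc r)
  then show ?case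
    by auto
qed auto

lemma nbhd_Suc_neighbour: "u \<in> nbhd N r v \<Longrightarrow> v \<in> N v' \<Longrightarrow> u \<in> nbhd N (Suc r) v'"
  by auto

lemma ex_max:
  fixes f :: "'a \<Rightarrow> 'b :: linorder"
  assumes "finite S" "S \<noteq> {}"
  shows "\<exists>x\<in>S. \<forall>y\<in>S. f y \<le> f x"
proof -
  have "Max (f ` S) \<in> f ` S" using assms by (intro Max_in) auto
  then obtain x where "x \<in> S" "f x = Max (f ` S)" by auto
  then show ?thesis using assms by (metis Max_ge finite_imageI imageI)
qed

text \<open>Only the images of balls under \<open>f\<close> are recorded, never the vertices
  themselves, so that whatever is computed from a scan is determined by a view
  (\<open>agree_scan\<close>). The truncation at \<open>\<rho>\<close> bounds the distance that has
  to be explored.\<close>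

definition scan :: "('v \<Rightarrow> 'v set) \<Rightarrow> nat \<Rightarrow> ('v \<Rightarrow> 'a) \<Rightarrow> 'v \<Rightarrow> nat \<Rightarrow> 'a set" where
  "scan N \<rho> f v = (\<lambda>j. if j \<le> \<rho> then f ` nbhd N j v else {})"

text \<open>\<open>d = 1\<close> means that the centre touches the vertex, \<open>d = 0\<close> that
  it captures it. The inequality \<open>j \<le> r + d\<close> may replace equality because balls
  grow with their radius.\<close>

definition reached :: "nat \<Rightarrow> (nat \<Rightarrow> (nat \<times> nat) set set) \<Rightarrow> nat set" where
  "reached d G = {k. \<exists>j. \<exists>c\<in>G j. \<exists>r. (k, r) \<in> c \<and> j \<le> r + d}"

text \<open>If nothing touches the vertex, \<open>LEAST\<close> returns an arbitrary key, but then
  nothing captures it either and the label is \<open>None\<close>.\<close>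

definition cluster_label :: "(nat \<Rightarrow> (nat \<times> nat) set set) \<Rightarrow> nat option" where
  "cluster_label G = (let k = LEAST k. k \<in> reached 1 G in if k \<in> reached 0 G then Some k else None)"

definition cluster ::
    "('v \<Rightarrow> 'v set) \<Rightarrow> nat \<Rightarrow> ('v \<Rightarrow> (nat \<times> nat) set) \<Rightarrow> 'v \<Rightarrow> nat option" where
  "cluster N \<rho> cd v = cluster_label (scan N \<rho> cd v)"

section \<open>Packing constraints seen through the tags of the vertices\<close>

type_synonym tag = "nat \<times> nat \<times> (nat \<times> real \<times> real) set"

abbreviation tag_weight :: "tag \<Rightarrow> nat" where "tag_weight y \<equiv> fst (snd y)"
abbreviation tag_cons :: "tag \<Rightarrow> (nat \<times> real \<times> real) set" where "tag_cons y \<equiv> snd (snd y)"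

text \<open>For distinct constraint labels the sum has at most one term: it is the matrix entry of
  the vertex in row \<open>l\<close>, and 0 for a row that does not contain the vertex.\<close>

definition tag_coeff :: "tag \<Rightarrow> nat \<Rightarrow> real" where
  "tag_coeff y l = (\<Sum>t\<in>{t \<in> tag_cons y. fst t = l}. fst (snd t))"

text \<open>A row that contains no chosen vertex reads \<open>0 \<le> b_j\<close> and may be
  skipped. Hence a cluster can test its solutions from its own tags alone.\<close>

definition tags_feasible :: "tag set \<Rightarrow> bool" where
  "tags_feasible Y \<longleftrightarrow>
     (\<forall>y\<in>Y. \<forall>t\<in>tag_cons y. (\<Sum>z\<in>Y. tag_coeff z (fst t)) \<le> snd (snd t))"

text \<open>The choice depends on the set of tags only, so all vertices of a cluster break ties
  alike and settle on the same optimum without further communication.\<close>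

definition best_tags :: "tag set \<Rightarrow> tag set" where
  "best_tags Y = (SOME X. X \<subseteq> Y \<and> tags_feasible X \<and>
     (\<forall>Z\<subseteq>Y. tags_feasible Z \<longrightarrow> sum tag_weight Z \<le> sum tag_weight X))"

definition solve ::
    "('v \<Rightarrow> 'v set) \<Rightarrow> nat \<Rightarrow> ('v \<Rightarrow> tag) \<Rightarrow> ('v \<Rightarrow> nat option) \<Rightarrow> 'v \<Rightarrow> bool" where
  "solve N \<rho> tg c v \<longleftrightarrow> c v \<noteq> None \<and>
     tg v \<in> best_tags (fst ` {y \<in> (\<lambda>u. (tg u, c u)) ` nbhd N \<rho> v. snd y = c v})"

locale vgraph =
  fixes V :: "'v set" and N :: "'v \<Rightarrow> 'v set"
  assumes finite_V: "finite V"
    and N_sym: "u \<in> N v \<Longrightarrow> v \<in> N u"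
    and N_sub: "N v \<subseteq> V"
begin

lemma nbhd_sub: "v \<in> V \<Longrightarrow> nbhd N r v \<subseteq> V"
proof (induction r arbitrary: v)
  case (Suc r)
  then have "u \<in> N v \<Longrightarrow> nbhd N r u \<subseteq> V" for u using N_sub by blast
  then show ?case using Suc by auto
qed auto

lemma finite_nbhd: "v \<in> V \<Longrightarrow> finite (nbhd N r v)"
  using nbhd_sub finite_V finite_subset by metis

lemma nbhd_sym: "u \<in> nbhd N r v \<Longrightarrow> v \<in> nbhd N r u"
proof (induction r arbitrary: u v)
  case (Suc r)
  from Suc.prems consider "u \<in> nbhd N r v" | w where "w \<in> N v" "u \<in> nbhd N r w" by auto
  then show ?case
  proof cases
    case 2
    then have "w \<in> nbhd N r u" "v \<in> nbhd N 1 w" using Suc.IH N_sym by auto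
    then show ?thesis using nbhd_trans by fastforce
  qed (use Suc.IH in auto)
qed auto

lemma nbhd_commute: "u \<in> nbhd N r v \<longleftrightarrow> v \<in> nbhd N r u"
  using nbhd_sym by blast

end

declare nbhd.simps [simp del]

locale centres = vgraph V N for V :: "'v set" and N +
  fixes cd :: "'v \<Rightarrow> (nat \<times> nat) set" and \<rho> :: nat
  assumes radius_less: "(k, r) \<in> cd u \<Longrightarrow> Suc r \<le> \<rho>"
    and key_unique: "u \<in> V \<Longrightarrow> u' \<in> V \<Longrightarrow> (k, r) \<in> cd u \<Longrightarrow> (k, r') \<in> cd u' \<Longrightarrow> u = u' \<and> r = r'"
begin

lemma reached_iff:
  assumes "d \<le> 1"
  shows "k \<in> reached d (scan N \<rho> cd v) \<longleftrightarrow> (\<exists>u r. (k, r) \<in> cd u \<and> u \<in> nbhd N (r + d) v)" (is "?l \<longleftrightarrow> ?r")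
proof
  assume ?l
  then obtain j u r where *: "j \<le> \<rho>" "u \<in> nbhd N j v" "(k, r) \<in> cd u" "j \<le> r + d"
    by (auto simp: reached_def scan_def split: if_splits)
  then have "u \<in> nbhd N (r + d) v" using subsetD[OF nbhd_mono] by metis
  then show ?r using * by blast
next
  assume ?r
  then obtain u r where ur: "(k, r) \<in> cd u" "u \<in> nbhd N (r + d) v" by blast
  moreover have "r + d \<le> \<rho>" using radius_less[OF ur(1)] assms by simp
  ultimately have "cd u \<in> scan N \<rho> cd v (r + d)" by (simp add: scan_def)
  then show ?l using ur(1) unfolding reached_def
    by (intro CollectI exI[of _ "r + d"] bexI[of _ "cd u"] exI[of _ r] conjI order_refl)
qed

lemma touched_iff: "k \<in> reached 1 (scan N \<rho> cd v) \<longleftrightarrow> (\<exists>u r. (k, r) \<in> cd u \<and> u \<in> nbhd N (Suc r) v)"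
  and captured_iff: "k \<in> reached 0 (scan N \<rho> cd v) \<longleftrightarrow> (\<exists>u r. (k, r) \<in> cd u \<and> u \<in> nbhd N r v)"
  using reached_iff[of 1] reached_iff[of 0] by simp_all

abbreviation clab :: "'v \<Rightarrow> nat option" where "clab \<equiv> cluster N \<rho> cd"

lemma clab_SomeD:
  assumes "clab v = Some k"
  shows "\<exists>u r. (k, r) \<in> cd u \<and> u \<in> nbhd N r v"
    and "(k', r') \<in> cd u' \<Longrightarrow> u' \<in> nbhd N (Suc r') v \<Longrightarrow> k \<le> k'"
proof -
  have k: "k = (LEAST k. k \<in> reached 1 (scan N \<rho> cd v))" "k \<in> reached 0 (scan N \<rho> cd v)"
    using assms by (auto simp: cluster_def cluster_label_def Let_def split: if_splits)
  show "\<exists>u r. (k, r) \<in> cd u \<and> u \<in> nbhd N r v" using k captured_iff by blast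
  show "k \<le> k'" if "(k', r') \<in> cd u'" "u' \<in> nbhd N (Suc r') v"
    unfolding k(1) by (rule Least_le) (use that touched_iff in blast)
qed

text \<open>The touching centre \<open>u0\<close> excludes the other source of \<open>None\<close>,
  that no centre touches \<open>v\<close> at all. In the applications it is \<open>v\<close>
  itself.\<close>

lemma clab_NoneD:
  assumes "clab v = None" and "(k0, r0) \<in> cd u0" "u0 \<in> nbhd N (Suc r0) v"
  shows "\<exists>k u r. (k, r) \<in> cd u \<and> u \<in> nbhd N (Suc r) v \<and> u \<notin> nbhd N r v \<and>
           (\<forall>k' r' u'. (k', r') \<in> cd u' \<longrightarrow> u' \<in> nbhd N (Suc r') v \<longrightarrow> k \<le> k')"
proof -
  define k where "k = (LEAST k. k \<in> reached 1 (scan N \<rho> cd v))"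
  have "k \<notin> reached 0 (scan N \<rho> cd v)"
    using assms by (auto simp: cluster_def cluster_label_def Let_def k_def split: if_splits)
  moreover have "k \<in> reached 1 (scan N \<rho> cd v)"
    unfolding k_def by (rule LeastI[of _ k0]) (use assms touched_iff in blast)
  moreover have "\<forall>k' r' u'. (k', r') \<in> cd u' \<longrightarrow> u' \<in> nbhd N (Suc r') v \<longrightarrow> k \<le> k'"
    unfolding k_def using touched_iff by (auto intro!: Least_le simp del: nbhd.simps)
  ultimately show ?thesis unfolding touched_iff captured_iff by blast
qed

text \<open>A centre that captures \<open>v\<close> touches every neighbour of \<open>v\<close>, so
  the label of the neighbour, its least touching key, is at most that of \<open>v\<close>. Symmetry
  gives equality.\<close>

lemma clab_adjacent:
  assumes "clab v = Some k" "clab v' = Some k'" "v' \<in> N v"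
  shows "k = k'"
proof -
  have *: "k' \<le> k" if a: "clab v = Some k" "clab v' = Some k'" "v' \<in> N v" for v v' k k'
  proof -
    obtain u r where "(k, r) \<in> cd u" "u \<in> nbhd N r v" using clab_SomeD(1) a(1) by blast
    moreover have "u \<in> nbhd N (Suc r) v'" using nbhd_Suc_neighbour[OF calculation(2)] N_sym[OF a(3)] .
    ultimately show ?thesis using clab_SomeD(2)[OF a(2)] by blast
  qed
  show ?thesis using * assms N_sym by (meson antisym)
qed

lemma clab_diameter:
  assumes "v \<in> V" "v' \<in> V" "clab v = Some k" "clab v' = Some k"
  shows "v' \<in> nbhd N (2 * \<rho>) v"
proof -
  obtain u r where u: "(k, r) \<in> cd u" "u \<in> nbhd N r v" using clab_SomeD(1) assms by blast
  obtain u' r' where u': "(k, r') \<in> cd u'" "u' \<in> nbhd N r' v'" using clab_SomeD(1) assms by blast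
  have "u \<in> V" "u' \<in> V" using u(2) u'(2) nbhd_sub assms(1,2) by blast+
  then have "u = u'" "r = r'" using key_unique[OF _ _ u(1) u'(1)] by auto
  then have "v' \<in> nbhd N (r + r) v" using nbhd_trans u u' nbhd_sym by metis
  moreover have "r + r \<le> 2 * \<rho>" using radius_less u by fastforce
  ultimately show ?thesis using subsetD[OF nbhd_mono] by metis
qed

end

locale tagged_graph = vgraph V N for V :: "'v set" and N +
  fixes tg :: "'v \<Rightarrow> tag"
  assumes tg_inj: "inj_on tg V"
    and cons_finite: "v \<in> V \<Longrightarrow> finite (tag_cons (tg v))"
    and cons_nonneg: "v \<in> V \<Longrightarrow> t \<in> tag_cons (tg v) \<Longrightarrow> 0 \<le> fst (snd t)"
    and cons_shared: "u \<in> V \<Longrightarrow> v \<in> V \<Longrightarrow> u \<noteq> v \<Longrightarrow> t \<in> tag_cons (tg u) \<Longrightarrow>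
      t' \<in> tag_cons (tg v) \<Longrightarrow> fst t = fst t' \<Longrightarrow> v \<in> N u"
begin

definition feas :: "'v set \<Rightarrow> bool" where "feas X \<longleftrightarrow> tags_feasible (tg ` X)"

abbreviation wt :: "'v \<Rightarrow> nat" where "wt v \<equiv> tag_weight (tg v)"

lemma feas_iff:
  assumes "X \<subseteq> V"
  shows "feas X \<longleftrightarrow> (\<forall>y\<in>X. \<forall>t\<in>tag_cons (tg y). (\<Sum>z\<in>X. tag_coeff (tg z) (fst t)) \<le> snd (snd t))"
proof -
  have "inj_on tg X" using tg_inj assms inj_on_subset by blast
  then show ?thesis by (simp add: feas_def tags_feasible_def sum.reindex)
qed

lemma tag_coeff_nonneg: "v \<in> V \<Longrightarrow> 0 \<le> tag_coeff (tg v) l"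
  unfolding tag_coeff_def by (rule sum_nonneg) (auto intro: cons_nonneg)

lemma feas_empty: "feas {}" by (simp add: feas_def tags_feasible_def)

lemma feas_subset:
  assumes "X \<subseteq> V" "feas X" "Y \<subseteq> X"
  shows "feas Y"
proof -
  have "(\<Sum>z\<in>Y. tag_coeff (tg z) (fst t)) \<le> snd (snd t)" if "y \<in> Y" "t \<in> tag_cons (tg y)" for y t
  proof -
    have "(\<Sum>z\<in>Y. tag_coeff (tg z) (fst t)) \<le> (\<Sum>z\<in>X. tag_coeff (tg z) (fst t))"
      by (rule sum_mono2) (use assms finite_V finite_subset tag_coeff_nonneg in blast)+
    also have "\<dots> \<le> snd (snd t)" using assms that feas_iff by blast
    finally show ?thesis .
  qed
  then show ?thesis using assms feas_iff[of Y] by blast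
qed

lemma sum_wt: "X \<subseteq> V \<Longrightarrow> sum tag_weight (tg ` X) = sum wt X"
  using tg_inj inj_on_subset by (subst sum.reindex) (blast, simp add: o_def)

lemma best_tags:
  assumes "C \<subseteq> V"
  shows "\<exists>X\<subseteq>C. best_tags (tg ` C) = tg ` X \<and> feas X \<and> (\<forall>Z\<subseteq>C. feas Z \<longrightarrow> sum wt Z \<le> sum wt X)"
proof -
  have fin: "finite (Pow (tg ` C))" using assms finite_V finite_subset by blast
  let ?P = "\<lambda>X. X \<subseteq> tg ` C \<and> tags_feasible X"
  let ?Q = "\<lambda>X. ?P X \<and> (\<forall>Z\<subseteq>tg ` C. tags_feasible Z \<longrightarrow> sum tag_weight Z \<le> sum tag_weight X)"
  have "{X. ?P X} \<noteq> {}" using feas_empty by (auto simp: feas_def)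
  moreover have "finite {X. ?P X}" using fin by (rule rev_finite_subset) auto
  ultimately have "\<exists>X\<in>{X. ?P X}. \<forall>Z\<in>{X. ?P X}. sum tag_weight Z \<le> sum tag_weight X"
    using ex_max[of "{X. ?P X}" "sum tag_weight"] by blast
  then have "\<exists>X. ?Q X" by blast
  then have "?Q (SOME X. ?Q X)" by (rule someI_ex)
  then have Q: "?Q (best_tags (tg ` C))" by (simp add: best_tags_def conj_assoc)
  then obtain X where X: "X \<subseteq> C" "best_tags (tg ` C) = tg ` X" by (meson subset_image_iff)
  have "sum wt Z \<le> sum wt X" if "Z \<subseteq> C" "feas Z" for Z
  proof -
    have "sum tag_weight (tg ` Z) \<le> sum tag_weight (tg ` X)"
      using Q that X(2) image_mono[OF that(1), of tg] unfolding feas_def by metis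
    then show ?thesis using sum_wt that assms X by auto
  qed
  then show ?thesis using X Q by (auto simp: feas_def)
qed

end

locale clustering = tagged_graph V N tg for V :: "'v set" and N tg +
  fixes c :: "'v \<Rightarrow> nat option" and \<rho> :: nat
  assumes c_adjacent: "u \<in> V \<Longrightarrow> v \<in> V \<Longrightarrow> c u = Some k \<Longrightarrow> c v = Some l \<Longrightarrow> v \<in> N u \<Longrightarrow> k = l"
    and c_diameter: "u \<in> V \<Longrightarrow> v \<in> V \<Longrightarrow> c u = Some k \<Longrightarrow> c v = Some k \<Longrightarrow> v \<in> nbhd N \<rho> u"
begin

definition sol :: "'v set" where "sol = {v \<in> V. solve N \<rho> tg c v}"

lemma sol_sub: "sol \<subseteq> V" by (auto simp: sol_def)

text \<open>By \<open>c_diameter\<close> the ball inspected by \<open>solve\<close> contains the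
  whole cluster, so all its vertices evaluate \<open>best_tags\<close> on the same set.\<close>

lemma sol_cluster:
  defines "C \<equiv> \<lambda>k. {v \<in> V. c v = Some k}"
  shows "feas (sol \<inter> C k)" and "Z \<subseteq> C k \<Longrightarrow> feas Z \<Longrightarrow> sum wt Z \<le> sum wt (sol \<inter> C k)"
proof -
  have CV: "C k \<subseteq> V" by (auto simp: C_def)
  then obtain X where X: "X \<subseteq> C k" "best_tags (tg ` C k) = tg ` X" "feas X"
    "\<And>Z. Z \<subseteq> C k \<Longrightarrow> feas Z \<Longrightarrow> sum wt Z \<le> sum wt X"
    using best_tags[of "C k"] by auto
  have "solve N \<rho> tg c v \<longleftrightarrow> v \<in> X" if v: "v \<in> C k" for v
  proof -
    have "{u \<in> nbhd N \<rho> v. c u = Some k} = C k"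
      using v c_diameter subsetD[OF nbhd_sub] unfolding C_def by blast
    then have "fst ` {y \<in> (\<lambda>u. (tg u, c u)) ` nbhd N \<rho> v. snd y = c v} = tg ` C k"
      using v by (fastforce simp: C_def image_iff)
    then have "solve N \<rho> tg c v \<longleftrightarrow> tg v \<in> tg ` X" using X v by (auto simp: solve_def C_def)
    also have "\<dots> \<longleftrightarrow> v \<in> X" using inj_on_image_mem_iff[OF tg_inj, of v X] v CV X(1) by blast
    finally show ?thesis .
  qed
  then have "sol \<inter> C k = X" using X(1) by (auto simp: sol_def C_def)
  then show "feas (sol \<inter> C k)" "Z \<subseteq> C k \<Longrightarrow> feas Z \<Longrightarrow> sum wt Z \<le> sum wt (sol \<inter> C k)"
    using X by auto
qed

text \<open>A constraint cannot involve two clusters: its vertices are pairwise adjacent, and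
  adjacent vertices that are not deleted carry the same label. Each constraint is therefore
  respected as soon as each cluster respects it.\<close>

lemma sol_feas: "feas sol"
  unfolding feas_iff[OF sol_sub]
proof (intro ballI)
  fix y t assume y: "y \<in> sol" and t: "t \<in> tag_cons (tg y)"
  from y obtain k where k: "c y = Some k" by (auto simp: sol_def solve_def)
  let ?C = "{v \<in> V. c v = Some k}"
  have "(\<Sum>z\<in>sol. tag_coeff (tg z) (fst t)) = (\<Sum>z\<in>sol \<inter> ?C. tag_coeff (tg z) (fst t))"
  proof (rule sum.mono_neutral_right)
    show "finite sol" using sol_sub finite_V finite_subset by blast
    show "\<forall>z\<in>sol - sol \<inter> ?C. tag_coeff (tg z) (fst t) = 0"
    proof
      fix z assume z: "z \<in> sol - sol \<inter> ?C"
      then obtain l where l: "c z = Some l" by (auto simp: sol_def solve_def)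
      have V: "y \<in> V" "z \<in> V" using y z sol_sub by auto
      have "{t' \<in> tag_cons (tg z). fst t' = fst t} = {}"
      proof (rule ccontr)
        assume ne: "{t' \<in> tag_cons (tg z). fst t' = fst t} \<noteq> {}"
        from ne obtain t' where t': "t' \<in> tag_cons (tg z)" "fst t' = fst t" by blast
        have "z \<in> N y" using cons_shared[OF V _ t t'(1)] t' z k V by fastforce
        then have "k = l" using c_adjacent[OF V k l] by simp
        then show False using z l V by auto
      qed
      then show "tag_coeff (tg z) (fst t) = 0" by (simp only: tag_coeff_def sum.empty)
    qed
  qed auto
  also have "\<dots> \<le> snd (snd t)"
  proof -
    have "y \<in> sol \<inter> ?C" using y k sol_sub by auto
    moreover have "sol \<inter> ?C \<subseteq> V" by auto
    ultimately show ?thesis using sol_cluster(1)[of k] t feas_iff by blast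
  qed
  finally show "(\<Sum>z\<in>sol. tag_coeff (tg z) (fst t)) \<le> snd (snd t)" .
qed

text \<open>In every cluster the local optimum weighs at least as much as the witness that
  \<open>dom\<close> provides there. This is applied twice, with \<open>\<mu>\<close> the weight on
  a fixed feasible set and with \<open>\<mu>\<close> the averaged mass.\<close>

lemma sol_mass:
  fixes \<mu> :: "'v \<Rightarrow> real"
  assumes dom: "\<And>C. C \<subseteq> V \<Longrightarrow> \<exists>Z\<subseteq>C. feas Z \<and> sum \<mu> C \<le> real (sum wt Z)"
  shows "(\<Sum>v | v \<in> V \<and> c v \<noteq> None. \<mu> v) \<le> real (sum wt sol)"
proof -
  let ?L = "c ` {v \<in> V. c v \<noteq> None}"
  let ?C = "\<lambda>k. {v \<in> V. c v = k}"
  have fin: "finite ?L" using finite_V by auto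
  have *: "sum \<mu> (?C k) \<le> real (sum wt (sol \<inter> ?C k))" if "k \<in> ?L" for k
  proof -
    from that obtain l where l: "k = Some l" by auto
    obtain Z where Z: "Z \<subseteq> ?C k" "feas Z" "sum \<mu> (?C k) \<le> real (sum wt Z)"
      using dom[of "?C k"] by auto
    have "sum wt Z \<le> sum wt (sol \<inter> ?C k)" using sol_cluster(2)[of Z l] Z(1,2) l by simp
    then show ?thesis using Z(3) by linarith
  qed
  have "(\<Sum>v | v \<in> V \<and> c v \<noteq> None. \<mu> v) = (\<Sum>k\<in>?L. \<Sum>v | v \<in> {v \<in> V. c v \<noteq> None} \<and> c v = k. \<mu> v)"
    by (rule sum.image_gen) (use finite_V in auto)
  also have "\<dots> = (\<Sum>k\<in>?L. sum \<mu> (?C k))"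
    by (intro sum.cong refl arg_cong2[where f = sum]) auto
  also have "\<dots> \<le> (\<Sum>k\<in>?L. real (sum wt (sol \<inter> ?C k)))" by (intro sum_mono *)
  also have "\<dots> = real (\<Sum>k\<in>?L. \<Sum>v | v \<in> sol \<and> c v = k. wt v)"
    unfolding of_nat_sum by (intro sum.cong refl arg_cong2[where f = sum]) (auto simp: sol_def)
  also have "(\<Sum>k\<in>?L. \<Sum>v | v \<in> sol \<and> c v = k. wt v) = sum wt sol"
    by (rule sum.group) (use sol_sub finite_V finite_subset fin in \<open>auto simp: sol_def solve_def\<close>)
  finally show ?thesis .
qed

end

section \<open>Carving with sparse layers\<close>

text \<open>A sum over a ball that can be read off an image: the identifiers keep equal summands of
  different vertices apart.\<close>

definition lsum :: "('v \<Rightarrow> 'v set) \<Rightarrow> ('v \<Rightarrow> nat) \<Rightarrow> ('v \<Rightarrow> real) \<Rightarrow> nat \<Rightarrow> 'v \<Rightarrow> real" where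
  "lsum N idt q r v = (\<Sum>y\<in>(\<lambda>u. (idt u, q u)) ` nbhd N r v. snd y)"

lemma (in vgraph) lsum_eq:
  assumes "inj_on idt V" "v \<in> V"
  shows "lsum N idt q r v = sum q (nbhd N r v)"
proof -
  have "inj_on (\<lambda>u. (idt u, q u)) (nbhd N r v)"
    using assms nbhd_sub[OF assms(2)] by (auto simp: inj_on_def)
  then show ?thesis by (simp add: lsum_def sum.reindex)
qed

locale alg_params =
  fixes p \<kappa> :: real and B T g L K :: nat
begin

text \<open>\<open>thr j / 2 ^ B\<close> discretises the tail \<open>(1 - p) ^ j\<close> of a
  geometric radius: up to the truncation, \<open>thr j\<close> of the \<open>2 ^ B\<close> seeds
  give a radius of at least \<open>j\<close>. Rounding up ensures that no step loses more than the
  fraction \<open>p\<close> (\<open>thr_drop\<close>).\<close>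

primrec thr :: "nat \<Rightarrow> nat" where
  "thr 0 = 2 ^ B"
| "thr (Suc j) = nat \<lceil>(1 - p) * real (thr j)\<rceil>"

definition rad :: "nat \<Rightarrow> nat" where
  "rad x = Max {j. j \<le> g \<and> (j = 0 \<or> x < thr j)}"

lemma rad_le: "rad x \<le> g"
proof -
  have "rad x \<in> {j. j \<le> g \<and> (j = 0 \<or> x < thr j)}"
    unfolding rad_def by (rule Max_in) auto
  then show ?thesis by simp
qed

definition geo_centres :: "('v \<Rightarrow> nat) \<Rightarrow> ('v \<Rightarrow> nat) \<Rightarrow> 'v \<Rightarrow> (nat \<times> nat) set" where
  "geo_centres idt x u = {(idt u, rad (x u))}"

definition geo_cluster :: "('v \<Rightarrow> 'v set) \<Rightarrow> ('v \<Rightarrow> nat) \<Rightarrow> ('v \<Rightarrow> nat) \<Rightarrow> 'v \<Rightarrow> nat option" where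
  "geo_cluster N idt x = cluster N (Suc g) (geo_centres idt x)"

text \<open>Phase \<open>i\<close> has the window \<open>{scale i..<scale (i - 1)}\<close> of
  \<open>L\<close> radii, and consecutive windows abut. The innermost value
  \<open>scale T = 2 * Suc g\<close> is chosen so that vertices farther apart than this read
  disjoint sets of geometric radii.\<close>

definition scale :: "nat \<Rightarrow> nat" where
  "scale i = 2 * Suc g + (T - i) * L"

text \<open>The condition refers to \<open>\<nu>\<close> and not to the samples. Centres of all
  phases can therefore fix their radii at once, before it is known which vertices earlier phases
  actually took.\<close>

definition active :: "('v \<Rightarrow> 'v set) \<Rightarrow> ('v \<Rightarrow> nat) \<Rightarrow> ('v \<Rightarrow> real) \<Rightarrow> nat \<Rightarrow> 'v \<Rightarrow> bool" where
  "active N idt \<nu> i v \<longleftrightarrow> (\<forall>j\<in>{1..<i}. lsum N idt \<nu> (scale j) v < 1 / 2 ^ j)"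

definition layer_mass ::
    "('v \<Rightarrow> 'v set) \<Rightarrow> ('v \<Rightarrow> nat) \<Rightarrow> ('v \<Rightarrow> real) \<Rightarrow> ('v \<Rightarrow> real) \<Rightarrow> nat \<Rightarrow> 'v \<Rightarrow> nat \<Rightarrow> real" where
  "layer_mass N idt \<mu> \<nu> i u r =
     lsum N idt (\<lambda>v. if active N idt \<nu> i v then \<mu> v else 0) (Suc r) u -
     lsum N idt (\<lambda>v. if active N idt \<nu> i v then \<mu> v else 0) r u"

definition carve_radius ::
    "('v \<Rightarrow> 'v set) \<Rightarrow> ('v \<Rightarrow> nat) \<Rightarrow> ('v \<Rightarrow> real) \<Rightarrow> ('v \<Rightarrow> real) \<Rightarrow> nat \<Rightarrow> 'v \<Rightarrow> nat" where
  "carve_radius N idt \<mu> \<nu> i u =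
     arg_min_on (layer_mass N idt \<mu> \<nu> i u) {scale i..<scale (i - 1)}"

definition sampled :: "('v \<Rightarrow> real) \<Rightarrow> ('v \<Rightarrow> nat \<Rightarrow> nat) \<Rightarrow> nat \<Rightarrow> 'v \<Rightarrow> bool" where
  "sampled \<nu> s i u \<longleftrightarrow> real (s u i) < \<kappa> * 2 ^ i * \<nu> u * 2 ^ B"

text \<open>With identifiers below \<open>2 ^ B\<close> the keys are ordered by phase first and
  identifier second, so earlier phases win. Every vertex is a centre of phase \<open>Suc T\<close>,
  hence every vertex is touched.\<close>

definition carve_centres ::
    "('v \<Rightarrow> 'v set) \<Rightarrow> ('v \<Rightarrow> nat) \<Rightarrow> ('v \<Rightarrow> real) \<Rightarrow> ('v \<Rightarrow> real) \<Rightarrow> ('v \<Rightarrow> nat \<Rightarrow> nat) \<Rightarrow>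
     'v \<Rightarrow> (nat \<times> nat) set" where
  "carve_centres N idt \<mu> \<nu> s u =
     insert (Suc T * 2 ^ B + idt u, rad (s u (Suc T)))
       {(i * 2 ^ B + idt u, carve_radius N idt \<mu> \<nu> i u) | i. i \<in> {1..T} \<and> sampled \<nu> s i u}"

definition carve_cluster ::
    "('v \<Rightarrow> 'v set) \<Rightarrow> ('v \<Rightarrow> nat) \<Rightarrow> ('v \<Rightarrow> real) \<Rightarrow> ('v \<Rightarrow> real) \<Rightarrow> ('v \<Rightarrow> nat \<Rightarrow> nat) \<Rightarrow>
     'v \<Rightarrow> nat option" where
  "carve_cluster N idt \<mu> \<nu> s = cluster N (scale 0) (carve_centres N idt \<mu> \<nu> s)"

lemma scale_antimono: "i \<le> j \<Longrightarrow> scale j \<le> scale i"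
  unfolding scale_def by (intro add_mono mult_le_mono1 diff_le_mono2 order_refl)

lemma scale_step: "1 \<le> i \<Longrightarrow> i \<le> T \<Longrightarrow> scale (i - 1) = scale i + L"
proof -
  assume "1 \<le> i" "i \<le> T"
  then have "T - (i - 1) = Suc (T - i)" by simp
  then show ?thesis unfolding scale_def by simp
qed

end

locale labelled_graph = vgraph V N + alg_params p \<kappa> B T g L K
  for V :: "'v set" and N and p \<kappa> B T g L K +
  fixes idt :: "'v \<Rightarrow> nat"
  assumes id_inj: "inj_on idt V"
begin

lemma geo_interp: "centres V N (geo_centres idt x) (Suc g)"
  by unfold_locales
    (use rad_le inj_onD[OF id_inj] in \<open>auto simp: geo_centres_def\<close>)

end

text \<open>The carving knows \<open>\<nu>\<close> only through these bounds: balls of radius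
  \<open>scale 0\<close> have measure at most 1, and a set of small \<open>\<nu>\<close>-measure
  carries a small share of the mass \<open>\<mu>\<close>.\<close>

locale carving = labelled_graph V N p \<kappa> B T g L K idt
  for V :: "'v set" and N p \<kappa> B T g L K idt +
  fixes \<mu> \<nu> :: "'v \<Rightarrow> real"
  assumes id_less: "u \<in> V \<Longrightarrow> idt u < 2 ^ B"
    and mu_nonneg: "u \<in> V \<Longrightarrow> 0 \<le> \<mu> u"
    and nu_nonneg: "u \<in> V \<Longrightarrow> 0 \<le> \<nu> u"
    and nu_scale0: "u \<in> V \<Longrightarrow> sum \<nu> (nbhd N (scale 0) u) \<le> 1"
    and mu_le_nu: "u \<in> V \<Longrightarrow> \<mu> u \<le> sum \<mu> V * \<nu> u"
    and L_pos: "0 < L" and T_pos: "0 < T" and kappa_ge: "1 \<le> \<kappa>"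
begin

abbreviation "act \<equiv> active N idt \<nu>"
abbreviation "crad \<equiv> carve_radius N idt \<mu> \<nu>"
abbreviation "smp \<equiv> sampled \<nu>"
abbreviation "clu \<equiv> carve_cluster N idt \<mu> \<nu>"

lemma act_iff: "v \<in> V \<Longrightarrow> act i v \<longleftrightarrow> (\<forall>j\<in>{1..<i}. sum \<nu> (nbhd N (scale j) v) < 1 / 2 ^ j)"
  by (simp add: active_def lsum_eq[OF id_inj])

lemma act_nu:
  assumes "v \<in> V" "act i v" "1 \<le> i"
  shows "sum \<nu> (nbhd N (scale (i - 1)) v) \<le> 1 / 2 ^ (i - 1)"
proof (cases "i = 1")
  case True
  then show ?thesis using nu_scale0 assms(1) by simp
next
  case False
  then have "i - 1 \<in> {1..<i}" using assms(3) by auto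
  then show ?thesis using assms act_iff less_imp_le by blast
qed

lemma crad_in: "1 \<le> i \<Longrightarrow> i \<le> T \<Longrightarrow> crad i u \<in> {scale i..<scale (i - 1)}"
  unfolding carve_radius_def using scale_step[of i] L_pos
  by (intro arg_min_if_finite(1)) auto

text \<open>The least of the \<open>L\<close> layers in the window is at most their average, and
  their masses telescope to at most that of the ball of radius \<open>scale (i - 1)\<close>.\<close>

lemma crad_mass:
  assumes "1 \<le> i" "i \<le> T" "u \<in> V"
  shows "real L * (\<Sum>v | v \<in> nbhd N (Suc (crad i u)) u - nbhd N (crad i u) u \<and> act i v. \<mu> v)
           \<le> (\<Sum>v | v \<in> nbhd N (scale (i - 1)) u \<and> act i v. \<mu> v)"
proof -
  let ?q = "\<lambda>v. if act i v then \<mu> v else 0"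
  let ?s = "\<lambda>r. sum ?q (nbhd N r u)"
  let ?lm = "layer_mass N idt \<mu> \<nu> i u"
  let ?I = "{scale i..<scale (i - 1)}"
  have lm: "?lm r = ?s (Suc r) - ?s r" for r
    by (simp only: layer_mass_def lsum_eq[OF id_inj assms(3)])
  have lm': "?lm r = (\<Sum>v | v \<in> nbhd N (Suc r) u - nbhd N r u \<and> act i v. \<mu> v)" for r
  proof -
    have "?lm r = sum ?q (nbhd N (Suc r) u - nbhd N r u)"
      unfolding lm using nbhd_mono[of r "Suc r" N u] finite_nbhd[OF assms(3)]
      by (intro sum_diff[symmetric]) (auto)
    also have "\<dots> = sum \<mu> {v \<in> nbhd N (Suc r) u - nbhd N r u. act i v}"
      by (rule sum.inter_filter[symmetric]) (intro finite_Diff finite_nbhd assms(3))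
    finally show ?thesis .
  qed
  have le: "?lm (crad i u) \<le> ?lm r" if "r \<in> ?I" for r
    unfolding carve_radius_def by (rule arg_min_least) (use that in auto)
  have "real L * ?lm (crad i u) = (\<Sum>r\<in>?I. ?lm (crad i u))"
    using scale_step[OF assms(1,2)] by simp
  also have "\<dots> \<le> (\<Sum>r\<in>?I. ?lm r)" by (rule sum_mono) (rule le)
  also have "\<dots> = ?s (scale (i - 1)) - ?s (scale i)"
    unfolding lm by (rule sum_Suc_diff') (use scale_step[OF assms(1,2)] in simp)
  also have "\<dots> \<le> ?s (scale (i - 1))"
    using mu_nonneg subsetD[OF nbhd_sub[OF assms(3)]] by (simp add: sum_nonneg)
  also have "\<dots> = (\<Sum>v | v \<in> nbhd N (scale (i - 1)) u \<and> act i v. \<mu> v)"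
    by (rule sum.inter_filter[symmetric]) (rule finite_nbhd[OF assms(3)])
  finally show ?thesis unfolding lm' .
qed

lemma key_eq_iff:
  "u \<in> V \<Longrightarrow> u' \<in> V \<Longrightarrow> i * 2 ^ B + idt u = j * 2 ^ B + idt u' \<longleftrightarrow> i = j \<and> u = u'"
proof
  assume *: "u \<in> V" "u' \<in> V" "i * 2 ^ B + idt u = j * 2 ^ B + idt u'"
  have "i = (i * 2 ^ B + idt u) div 2 ^ B" "j = (j * 2 ^ B + idt u') div 2 ^ B"
    using id_less[OF *(1)] id_less[OF *(2)] by simp_all
  then have "i = j" using * by metis
  then show "i = j \<and> u = u'" using * inj_onD[OF id_inj] by auto
qed auto

lemma key_le: "u \<in> V \<Longrightarrow> u' \<in> V \<Longrightarrow> i * 2 ^ B + idt u \<le> j * 2 ^ B + idt u' \<Longrightarrow> i \<le> j"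
proof (rule ccontr)
  assume *: "u \<in> V" "u' \<in> V" "i * 2 ^ B + idt u \<le> j * 2 ^ B + idt u'" "\<not> i \<le> j"
  then have "Suc j * 2 ^ B \<le> i * 2 ^ B" by (intro mult_le_mono1) simp
  then show False using *(3) id_less[OF *(2)] by simp
qed

lemma carve_interp: "centres V N (carve_centres N idt \<mu> \<nu> s) (scale 0)"
proof unfold_locales
  fix k r u assume "(k, r) \<in> carve_centres N idt \<mu> \<nu> s u"
  then consider "r = rad (s u (Suc T))" | i where "1 \<le> i" "i \<le> T" "r = crad i u"
    by (auto simp: carve_centres_def)
  then show "Suc r \<le> scale 0"
  proof cases
    case 1
    then show ?thesis using rad_le[of "s u (Suc T)"] by (simp add: scale_def)
  next
    case 2
    then have "r < scale (i - 1)" using crad_in[of i u] by simp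
    then show ?thesis using scale_antimono[of 0 "i - 1"] by simp
  qed
next
  fix k r u r' u'
  assume V: "u \<in> V" "u' \<in> V" and
    "(k, r) \<in> carve_centres N idt \<mu> \<nu> s u" "(k, r') \<in> carve_centres N idt \<mu> \<nu> s u'"
  then show "u = u' \<and> r = r'"
    using key_eq_iff[OF V, of "Suc T" "Suc T"] key_eq_iff[OF V] key_eq_iff[OF V, of "Suc T"]
      key_eq_iff[OF V, of _ "Suc T"]
    unfolding carve_centres_def by (auto simp del: mult_Suc)
qed

section \<open>Good events of the carving and the mass deleted under them\<close>

definition hits :: "('v \<Rightarrow> nat \<Rightarrow> nat) \<Rightarrow> bool" where
  "hits s \<longleftrightarrow> (\<forall>v\<in>V. \<forall>i\<in>{1..T}. 1 / 2 ^ i \<le> sum \<nu> (nbhd N (scale i) v) \<longrightarrow>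
     (\<exists>u\<in>nbhd N (scale i) v. smp s i u))"

definition sparse :: "('v \<Rightarrow> nat \<Rightarrow> nat) \<Rightarrow> bool" where
  "sparse s \<longleftrightarrow> (\<forall>v\<in>V. \<forall>i\<in>{1..T}. sum \<nu> (nbhd N (scale (i - 1)) v) \<le> 1 / 2 ^ (i - 1) \<longrightarrow>
     real (card {u \<in> nbhd N (scale (i - 1)) v. smp s i u}) \<le> 7 * \<kappa>)"

text \<open>The geometric clustering is taken on its own here, as if no phase preceded it, and only
  samples of phase \<open>T\<close> are consulted. The two conditions then read disjoint groups of
  seeds, which makes the product bound of \<open>pr_all_lost\<close> possible.\<close>

definition lost :: "('v \<Rightarrow> nat \<Rightarrow> nat) \<Rightarrow> 'v \<Rightarrow> bool" where
  "lost s v \<longleftrightarrow> geo_cluster N idt (\<lambda>u. s u (Suc T)) v = None \<and>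
     (\<forall>u\<in>nbhd N (2 * Suc g) v. \<not> smp s T u)"

definition cut_layer :: "nat \<Rightarrow> 'v \<Rightarrow> 'v set" where
  "cut_layer i u = {v. v \<in> nbhd N (Suc (crad i u)) u - nbhd N (crad i u) u \<and> act i v}"

text \<open>Consider the least key that touches \<open>v\<close>. If it belongs to the last phase,
  no earlier centre touches \<open>v\<close>, and the geometric clustering alone deletes
  \<open>v\<close> as well. If it belongs to phase \<open>i\<close>, then \<open>v\<close> lies on
  the cut of that centre, and it is active: otherwise \<open>hits\<close> would supply a touching
  centre of an earlier phase.\<close>

lemma deleted_cases:
  assumes "hits s" "v \<in> V" "clu s v = None"
  shows "lost s v \<or> (\<exists>i\<in>{1..T}. \<exists>u\<in>V. smp s i u \<and> v \<in> cut_layer i u)"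
proof -
  interpret centres V N "carve_centres N idt \<mu> \<nu> s" "scale 0" by (rule carve_interp)
  interpret geo: centres V N "geo_centres idt (\<lambda>u. s u (Suc T))" "Suc g" by (rule geo_interp)
  have None: "clab v = None" using assms(3) by (simp add: carve_cluster_def)
  let ?cc = "carve_centres N idt \<mu> \<nu> s"
  have own: "(Suc T * 2 ^ B + idt v, rad (s v (Suc T))) \<in> ?cc v" by (simp add: carve_centres_def)
  obtain k r u where k: "(k, r) \<in> ?cc u" "u \<in> nbhd N (Suc r) v" "u \<notin> nbhd N r v"
    and min: "\<And>k' r' u'. (k', r') \<in> ?cc u' \<Longrightarrow> u' \<in> nbhd N (Suc r') v \<Longrightarrow> k \<le> k'"
    using clab_NoneD[OF None own self_in_nbhd] by metis
  have u: "u \<in> V" using k(2) nbhd_sub[OF assms(2)] by blast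
  have phase: "k \<le> i * 2 ^ B + idt u'" if "i \<in> {1..T}" "smp s i u'" "u' \<in> nbhd N (Suc (crad i u')) v" for i u'
    by (rule min[of _ "crad i u'" u']) (use that in \<open>auto simp: carve_centres_def\<close>)
  \<comment> \<open>Within distance \<open>scale i\<close> a sampled centre touches \<open>v\<close>
    whichever radius of its window it has chosen.\<close>
  have phase': "k \<le> i * 2 ^ B + idt u'" if "i \<in> {1..T}" "smp s i u'" "u' \<in> nbhd N (scale i) v" for i u'
  proof (rule phase[OF that(1,2)])
    have "scale i \<le> Suc (crad i u')" using crad_in[of i u'] that(1) by simp
    then show "u' \<in> nbhd N (Suc (crad i u')) v" using subsetD[OF nbhd_mono] that(3) by metis
  qed
  from k(1) consider (geo) "k = Suc T * 2 ^ B + idt u" "r = rad (s u (Suc T))"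
    | (phase) i where "i \<in> {1..T}" "smp s i u" "k = i * 2 ^ B + idt u" "r = crad i u"
    by (auto simp: carve_centres_def)
  then show ?thesis
  proof cases
    case geo
    have no: "\<not> smp s T u'" if "u' \<in> nbhd N (2 * Suc g) v" for u'
    proof
      assume "smp s T u'"
      moreover have "u' \<in> V" using that nbhd_sub[OF assms(2)] by blast
      ultimately show False
        using key_le[OF u, of u' "Suc T" T] phase'[of T u'] T_pos that geo(1)
        by (simp add: scale_def del: mult_Suc)
    qed
    have "geo_cluster N idt (\<lambda>u. s u (Suc T)) v = None"
    proof (rule ccontr)
      assume "geo_cluster N idt (\<lambda>u. s u (Suc T)) v \<noteq> None"
      then obtain l where l: "geo.clab v = Some l" by (auto simp: geo_cluster_def)
      obtain u' where u': "l = idt u'" "u' \<in> nbhd N (rad (s u' (Suc T))) v"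
        using geo.clab_SomeD(1)[OF l] by (auto simp: geo_centres_def)
      have "l \<le> idt u"
        by (rule geo.clab_SomeD(2)[OF l, of _ r u]) (use geo k in \<open>auto simp: geo_centres_def\<close>)
      moreover have "k \<le> Suc T * 2 ^ B + idt u'"
      proof (rule min)
        show "u' \<in> nbhd N (Suc (rad (s u' (Suc T)))) v"
          using subsetD[OF nbhd_mono[of _ "Suc _"]] u'(2) le_SucI order_refl by metis
      qed (simp add: carve_centres_def)
      ultimately have "idt u = idt u'" using geo u' by simp
      moreover have "u' \<in> V" using u'(2) nbhd_sub[OF assms(2)] by blast
      ultimately have "u = u'" using u inj_onD[OF id_inj] by blast
      then show False using k u' geo by simp
    qed
    then show ?thesis using no by (simp add: lost_def)
  next
    case phase
    have "act i v" unfolding act_iff[OF assms(2)]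
    proof (rule ballI, rule ccontr)
      fix j assume j: "j \<in> {1..<i}" "\<not> sum \<nu> (nbhd N (scale j) v) < 1 / 2 ^ j"
      then have "j \<in> {1..T}" "1 / 2 ^ j \<le> sum \<nu> (nbhd N (scale j) v)" using phase(1) by auto
      then obtain u' where u': "u' \<in> nbhd N (scale j) v" "smp s j u'"
        using assms(1,2) unfolding hits_def by blast
      then have "i * 2 ^ B + idt u \<le> j * 2 ^ B + idt u'" using phase' \<open>j \<in> {1..T}\<close> phase(3) by blast
      moreover have "u' \<in> V" using u'(1) nbhd_sub[OF assms(2)] by blast
      ultimately have "i \<le> j" using key_le u by blast
      then show False using j(1) by simp
    qed
    then have "v \<in> cut_layer i u"
      using k(2,3) phase(4) nbhd_commute unfolding cut_layer_def by blast
    then show ?thesis using phase u by blast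
  qed
qed

text \<open>Double counting: a centre of phase \<open>i\<close> pays for its cut with
  \<open>1 / L\<close> of the active mass within \<open>scale (i - 1)\<close>, and an active vertex
  is charged by at most \<open>7 * \<kappa>\<close> centres of that phase, because
  \<open>act_nu\<close> makes \<open>sparse\<close> applicable to it.\<close>

lemma deleted_mass:
  assumes "hits s" "sparse s"
  shows "(\<Sum>v | v \<in> V \<and> clu s v = None. \<mu> v)
           \<le> 7 * \<kappa> * real T / real L * sum \<mu> V + (\<Sum>v | v \<in> V \<and> lost s v. \<mu> v)"
proof -
  let ?S = "\<lambda>i. {u \<in> V. smp s i u}"
  let ?ph = "\<lambda>v. \<Sum>i\<in>{1..T}. \<Sum>u\<in>?S i. if v \<in> cut_layer i u then \<mu> v else 0"
  have fS: "finite (?S i)" for i using finite_V by simp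
  have nn: "0 \<le> (if v \<in> cut_layer i u then \<mu> v else 0)" if "v \<in> V" for v i u using mu_nonneg that by simp
  have ph0: "0 \<le> ?ph v" if "v \<in> V" for v using nn[OF that] by (intro sum_nonneg)
  have pt: "(if clu s v = None then \<mu> v else 0) \<le> ?ph v + (if lost s v then \<mu> v else 0)" if v: "v \<in> V" for v
  proof (cases "clu s v = None \<and> \<not> lost s v")
    case True
    then obtain i u where iu: "i \<in> {1..T}" "u \<in> ?S i" "v \<in> cut_layer i u"
      using deleted_cases[OF assms(1) v] by blast
    have "\<mu> v = (if v \<in> cut_layer i u then \<mu> v else 0)" using iu by simp
    also have "\<dots> \<le> (\<Sum>u\<in>?S i. if v \<in> cut_layer i u then \<mu> v else 0)"
      by (rule member_le_sum) (use iu fS nn v in auto)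
    also have "\<dots> \<le> ?ph v"
      by (rule member_le_sum[of i]) (use iu in \<open>auto intro!: sum_nonneg nn v simp del: One_nat_def\<close>)
    finally show ?thesis using True by simp
  next
    case False
    then show ?thesis using ph0[OF v] mu_nonneg[OF v] by auto
  qed
  have layer: "(\<Sum>v\<in>V. if v \<in> cut_layer i u then \<mu> v else 0)
      \<le> (\<Sum>v\<in>V. if u \<in> nbhd N (scale (i - 1)) v \<and> act i v then \<mu> v else 0) / real L"
    if i: "i \<in> {1..T}" and u: "u \<in> ?S i" for i u
  proof -
    have uV: "u \<in> V" using u by simp
    have "(\<Sum>v\<in>V. if v \<in> cut_layer i u then \<mu> v else 0) = sum \<mu> {v \<in> V. v \<in> cut_layer i u}"
      by (rule sum.inter_filter[symmetric]) (rule finite_V)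
    also have "{v \<in> V. v \<in> cut_layer i u} = cut_layer i u"
      using nbhd_sub[OF uV] unfolding cut_layer_def by blast
    finally have 1: "(\<Sum>v\<in>V. if v \<in> cut_layer i u then \<mu> v else 0) = sum \<mu> (cut_layer i u)" .
    have "(\<Sum>v\<in>V. if u \<in> nbhd N (scale (i - 1)) v \<and> act i v then \<mu> v else 0)
        = sum \<mu> {v \<in> V. u \<in> nbhd N (scale (i - 1)) v \<and> act i v}"
      by (rule sum.inter_filter[symmetric]) (rule finite_V)
    also have "{v \<in> V. u \<in> nbhd N (scale (i - 1)) v \<and> act i v} = {v. v \<in> nbhd N (scale (i - 1)) u \<and> act i v}"
      using nbhd_sub[OF uV] nbhd_commute by blast
    finally show ?thesis using crad_mass[of i u] i uV L_pos 1
      by (simp add: cut_layer_def pos_le_divide_eq mult.commute)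
  qed
  have col: "(\<Sum>u\<in>?S i. if u \<in> nbhd N (scale (i - 1)) v \<and> act i v then \<mu> v else 0) \<le> 7 * \<kappa> * \<mu> v"
    if i: "i \<in> {1..T}" and v: "v \<in> V" for i v
  proof (cases "act i v")
    case True
    have "(\<Sum>u\<in>?S i. if u \<in> nbhd N (scale (i - 1)) v \<and> act i v then \<mu> v else 0)
        = (\<Sum>u | u \<in> ?S i \<and> u \<in> nbhd N (scale (i - 1)) v. \<mu> v)"
      using True sum.inter_filter[OF fS, of "\<lambda>_. \<mu> v" i "\<lambda>u. u \<in> nbhd N (scale (i - 1)) v"] by simp
    also have "\<dots> = real (card {u \<in> nbhd N (scale (i - 1)) v. smp s i u}) * \<mu> v"
    proof -
      have "{u. u \<in> ?S i \<and> u \<in> nbhd N (scale (i - 1)) v} = {u \<in> nbhd N (scale (i - 1)) v. smp s i u}"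
        using nbhd_sub[OF v] by blast
      then show ?thesis by simp
    qed
    also have "\<dots> \<le> 7 * \<kappa> * \<mu> v"
    proof (rule mult_right_mono[OF _ mu_nonneg[OF v]])
      have "sum \<nu> (nbhd N (scale (i - 1)) v) \<le> 1 / 2 ^ (i - 1)" using act_nu[OF v True] i by simp
      then show "real (card {u \<in> nbhd N (scale (i - 1)) v. smp s i u}) \<le> 7 * \<kappa>"
        using assms(2) v i unfolding sparse_def by blast
    qed
    finally show ?thesis .
  next
    case False
    then show ?thesis using mu_nonneg[OF v] kappa_ge by simp
  qed
  have "(\<Sum>v | v \<in> V \<and> clu s v = None. \<mu> v) = (\<Sum>v\<in>V. if clu s v = None then \<mu> v else 0)"
    by (simp add: sum.inter_filter[OF finite_V])
  also have "\<dots> \<le> (\<Sum>v\<in>V. ?ph v + (if lost s v then \<mu> v else 0))" by (rule sum_mono) (rule pt)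
  also have "\<dots> = (\<Sum>v\<in>V. ?ph v) + (\<Sum>v | v \<in> V \<and> lost s v. \<mu> v)"
    by (simp add: sum.distrib sum.inter_filter[OF finite_V])
  also have "(\<Sum>v\<in>V. ?ph v) = (\<Sum>i\<in>{1..T}. \<Sum>u\<in>?S i. \<Sum>v\<in>V. if v \<in> cut_layer i u then \<mu> v else 0)"
    by (subst sum.swap[where A = V and B = "{1..T}"], rule sum.cong[OF refl], rule sum.swap)
  also have "\<dots> \<le> (\<Sum>i\<in>{1..T}. \<Sum>u\<in>?S i. (\<Sum>v\<in>V. if u \<in> nbhd N (scale (i - 1)) v \<and> act i v then \<mu> v else 0) / real L)"
    by (intro sum_mono layer)
  also have "\<dots> = (\<Sum>i\<in>{1..T}. (\<Sum>v\<in>V. \<Sum>u\<in>?S i. if u \<in> nbhd N (scale (i - 1)) v \<and> act i v then \<mu> v else 0) / real L)"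
    by (subst sum_divide_distrib[symmetric], subst sum.swap, rule refl)
  also have "\<dots> \<le> (\<Sum>i\<in>{1..T}. (\<Sum>v\<in>V. 7 * \<kappa> * \<mu> v) / real L)"
    by (intro sum_mono divide_right_mono col) auto
  also have "\<dots> = 7 * \<kappa> * real T / real L * sum \<mu> V"
    by (simp add: sum_distrib_left[symmetric])
  finally show ?thesis by simp
qed

end

section \<open>Uniform product spaces by counting\<close>

text \<open>Expectations are ratios of finite counts throughout; the passage from the measure on
  random bits happens once, in \<open>prob_bit_fields\<close>.\<close>

definition avg :: "'a set \<Rightarrow> ('a \<Rightarrow> real) \<Rightarrow> real" where
  "avg X f = sum f X / real (card X)"

lemma avg_mono: "(\<And>x. x \<in> X \<Longrightarrow> f x \<le> h x) \<Longrightarrow> avg X f \<le> avg X h"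
  unfolding avg_def by (intro divide_right_mono sum_mono) auto

lemma avg_cong: "(\<And>x. x \<in> X \<Longrightarrow> f x = h x) \<Longrightarrow> avg X f = avg X h"
  unfolding avg_def by (metis sum.cong)

lemma avg_nonneg: "(\<And>x. x \<in> X \<Longrightarrow> 0 \<le> f x) \<Longrightarrow> 0 \<le> avg X f"
  unfolding avg_def by (intro divide_nonneg_nonneg sum_nonneg) auto

lemma avg_add: "avg X (\<lambda>x. f x + h x) = avg X f + avg X h"
  unfolding avg_def by (simp add: sum.distrib add_divide_distrib)

lemma avg_sum: "avg X (\<lambda>x. \<Sum>i\<in>I. f i x) = (\<Sum>i\<in>I. avg X (f i))"
  unfolding avg_def by (simp add: sum.swap[of _ X] sum_divide_distrib)

lemma avg_cmult: "avg X (\<lambda>x. a * f x) = a * avg X f"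
  unfolding avg_def by (simp add: sum_distrib_left)

lemma avg_mult_right: "avg X (\<lambda>x. f x * a) = avg X f * a"
  unfolding avg_def by (simp add: sum_distrib_right)

lemma avg_const: "finite X \<Longrightarrow> X \<noteq> {} \<Longrightarrow> avg X (\<lambda>_. a) = a"
  unfolding avg_def by simp

lemma avg_of_bool_mono:
  "(\<And>x. x \<in> X \<Longrightarrow> P x \<Longrightarrow> Q x) \<Longrightarrow> avg X (\<lambda>x. of_bool (P x)) \<le> avg X (\<lambda>x. of_bool (Q x))"
  by (rule avg_mono) auto

lemma avg_of_bool_not:
  "finite X \<Longrightarrow> X \<noteq> {} \<Longrightarrow> avg X (\<lambda>x. of_bool (\<not> P x)) = 1 - avg X (\<lambda>x. of_bool (P x))"
proof -
  assume "finite X" "X \<noteq> {}"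
  then have "1 = avg X (\<lambda>x. of_bool (P x) + of_bool (\<not> P x))" by (subst avg_const[of X 1, symmetric]) (auto intro: avg_cong)
  then show ?thesis by (simp add: avg_add)
qed

lemma avg_of_bool_Ex:
  assumes "finite I"
  shows "avg X (\<lambda>x. of_bool (\<exists>i\<in>I. P i x)) \<le> (\<Sum>i\<in>I. avg X (\<lambda>x. of_bool (P i x)))"
proof -
  have "of_bool (\<exists>i\<in>I. P i x) \<le> (\<Sum>i\<in>I. of_bool (P i x) :: real)" for x
  proof (cases "\<exists>i\<in>I. P i x")
    case True
    then obtain i where i: "i \<in> I" "P i x" by blast
    have "of_bool (P i x) \<le> (\<Sum>i\<in>I. of_bool (P i x) :: real)"
      by (rule member_le_sum) (use assms i in auto)
    then show ?thesis using True i by simp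
  qed (simp add: sum_nonneg)
  then have "avg X (\<lambda>x. of_bool (\<exists>i\<in>I. P i x)) \<le> avg X (\<lambda>x. \<Sum>i\<in>I. of_bool (P i x))"
    by (intro avg_mono)
  then show ?thesis by (simp add: avg_sum)
qed

lemma avg_of_bool_disj:
  "avg X (\<lambda>x. of_bool (P x \<or> Q x)) \<le> avg X (\<lambda>x. of_bool (P x)) + avg X (\<lambda>x. of_bool (Q x))"
  by (subst avg_add[symmetric], rule avg_mono) auto

lemma avg_markov:
  assumes "\<And>x. x \<in> X \<Longrightarrow> 0 \<le> f x" "0 < a"
  shows "avg X (\<lambda>x. of_bool (a \<le> f x)) \<le> avg X f / a"
proof -
  have "avg X (\<lambda>x. of_bool (a \<le> f x)) \<le> avg X (\<lambda>x. (1 / a) * f x)"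
    by (rule avg_mono) (use assms in auto)
  then show ?thesis by (simp only: avg_cmult) simp
qed

text \<open>Independence is always obtained from dependence on disjoint sets of coordinates
  (\<open>mean_indep\<close>). Quantifying over all functions, not just outcomes, spares membership
  proofs for arguments built with \<open>glue\<close>.\<close>

definition depends :: "'i set \<Rightarrow> (('i \<Rightarrow> 'a) \<Rightarrow> 'b) \<Rightarrow> bool" where
  "depends J f \<longleftrightarrow> (\<forall>x y. (\<forall>i\<in>J. x i = y i) \<longrightarrow> f x = f y)"

lemma dependsI:
  fixes f :: "('i \<Rightarrow> 'a) \<Rightarrow> 'b"
  assumes "\<And>x y. (\<And>i. i \<in> J \<Longrightarrow> x i = y i) \<Longrightarrow> f x = f y"
  shows "depends J f"
  unfolding depends_def
proof (intro allI impI)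
  fix x y :: "'i \<Rightarrow> 'a" assume "\<forall>i\<in>J. x i = y i"
  then show "f x = f y" by (intro assms) blast
qed

lemma dependsD: "depends J f \<Longrightarrow> (\<And>i. i \<in> J \<Longrightarrow> x i = y i) \<Longrightarrow> f x = f y"
  unfolding depends_def by blast

lemma depends_mono: "depends J f \<Longrightarrow> J \<subseteq> J' \<Longrightarrow> depends J' f"
  unfolding depends_def by blast

lemma depends_prod: "(\<And>w. w \<in> W \<Longrightarrow> depends (J w) (f w)) \<Longrightarrow>
    depends (\<Union>w\<in>W. J w) (\<lambda>x. \<Prod>w\<in>W. f w x :: real)"
  by (rule dependsI, rule prod.cong) (auto intro: dependsD)

definition glue :: "'i set \<Rightarrow> ('i \<Rightarrow> 'a) \<Rightarrow> ('i \<Rightarrow> 'a) \<Rightarrow> 'i \<Rightarrow> 'a" where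
  "glue J y z = (\<lambda>i. if i \<in> J then y i else z i)"

locale uniform_space =
  fixes M :: nat
  assumes M_pos: "0 < M"
begin

definition outcomes :: "'i set \<Rightarrow> ('i \<Rightarrow> nat) set" where
  "outcomes I = (I \<rightarrow>\<^sub>E {..<M})"

lemma finite_outcomes: "finite I \<Longrightarrow> finite (outcomes I)"
  unfolding outcomes_def by (rule finite_PiE) auto

lemma outcomes_nonempty: "outcomes I \<noteq> {}"
  using M_pos by (auto simp: outcomes_def PiE_eq_empty_iff)

lemma card_outcomes: "finite I \<Longrightarrow> card (outcomes I) = M ^ card I"
  by (simp add: outcomes_def card_PiE)

abbreviation mean :: "'i set \<Rightarrow> (('i \<Rightarrow> nat) \<Rightarrow> real) \<Rightarrow> real" where
  "mean I f \<equiv> avg (outcomes I) f"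

abbreviation pr :: "'i set \<Rightarrow> (('i \<Rightarrow> nat) \<Rightarrow> bool) \<Rightarrow> real" where
  "pr I P \<equiv> avg (outcomes I) (\<lambda>x. of_bool (P x))"

lemma mean_const: "finite I \<Longrightarrow> mean I (\<lambda>_. a) = a"
  by (simp add: avg_const finite_outcomes outcomes_nonempty)

lemma mean_split:
  assumes "finite I" "J \<subseteq> I"
  shows "mean I f = mean J (\<lambda>y. mean (I - J) (\<lambda>z. f (glue J y z)))"
proof -
  have fin: "finite J" "finite (I - J)" using assms finite_subset by auto
  have bij: "bij_betw (\<lambda>(y, z). glue J y z) (outcomes J \<times> outcomes (I - J)) (outcomes I)"
  proof (rule bij_betw_byWitness[where f' = "\<lambda>x. (restrict x J, restrict x (I - J))"])
    show "\<forall>a\<in>outcomes J \<times> outcomes (I - J).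
        (restrict (case a of (y, z) \<Rightarrow> glue J y z) J, restrict (case a of (y, z) \<Rightarrow> glue J y z) (I - J)) = a"
      by (auto simp: outcomes_def glue_def restrict_def PiE_def extensional_def fun_eq_iff)
    show "\<forall>x\<in>outcomes I. (case (restrict x J, restrict x (I - J)) of (y, z) \<Rightarrow> glue J y z) = x"
      using assms(2) by (auto simp: outcomes_def glue_def restrict_def PiE_def extensional_def fun_eq_iff)
    show "(\<lambda>(y, z). glue J y z) ` (outcomes J \<times> outcomes (I - J)) \<subseteq> outcomes I"
      using assms(2) by (auto simp: outcomes_def glue_def PiE_def extensional_def Pi_def)
    show "(\<lambda>x. (restrict x J, restrict x (I - J))) ` outcomes I \<subseteq> outcomes J \<times> outcomes (I - J)"
      using assms(2) by (auto simp: outcomes_def PiE_def extensional_def Pi_def)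
  qed
  have "card I = card J + card (I - J)"
    using assms by (metis card_Diff_subset card_mono fin(1) le_add_diff_inverse)
  then have card: "real (card (outcomes I)) = real (card (outcomes J)) * real (card (outcomes (I - J)))"
    by (simp add: card_outcomes assms(1) fin power_add)
  have "sum f (outcomes I) = (\<Sum>(y, z)\<in>outcomes J \<times> outcomes (I - J). f (glue J y z))"
    by (subst sum.reindex_bij_betw[OF bij, symmetric]) (auto intro: sum.cong)
  also have "\<dots> = (\<Sum>y\<in>outcomes J. \<Sum>z\<in>outcomes (I - J). f (glue J y z))"
    by (rule sum.cartesian_product[symmetric])
  finally show ?thesis
    by (simp add: avg_def card sum_divide_distrib divide_divide_eq_left mult.commute)
qed

text \<open>Serves to freeze some coordinates, such as those that determine the identifiers or the
  averaged mass, and to bound a failure probability over the others uniformly.\<close>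

lemma mean_conditional_le:
  assumes "finite I" "J \<subseteq> I" "\<And>y. y \<in> outcomes J \<Longrightarrow> mean (I - J) (\<lambda>z. f (glue J y z)) \<le> q"
  shows "mean I f \<le> q"
proof -
  have "mean I f \<le> mean J (\<lambda>_. q)"
    unfolding mean_split[OF assms(1,2)] by (rule avg_mono) (rule assms(3))
  also have "\<dots> = q" using assms finite_subset by (intro mean_const) blast
  finally show ?thesis .
qed

lemma mean_indep:
  assumes "finite I" "J \<subseteq> I" "J' \<subseteq> I" "J \<inter> J' = {}" "depends J f" "depends J' h"
  shows "mean I (\<lambda>x. f x * h x) = mean I f * mean I h"
proof -
  have fin: "finite J" "finite (I - J)" using assms finite_subset by auto
  have f: "f (glue J y z) = f y" for y z
    by (rule dependsD[OF assms(5)]) (simp add: glue_def)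
  have h: "h (glue J y z) = h z" for y z
    by (rule dependsD[OF assms(6)]) (use assms(4) in \<open>auto simp: glue_def\<close>)
  show ?thesis
    unfolding mean_split[OF assms(1,2)] f h
    by (simp add: avg_cmult avg_mult_right avg_const finite_outcomes outcomes_nonempty fin)
qed

lemma mean_prod:
  assumes "finite I" "finite W" "\<And>w. w \<in> W \<Longrightarrow> J w \<subseteq> I" "\<And>w. w \<in> W \<Longrightarrow> depends (J w) (f w)"
    "\<And>w w'. w \<in> W \<Longrightarrow> w' \<in> W \<Longrightarrow> w \<noteq> w' \<Longrightarrow> J w \<inter> J w' = {}"
  shows "mean I (\<lambda>x. \<Prod>w\<in>W. f w x) = (\<Prod>w\<in>W. mean I (f w))"
  using assms(2-)
proof (induction W)
  case empty
  then show ?case by (simp add: mean_const assms(1))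
next
  case (insert w W)
  have "mean I (\<lambda>x. f w x * (\<Prod>w\<in>W. f w x)) = mean I (f w) * mean I (\<lambda>x. \<Prod>w\<in>W. f w x)"
  proof (rule mean_indep[OF assms(1), of "J w" "\<Union>w\<in>W. J w"])
    show "J w \<inter> (\<Union>w\<in>W. J w) = {}" using insert.prems(3)[of w] insert.hyps(2) by blast
    show "depends (\<Union>w\<in>W. J w) (\<lambda>x. \<Prod>w\<in>W. f w x)"
      by (rule depends_prod) (use insert.prems in blast)
  qed (use insert.prems in auto)
  also have "mean I (\<lambda>x. \<Prod>w\<in>W. f w x) = (\<Prod>w\<in>W. mean I (f w))"
    by (rule insert.IH) (use insert.prems in auto)
  finally show ?case using insert.hyps by simp
qed

lemma mean_coordinate:
  assumes "finite I" "i \<in> I"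
  shows "mean I (\<lambda>x. f (x i)) = avg {..<M} f"
proof -
  have bij: "bij_betw (\<lambda>y. y i) (outcomes {i}) {..<M}"
    by (rule bij_betw_byWitness[where f' = "\<lambda>a. (\<lambda>j. if j = i then a else undefined)"])
      (auto simp: outcomes_def PiE_def extensional_def Pi_def fun_eq_iff)
  have g: "glue {i} y z i = y i" for y z by (simp add: glue_def)
  have "mean I (\<lambda>x. f (x i)) = mean {i} (\<lambda>y. f (y i))"
    using assms by (subst mean_split[of I "{i}"]) (simp_all add: g mean_const)
  also have "\<dots> = avg {..<M} f"
    unfolding avg_def using sum.reindex_bij_betw[OF bij, of f] bij_betw_same_card[OF bij] by simp
  finally show ?thesis .
qed

lemma pr_coordinate_less:
  assumes "finite I" "i \<in> I" "a \<le> M"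
  shows "pr I (\<lambda>x. x i < a) = real a / real M"
proof -
  have "{..<M} \<inter> {j. j < a} = {..<a}" using assms(3) by auto
  moreover have "pr I (\<lambda>x. x i < a) = avg {..<M} (\<lambda>j. of_bool (j < a))"
    by (rule mean_coordinate[OF assms(1,2)])
  ultimately show ?thesis by (simp add: avg_def)
qed

lemma exp_le_linear: "0 \<le> t \<Longrightarrow> t \<le> 1 \<Longrightarrow> exp t \<le> 1 + 2 * (t :: real)"
proof -
  assume t: "0 \<le> t" "t \<le> 1"
  then have "exp t \<le> 1 + t + t\<^sup>2" by (rule exp_bound)
  moreover have "t\<^sup>2 \<le> t" using t by (simp add: power2_eq_square mult_left_le)
  ultimately show ?thesis by simp
qed

text \<open>Exponential Markov inequality with exponent 1: on \<open>[0, 1]\<close> one has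
  \<open>exp t \<le> 1 + 2 * t\<close>, so each factor has mean at most
  \<open>exp (2 * mean I (f w))\<close>. The crude factor 2 suffices because both applications look
  at a value \<open>a\<close> beyond twice the bound \<open>m\<close> by a constant factor.\<close>

lemma chernoff:
  assumes "finite I" "finite W" "\<And>w. w \<in> W \<Longrightarrow> J w \<subseteq> I" "\<And>w. w \<in> W \<Longrightarrow> depends (J w) (f w)"
    "\<And>w w'. w \<in> W \<Longrightarrow> w' \<in> W \<Longrightarrow> w \<noteq> w' \<Longrightarrow> J w \<inter> J w' = {}"
    and "\<And>w x. w \<in> W \<Longrightarrow> 0 \<le> f w x \<and> f w x \<le> 1"
    and "(\<Sum>w\<in>W. mean I (f w)) \<le> m"
  shows "pr I (\<lambda>x. a \<le> (\<Sum>w\<in>W. f w x)) \<le> exp (2 * m - a)"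
proof -
  have "pr I (\<lambda>x. a \<le> (\<Sum>w\<in>W. f w x)) = pr I (\<lambda>x. exp a \<le> (\<Prod>w\<in>W. exp (f w x)))"
    by (simp add: exp_sum[OF assms(2), symmetric])
  also have "\<dots> \<le> mean I (\<lambda>x. \<Prod>w\<in>W. exp (f w x)) / exp a"
    by (rule avg_markov) (auto intro: prod_nonneg)
  also have "mean I (\<lambda>x. \<Prod>w\<in>W. exp (f w x)) = (\<Prod>w\<in>W. mean I (\<lambda>x. exp (f w x)))"
    by (rule mean_prod[OF assms(1,2), of J])
      (use assms(3-5) in \<open>auto simp: depends_def\<close>)
  also have "\<dots> \<le> (\<Prod>w\<in>W. exp (2 * mean I (f w)))"
  proof (rule prod_mono, safe)
    fix w assume w: "w \<in> W"
    show "0 \<le> mean I (\<lambda>x. exp (f w x))" by (rule avg_nonneg) simp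
    have "mean I (\<lambda>x. exp (f w x)) \<le> mean I (\<lambda>x. 1 + 2 * f w x)"
      by (rule avg_mono) (use assms(6) w exp_le_linear in blast)
    also have "\<dots> = 1 + 2 * mean I (f w)"
      by (simp add: avg_add avg_cmult mean_const assms(1))
    also have "\<dots> \<le> exp (2 * mean I (f w))" by (rule exp_ge_add_one_self)
    finally show "mean I (\<lambda>x. exp (f w x)) \<le> exp (2 * mean I (f w))" .
  qed
  also have "\<dots> = exp (2 * (\<Sum>w\<in>W. mean I (f w)))"
    by (simp add: exp_sum[OF assms(2)] sum_distrib_left)
  also have "\<dots> \<le> exp (2 * m)" using assms(7) by simp
  finally show ?thesis by (simp add: divide_right_mono exp_diff)
qed

end

section \<open>Geometric radii\<close>

lemma cluster_cong:
  assumes "\<And>u. u \<in> nbhd N \<rho> v \<Longrightarrow> cd u = cd' u"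
  shows "cluster N \<rho> cd v = cluster N \<rho> cd' v"
proof -
  have "cd u = cd' u" if "j \<le> \<rho>" "u \<in> nbhd N j v" for j u
    using assms subsetD[OF nbhd_mono[OF that(1)] that(2)] by blast
  then have "scan N \<rho> cd v = scan N \<rho> cd' v"
    by (auto simp: scan_def fun_eq_iff intro!: image_cong)
  then show ?thesis by (simp add: cluster_def)
qed

text \<open>\<open>tail\<close> makes a seed reach the truncation radius \<open>g\<close> with
  probability at most \<open>p / card V\<close>, so that truncation costs at most \<open>p\<close>
  over all centres together.\<close>

locale geo_space = labelled_graph V N p \<kappa> B T g L K idt + uniform_space "2 ^ B"
  for V :: "'v set" and N p \<kappa> B T g L K idt +
  assumes p_pos: "0 < p" and p_le1: "p \<le> 1"
    and tail: "real (card V) * real (thr g) \<le> p * 2 ^ B"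
begin

lemma thr_Suc_le: "thr (Suc j) \<le> thr j"
proof -
  have "(1 - p) * real (thr j) \<le> 1 * real (thr j)"
    by (rule mult_right_mono) (use p_pos in auto)
  then have "\<lceil>(1 - p) * real (thr j)\<rceil> \<le> int (thr j)" by (simp add: ceiling_le_iff)
  then show ?thesis by (simp only: thr.simps nat_le_iff)
qed

lemma thr_antimono: "i \<le> j \<Longrightarrow> thr j \<le> thr i"
  by (rule lift_Suc_antimono_le[of thr]) (use thr_Suc_le in auto)

lemma thr_drop: "real (thr j) - real (thr (Suc j)) \<le> p * real (thr j)"
proof -
  have "(1 - p) * real (thr j) \<le> real (thr (Suc j))"
    by (simp add: real_nat_ceiling_ge)
  then show ?thesis by (simp add: algebra_simps)
qed

lemma rad_ge_iff: "j \<le> g \<Longrightarrow> x < 2 ^ B \<Longrightarrow> j \<le> rad x \<longleftrightarrow> x < thr j"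
proof -
  assume j: "j \<le> g" and x: "x < 2 ^ B"
  let ?S = "{j. j \<le> g \<and> (j = 0 \<or> x < thr j)}"
  have fin: "finite ?S" by simp
  have "j \<le> rad x \<longleftrightarrow> (\<exists>i\<in>?S. j \<le> i)"
    unfolding rad_def by (rule Max_ge_iff) (use fin in auto)
  also have "\<dots> \<longleftrightarrow> x < thr j"
  proof
    assume "\<exists>i\<in>?S. j \<le> i"
    then obtain i where i: "i = 0 \<or> x < thr i" "j \<le> i" by blast
    then show "x < thr j" using thr_antimono[OF i(2)] x by (cases "i = 0") auto
  next
    assume "x < thr j"
    then show "\<exists>i\<in>?S. j \<le> i" using j by (intro bexI[of _ j]) auto
  qed
  finally show ?thesis .
qed

lemma coordinate_less: "i \<in> I \<Longrightarrow> x \<in> outcomes I \<Longrightarrow> x i < 2 ^ B"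
  by (auto simp: outcomes_def)

lemma pr_rad_ge:
  assumes "finite I" "i \<in> I" "j \<le> g"
  shows "pr I (\<lambda>x. j \<le> rad (x i)) = real (thr j) / 2 ^ B"
proof -
  have "pr I (\<lambda>x. j \<le> rad (x i)) = pr I (\<lambda>x. x i < thr j)"
    by (rule avg_cong) (simp add: rad_ge_iff[OF assms(3)] coordinate_less[OF assms(2)])
  then show ?thesis
    using pr_coordinate_less[OF assms(1,2), of "thr j"] thr_antimono[of 0 j] by simp
qed

text \<open>Memorylessness: a radius that has got as far as \<open>d - 1\<close> stops there with
  probability at most \<open>p\<close>, by \<open>thr_drop\<close>. At the truncation value this
  fails, and \<open>tail\<close> gives the second summand.\<close>

lemma pr_rad_eq:
  assumes "finite I" "i \<in> I" "0 < card V"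
  shows "pr I (\<lambda>x. Suc (rad (x i)) = d) \<le> p * pr I (\<lambda>x. d \<le> Suc (rad (x i))) + p / real (card V)"
proof -
  have pn: "0 \<le> p / real (card V)" using p_pos by simp
  have nn: "0 \<le> pr I (\<lambda>x. d \<le> Suc (rad (x i)))" by (rule avg_nonneg) simp
  consider "d = 0 \<or> d > Suc g" | "d = Suc g" | j where "d = Suc j" "j < g"
    by (metis linorder_neqE_nat not0_implies_Suc Suc_less_eq)
  then show ?thesis
  proof cases
    case 1
    then have "Suc (rad y) \<noteq> d" for y using rad_le[of y] by auto
    then have "pr I (\<lambda>x. Suc (rad (x i)) = d) = 0" by (simp add: avg_def)
    then show ?thesis using pn mult_nonneg_nonneg[OF less_imp_le[OF p_pos] nn] by linarith
  next
    case 2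
    have "pr I (\<lambda>x. Suc (rad (x i)) = d) \<le> pr I (\<lambda>x. g \<le> rad (x i))"
      by (rule avg_of_bool_mono) (use 2 in simp)
    also have "\<dots> \<le> p / real (card V)"
      unfolding pr_rad_ge[OF assms(1,2) order_refl] using tail assms(3) by (simp add: field_simps)
    finally show ?thesis using mult_nonneg_nonneg[OF less_imp_le[OF p_pos] nn] by linarith
  next
    case 3
    have "pr I (\<lambda>x. j \<le> rad (x i)) = pr I (\<lambda>x. Suc (rad (x i)) = d) + pr I (\<lambda>x. Suc j \<le> rad (x i))"
      by (subst avg_add[symmetric], rule avg_cong) (use 3 in auto)
    then have "pr I (\<lambda>x. Suc (rad (x i)) = d) = (real (thr j) - real (thr (Suc j))) / 2 ^ B"
      using 3 by (simp add: pr_rad_ge[OF assms(1,2)] diff_divide_distrib del: thr.simps)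
    also have "\<dots> \<le> p * real (thr j) / 2 ^ B" by (intro divide_right_mono thr_drop) simp
    also have "\<dots> = p * pr I (\<lambda>x. j \<le> rad (x i))" using 3 by (simp add: pr_rad_ge[OF assms(1,2)])
    finally show ?thesis using pn 3 by simp
  qed
qed

lemma geo_depends: "depends (e ` nbhd N (Suc g) v) (\<lambda>x. geo_cluster N idt (\<lambda>u. x (e u)) v)"
  unfolding geo_cluster_def
  by (rule dependsI, rule cluster_cong) (simp add: geo_centres_def)

text \<open>A vertex is deleted only if the first centre touching it, in the order of identifiers,
  does so with its very last step. Whether a smaller centre touches \<open>v\<close> is independent
  of the radius of \<open>u\<close>, so the last step costs a factor \<open>p\<close> compared with
  touching. At most one centre is the first to touch, which sums to \<open>p\<close>; the truncation
  errors give the other \<open>p\<close>. The map \<open>e\<close> leaves open which seed field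
  holds the radii.\<close>

lemma geo_deleted:
  fixes e :: "'v \<Rightarrow> 'i"
  assumes I: "finite I" "e ` V \<subseteq> I" "inj_on e V" and v: "v \<in> V"
  shows "pr I (\<lambda>x. geo_cluster N idt (\<lambda>u. x (e u)) v = None) \<le> 2 * p"
proof -
  \<comment> \<open>Vertices in other components never touch \<open>v\<close>, and the distance
    \<open>d\<close> makes sense only on \<open>R\<close>.\<close>
  define R where "R = {u \<in> V. \<exists>j. u \<in> nbhd N j v}"
  define d where "d u = (LEAST j. u \<in> nbhd N j v)" for u
  have R: "finite R" "R \<subseteq> V" using finite_V by (auto simp: R_def)
  have eI: "e u \<in> I" if "u \<in> V" for u using I(2) that by blast
  have card: "0 < card V" using v finite_V card_gt_0_iff by blast
  have d: "u \<in> nbhd N r v \<longleftrightarrow> d u \<le> r" if "u \<in> R" for u r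
  proof
    assume "u \<in> nbhd N r v" then show "d u \<le> r" unfolding d_def by (rule Least_le)
  next
    assume "d u \<le> r"
    moreover have "\<exists>j. u \<in> nbhd N j v" using that by (simp add: R_def)
    then have "u \<in> nbhd N (d u) v" unfolding d_def by (rule LeastI_ex)
    ultimately show "u \<in> nbhd N r v" using subsetD[OF nbhd_mono] by metis
  qed
  let ?t = "\<lambda>u x. d u \<le> Suc (rad (x (e u)))"
  let ?b = "\<lambda>u x. \<forall>u'\<in>R. idt u' < idt u \<longrightarrow> \<not> ?t u' x"
  let ?c = "\<lambda>u x. Suc (rad (x (e u))) = d u"
  have ev: "\<exists>u\<in>R. ?b u x \<and> ?c u x" if None: "geo_cluster N idt (\<lambda>u. x (e u)) v = None" for x
  proof -
    interpret centres V N "geo_centres idt (\<lambda>u. x (e u))" "Suc g" by (rule geo_interp)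
    have None': "clab v = None" using None by (simp add: geo_cluster_def)
    have own: "(idt v, rad (x (e v))) \<in> geo_centres idt (\<lambda>u. x (e u)) v" by (simp add: geo_centres_def)
    obtain k u r where u: "(k, r) \<in> geo_centres idt (\<lambda>u. x (e u)) u"
        "u \<in> nbhd N (Suc r) v" "u \<notin> nbhd N r v"
        "\<And>k' r' u'. (k', r') \<in> geo_centres idt (\<lambda>u. x (e u)) u' \<Longrightarrow> u' \<in> nbhd N (Suc r') v \<Longrightarrow> k \<le> k'"
      using clab_NoneD[OF None' own self_in_nbhd] by metis
    have k: "k = idt u" "r = rad (x (e u))" using u(1) by (auto simp: geo_centres_def)
    have uR: "u \<in> R" using u(2) nbhd_sub[OF v] unfolding R_def by blast
    have c: "?c u x" using u(2,3) d[OF uR] k by (simp add: le_Suc_eq)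
    have "?b u x"
    proof (intro ballI impI notI)
      fix u' assume u': "u' \<in> R" "idt u' < idt u" "?t u' x"
      have "k \<le> idt u'"
        by (rule u(4)[of "idt u'" "rad (x (e u'))" u']) (use u' d in \<open>auto simp: geo_centres_def\<close>)
      then show False using u'(2) k by simp
    qed
    then show ?thesis using c uR by blast
  qed
  have indep: "pr I (\<lambda>x. ?b u x \<and> P (x (e u))) = pr I (?b u) * pr I (\<lambda>x. P (x (e u)))" if u: "u \<in> R" for u P
  proof -
    have "mean I (\<lambda>x. of_bool (?b u x) * of_bool (P (x (e u)))) = pr I (?b u) * pr I (\<lambda>x. P (x (e u)))"
    proof (rule mean_indep[OF I(1), of "e ` (R - {u})" "{e u}"])
      show "e ` (R - {u}) \<inter> {e u} = {}" using I(3) u R(2) by (auto dest: inj_onD)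
      show "depends (e ` (R - {u})) (\<lambda>x. of_bool (?b u x) :: real)"
      proof (rule dependsI)
        fix x y :: "'i \<Rightarrow> nat" assume *: "\<And>i. i \<in> e ` (R - {u}) \<Longrightarrow> x i = y i"
        have "x (e u') = y (e u')" if "u' \<in> R" "idt u' < idt u" for u'
          by (rule *) (use that in auto)
        then show "of_bool (?b u x) = (of_bool (?b u y) :: real)" by auto
      qed
      show "depends {e u} (\<lambda>x. of_bool (P (x (e u))) :: real)" by (rule dependsI) simp
    qed (use R(2) eI u in auto)
    then show ?thesis by (simp add: of_bool_conj)
  qed
  have first: "(\<Sum>u\<in>R. of_bool (?b u x \<and> ?t u x)) \<le> (1 :: real)" for x
  proof -
    have "card {u \<in> R. ?b u x \<and> ?t u x} \<le> Suc 0"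
    proof (rule card_le_Suc0_iff_eq[THEN iffD2])
      show "\<forall>a1\<in>{u \<in> R. ?b u x \<and> ?t u x}. \<forall>a2\<in>{u \<in> R. ?b u x \<and> ?t u x}. a1 = a2"
      proof (intro ballI)
        fix a b assume *: "a \<in> {u \<in> R. ?b u x \<and> ?t u x}" "b \<in> {u \<in> R. ?b u x \<and> ?t u x}"
        then have "idt a = idt b" by (metis (no_types, lifting) linorder_neqE_nat mem_Collect_eq)
        then show "a = b" using * R(2) id_inj by (auto dest: inj_onD)
      qed
    qed (use R in auto)
    then have "real (card {u \<in> R. ?b u x \<and> ?t u x}) \<le> 1" by simp
    moreover have "R \<inter> {u. ?b u x \<and> ?t u x} = {u \<in> R. ?b u x \<and> ?t u x}" by blast
    ultimately have "real (card (R \<inter> {u. ?b u x \<and> ?t u x})) \<le> 1" by (simp only:)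
    moreover have "(\<Sum>u\<in>R. of_bool (?b u x \<and> ?t u x)) = real (card (R \<inter> {u. ?b u x \<and> ?t u x}))"
      using R(1) by simp
    ultimately show ?thesis by linarith
  qed
  have each: "pr I (\<lambda>x. ?b u x \<and> ?c u x) \<le> p * pr I (\<lambda>x. ?b u x \<and> ?t u x) + p / real (card V)"
    if u: "u \<in> R" for u
  proof -
    have uV: "u \<in> V" using u R by blast
    have b: "0 \<le> pr I (?b u)" "pr I (?b u) \<le> 1"
      using avg_mono[of "outcomes I" "\<lambda>x. of_bool (?b u x)" "\<lambda>_. 1"] mean_const[OF I(1), of 1]
      by (auto intro: avg_nonneg)
    have "pr I (\<lambda>x. ?b u x \<and> ?c u x) = pr I (?b u) * pr I (?c u)" by (rule indep[OF u])
    also have "\<dots> \<le> pr I (?b u) * (p * pr I (?t u) + p / real (card V))"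
      by (rule mult_left_mono[OF pr_rad_eq[OF I(1) eI[OF uV] card] b(1)])
    also have "\<dots> = p * (pr I (?b u) * pr I (?t u)) + pr I (?b u) * (p / real (card V))"
      by (simp add: algebra_simps)
    also have "pr I (?b u) * pr I (?t u) = pr I (\<lambda>x. ?b u x \<and> ?t u x)" by (rule indep[OF u, symmetric])
    also have "pr I (?b u) * (p / real (card V)) \<le> 1 * (p / real (card V))"
      by (rule mult_right_mono) (use b p_pos in auto)
    finally show ?thesis by simp
  qed
  have "pr I (\<lambda>x. geo_cluster N idt (\<lambda>u. x (e u)) v = None) \<le> pr I (\<lambda>x. \<exists>u\<in>R. ?b u x \<and> ?c u x)"
    by (rule avg_of_bool_mono) (rule ev)
  also have "\<dots> \<le> (\<Sum>u\<in>R. pr I (\<lambda>x. ?b u x \<and> ?c u x))" by (rule avg_of_bool_Ex[OF R(1)])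
  also have "\<dots> \<le> (\<Sum>u\<in>R. p * pr I (\<lambda>x. ?b u x \<and> ?t u x) + p / real (card V))"
    by (rule sum_mono) (rule each)
  also have "\<dots> = p * mean I (\<lambda>x. \<Sum>u\<in>R. of_bool (?b u x \<and> ?t u x)) + real (card R) * (p / real (card V))"
    by (simp only: sum.distrib sum_distrib_left[symmetric] avg_sum sum_constant)
  also have "\<dots> \<le> p * mean I (\<lambda>_. 1) + real (card V) * (p / real (card V))"
  proof (intro add_mono mult_left_mono mult_right_mono avg_mono first)
    show "real (card R) \<le> real (card V)" using card_mono[OF finite_V R(2)] by simp
  qed (use p_pos in auto)
  also have "\<dots> = 2 * p" using card mean_const[OF I(1), of 1] by simp
  finally show ?thesis .
qed

end

section \<open>Failure probability of the carving\<close>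

locale random_carving = carving V N p \<kappa> B T g L K idt \<mu> \<nu> + geo_space V N p \<kappa> B T g L K idt
  for V :: "'v set" and N p \<kappa> B T g L K idt \<mu> \<nu> +
  fixes I :: "('v \<times> nat) set"
  assumes fin_I: "finite I" and I_sup: "V \<times> {1..Suc T} \<subseteq> I"
    and card_le: "card V \<le> 2 ^ B" and T_large: "1 \<le> 2 ^ T * p"
begin

lemma coord: "u \<in> V \<Longrightarrow> i \<in> {1..Suc T} \<Longrightarrow> (u, i) \<in> I"
  using I_sup by blast

lemma smp_curry: "smp (curry x) i u \<longleftrightarrow> x (u, i) < nat \<lceil>\<kappa> * 2 ^ i * \<nu> u * 2 ^ B\<rceil>"
proof -
  have "real (x (u, i)) < c \<longleftrightarrow> x (u, i) < nat \<lceil>c\<rceil>" for c :: real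
    by (simp add: zless_nat_eq_int_zless less_ceiling_iff)
  then show ?thesis by (simp add: sampled_def)
qed

lemma rate_nonneg: "u \<in> V \<Longrightarrow> 0 \<le> \<kappa> * 2 ^ i * \<nu> u"
  using nu_nonneg kappa_ge by simp

lemma pr_sampled:
  assumes "u \<in> V" "i \<in> {1..Suc T}"
  shows "pr I (\<lambda>x. smp (curry x) i u) \<le> \<kappa> * 2 ^ i * \<nu> u + 1 / 2 ^ B"
    and "pr I (\<lambda>x. \<not> smp (curry x) i u) \<le> exp (- (\<kappa> * 2 ^ i * \<nu> u))"
proof -
  define c where "c = \<kappa> * 2 ^ i * \<nu> u"
  define a where "a = nat \<lceil>c * 2 ^ B\<rceil>"
  have c: "0 \<le> c" unfolding c_def by (rule rate_nonneg[OF assms(1)])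
  then have a: "c * 2 ^ B \<le> real a" "real a \<le> c * 2 ^ B + 1" unfolding a_def
    by (auto simp: real_nat_ceiling_ge)
  have smp: "smp (curry x) i u \<longleftrightarrow> x (u, i) < a" for x
    unfolding smp_curry a_def c_def ..
  have fin: "finite (outcomes I)" "outcomes I \<noteq> {}"
    using fin_I finite_outcomes outcomes_nonempty by auto
  show "pr I (\<lambda>x. smp (curry x) i u) \<le> \<kappa> * 2 ^ i * \<nu> u + 1 / 2 ^ B"
  proof -
    have "pr I (\<lambda>x. smp (curry x) i u) = pr I (\<lambda>x. x (u, i) < min a (2 ^ B))"
      by (rule avg_cong) (use coordinate_less[OF coord[OF assms]] smp in auto)
    also have "\<dots> = real (min a (2 ^ B)) / 2 ^ B"
      using pr_coordinate_less[OF fin_I coord[OF assms], of "min a (2 ^ B)"] by simp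
    also have "\<dots> \<le> real a / 2 ^ B" by (intro divide_right_mono) auto
    also have "\<dots> \<le> (c * 2 ^ B + 1) / 2 ^ B" using a by (intro divide_right_mono) auto
    also have "\<dots> = c + 1 / 2 ^ B" by (simp add: field_simps)
    finally show ?thesis by (simp add: c_def)
  qed
  show "pr I (\<lambda>x. \<not> smp (curry x) i u) \<le> exp (- (\<kappa> * 2 ^ i * \<nu> u))"
  proof (cases "a \<le> 2 ^ B")
    case True
    have "pr I (\<lambda>x. \<not> smp (curry x) i u) = 1 - real a / 2 ^ B"
      unfolding avg_of_bool_not[OF fin] smp
      using pr_coordinate_less[OF fin_I coord[OF assms], of a] True by simp
    also have "\<dots> \<le> 1 - c" using a by (simp add: field_simps)
    also have "\<dots> \<le> exp (- c)" using exp_ge_add_one_self[of "- c"] by simp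
    finally show ?thesis by (simp add: c_def)
  next
    \<comment> \<open>The rate exceeds 1, and \<open>u\<close> is sampled with certainty.\<close>
    case False
    have "pr I (\<lambda>x. \<not> smp (curry x) i u) = mean I (\<lambda>_. 0)"
      by (rule avg_cong) (use coordinate_less[OF coord[OF assms]] smp False in fastforce)
    then show ?thesis by (simp add: mean_const[OF fin_I])
  qed
qed

lemma smp_depends: "depends {(u, i)} (\<lambda>x. f (smp (curry x) i u))"
  by (rule dependsI) (simp add: smp_curry)

lemma pr_none_sampled:
  assumes "U \<subseteq> V" "i \<in> {1..Suc T}"
  shows "pr I (\<lambda>x. \<forall>u\<in>U. \<not> smp (curry x) i u) \<le> exp (- (\<kappa> * 2 ^ i * sum \<nu> U))"
proof -
  have U: "finite U" using assms finite_V finite_subset by blast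
  have UV: "u \<in> V" if "u \<in> U" for u using assms that by blast
  have "pr I (\<lambda>x. \<forall>u\<in>U. \<not> smp (curry x) i u) = mean I (\<lambda>x. \<Prod>u\<in>U. of_bool (\<not> smp (curry x) i u))"
    by (rule avg_cong) (use U in \<open>auto simp: prod_zero_iff\<close>)
  also have "\<dots> = (\<Prod>u\<in>U. pr I (\<lambda>x. \<not> smp (curry x) i u))"
    by (rule mean_prod[OF fin_I U, of "\<lambda>u. {(u, i)}"]) (use coord[OF UV assms(2)] smp_depends in auto)
  also have "\<dots> \<le> (\<Prod>u\<in>U. exp (- (\<kappa> * 2 ^ i * \<nu> u)))"
    by (rule prod_mono) (use pr_sampled(2)[OF UV assms(2)] in \<open>auto intro!: avg_nonneg\<close>)
  also have "\<dots> = exp (- (\<kappa> * 2 ^ i * sum \<nu> U))"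
    by (simp add: exp_sum[OF U, symmetric] sum_negf sum_distrib_left)
  finally show ?thesis .
qed

lemma pr_some_phase:
  assumes "\<And>v i. v \<in> V \<Longrightarrow> i \<in> {1..T} \<Longrightarrow> pr I (P v i) \<le> q"
  shows "pr I (\<lambda>x. \<exists>v\<in>V. \<exists>i\<in>{1..T}. P v i x) \<le> real (card V) * real T * q"
proof -
  have "pr I (\<lambda>x. \<exists>v\<in>V. \<exists>i\<in>{1..T}. P v i x) \<le> (\<Sum>v\<in>V. \<Sum>i\<in>{1..T}. pr I (P v i))"
    by (rule order_trans[OF avg_of_bool_Ex[OF finite_V]]) (intro sum_mono avg_of_bool_Ex, simp)
  also have "\<dots> \<le> (\<Sum>v\<in>V. \<Sum>i\<in>{1..T}. q)" by (intro sum_mono assms)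
  finally show ?thesis by (simp add: mult.assoc)
qed

lemma pr_not_hits: "pr I (\<lambda>x. \<not> hits (curry x)) \<le> real (card V) * real T * exp (- \<kappa>)"
proof -
  let ?P = "\<lambda>v i x. 1 / 2 ^ i \<le> sum \<nu> (nbhd N (scale i) v) \<and> (\<forall>u\<in>nbhd N (scale i) v. \<not> smp (curry x) i u)"
  have each: "pr I (?P v i) \<le> exp (- \<kappa>)" if v: "v \<in> V" and i: "i \<in> {1..T}" for v i
  proof (cases "1 / 2 ^ i \<le> sum \<nu> (nbhd N (scale i) v)")
    case True
    have "pr I (?P v i) \<le> pr I (\<lambda>x. \<forall>u\<in>nbhd N (scale i) v. \<not> smp (curry x) i u)"
      by (rule avg_of_bool_mono) blast
    also have "\<dots> \<le> exp (- (\<kappa> * 2 ^ i * sum \<nu> (nbhd N (scale i) v)))"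
      by (rule pr_none_sampled[OF nbhd_sub[OF v]]) (use i in auto)
    also have "\<dots> \<le> exp (- \<kappa>)"
    proof -
      have "1 \<le> 2 ^ i * sum \<nu> (nbhd N (scale i) v)" using True by (simp add: field_simps)
      then have "\<kappa> * 1 \<le> \<kappa> * (2 ^ i * sum \<nu> (nbhd N (scale i) v))"
        by (rule mult_left_mono) (use kappa_ge in simp)
      then show ?thesis by (simp add: mult.assoc)
    qed
    finally show ?thesis .
  next
    case False
    then show ?thesis by (simp add: avg_def)
  qed
  have "pr I (\<lambda>x. \<not> hits (curry x)) = pr I (\<lambda>x. \<exists>v\<in>V. \<exists>i\<in>{1..T}. ?P v i x)"
    unfolding hits_def by simp
  also have "\<dots> \<le> real (card V) * real T * exp (- \<kappa>)" by (rule pr_some_phase) (rule each)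
  finally show ?thesis .
qed

lemma pr_not_sparse: "pr I (\<lambda>x. \<not> sparse (curry x)) \<le> real (card V) * real T * exp (- \<kappa>)"
proof -
  let ?n = "\<lambda>v i. nbhd N (scale (i - 1)) v"
  let ?P = "\<lambda>v i x. sum \<nu> (?n v i) \<le> 1 / 2 ^ (i - 1) \<and>
      \<not> real (card {u \<in> ?n v i. smp (curry x) i u}) \<le> 7 * \<kappa>"
  have each: "pr I (?P v i) \<le> exp (- \<kappa>)" if v: "v \<in> V" and i: "i \<in> {1..T}" for v i
  proof (cases "sum \<nu> (?n v i) \<le> 1 / 2 ^ (i - 1)")
    case True
    have nV: "?n v i \<subseteq> V" by (rule nbhd_sub[OF v])
    have fin: "finite (?n v i)" by (rule finite_nbhd[OF v])
    have i': "i \<in> {1..Suc T}" using i by simp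
    obtain j where j: "i = Suc j" using i by (cases i) auto
    have cnt: "(\<Sum>u\<in>?n v i. of_bool (smp (curry x) i u)) = real (card {u \<in> ?n v i. smp (curry x) i u})" for x
      using fin by (simp add: Collect_conj_eq Int_commute)
    have "pr I (?P v i) \<le> pr I (\<lambda>x. 7 * \<kappa> \<le> (\<Sum>u\<in>?n v i. of_bool (smp (curry x) i u)))"
      unfolding cnt by (rule avg_of_bool_mono) linarith
    \<comment> \<open>The mean is at most \<open>2 * \<kappa> + 1\<close>: the rate
      \<open>\<kappa> * 2 ^ i\<close> meets a ball of measure \<open>1 / 2 ^ (i - 1)\<close>, and
      rounding up the rates adds at most 1 in total. The threshold 7 leaves the exponent
      \<open>2 - 3 * \<kappa>\<close>, at most \<open>- \<kappa>\<close> for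
      \<open>\<kappa> \<ge> 1\<close>.\<close>
    also have "\<dots> \<le> exp (2 * (2 * \<kappa> + 1) - 7 * \<kappa>)"
    proof (rule chernoff[OF fin_I fin, of "\<lambda>u. {(u, i)}"])
      show "{(u, i)} \<subseteq> I" if "u \<in> ?n v i" for u using coord[OF subsetD[OF nV that] i'] by simp
      have "(\<Sum>u\<in>?n v i. pr I (\<lambda>x. smp (curry x) i u)) \<le> (\<Sum>u\<in>?n v i. \<kappa> * 2 ^ i * \<nu> u + 1 / 2 ^ B)"
        by (intro sum_mono pr_sampled(1) i') (use nV in blast)
      also have "\<dots> = \<kappa> * 2 ^ i * sum \<nu> (?n v i) + real (card (?n v i)) / 2 ^ B"
        by (simp add: sum.distrib sum_distrib_left)
      also have "\<dots> \<le> \<kappa> * 2 ^ i * (1 / 2 ^ (i - 1)) + 1"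
      proof (intro add_mono mult_left_mono True)
        have "card (?n v i) \<le> 2 ^ B" using card_mono[OF finite_V nV] card_le by linarith
        then have "real (card (?n v i)) \<le> 2 ^ B" by (metis of_nat_le_iff of_nat_numeral of_nat_power)
        then show "real (card (?n v i)) / 2 ^ B \<le> 1" by simp
      qed (use kappa_ge in auto)
      also have "\<dots> = 2 * \<kappa> + 1" using j by simp
      finally show "(\<Sum>u\<in>?n v i. pr I (\<lambda>x. smp (curry x) i u)) \<le> 2 * \<kappa> + 1" .
    qed (auto simp: smp_depends)
    also have "\<dots> \<le> exp (- \<kappa>)" using kappa_ge by simp
    finally show ?thesis .
  next
    case False
    then show ?thesis by (simp add: avg_def)
  qed
  have "pr I (\<lambda>x. \<not> sparse (curry x)) = pr I (\<lambda>x. \<exists>v\<in>V. \<exists>i\<in>{1..T}. ?P v i x)"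
    unfolding sparse_def Bex_def Ball_def by (intro avg_cong arg_cong[of _ _ of_bool]) blast
  also have "\<dots> \<le> real (card V) * real T * exp (- \<kappa>)" by (rule pr_some_phase) (rule each)
  finally show ?thesis .
qed

abbreviation "cov W \<equiv> \<Union>w\<in>W. nbhd N (2 * Suc g) w"

text \<open>The samples of phase \<open>T\<close> and the geometric radii sit in different fields.
  The geometric fate of \<open>w\<close> depends on the radii within \<open>Suc g\<close> only, and
  these balls are disjoint for vertices at distance more than \<open>2 * Suc g\<close>; so all
  events involved are independent.\<close>

lemma pr_all_lost:
  assumes "W \<subseteq> V" and sep: "\<And>w w'. w \<in> W \<Longrightarrow> w' \<in> W \<Longrightarrow> w \<noteq> w' \<Longrightarrow> w' \<notin> nbhd N (2 * Suc g) w"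
  shows "pr I (\<lambda>x. \<forall>w\<in>W. lost (curry x) w) \<le> (2 * p) ^ card W * exp (- (\<kappa> * 2 ^ T * sum \<nu> (cov W)))"
proof -
  have W: "finite W" by (rule finite_subset[OF assms(1) finite_V])
  have cov: "cov W \<subseteq> V" using nbhd_sub assms(1) by blast
  let ?e = "\<lambda>u. (u, Suc T)"
  let ?G = "\<lambda>w x. of_bool (geo_cluster N idt (\<lambda>u. x (?e u)) w = None) :: real"
  let ?S = "\<lambda>x. of_bool (\<forall>u\<in>cov W. \<not> smp (curry x) T u) :: real"
  have wV: "w \<in> V" if "w \<in> W" for w using that assms(1) by blast
  have eI: "?e ` V \<subseteq> I" using coord[of _ "Suc T"] by auto
  have sub: "?e ` nbhd N (Suc g) w \<subseteq> I" if "w \<in> W" for w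
    using nbhd_sub[OF wV[OF that]] eI by blast
  have disj: "?e ` nbhd N (Suc g) w \<inter> ?e ` nbhd N (Suc g) w' = {}" if "w \<in> W" "w' \<in> W" "w \<noteq> w'" for w w'
  proof (rule ccontr)
    assume "?e ` nbhd N (Suc g) w \<inter> ?e ` nbhd N (Suc g) w' \<noteq> {}"
    then obtain u where "u \<in> nbhd N (Suc g) w" "u \<in> nbhd N (Suc g) w'" by blast
    then have "w' \<in> nbhd N (Suc g + Suc g) w" using nbhd_trans nbhd_sym by metis
    then show False using sep[OF that] by (simp add: mult_2)
  qed
  have dep: "depends (?e ` nbhd N (Suc g) w) (?G w)" for w
    using geo_depends[of ?e w] unfolding depends_def by metis
  have "pr I (\<lambda>x. \<forall>w\<in>W. lost (curry x) w) = mean I (\<lambda>x. ?S x * (\<Prod>w\<in>W. ?G w x))"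
  proof (rule avg_cong)
    fix x
    have "(\<forall>w\<in>W. lost (curry x) w) \<longleftrightarrow> (\<forall>u\<in>cov W. \<not> smp (curry x) T u) \<and>
        (\<forall>w\<in>W. geo_cluster N idt (\<lambda>u. x (?e u)) w = None)"
      unfolding lost_def curry_conv by blast
    moreover have "(\<Prod>w\<in>W. ?G w x) = of_bool (\<forall>w\<in>W. geo_cluster N idt (\<lambda>u. x (?e u)) w = None)"
      using W by (auto simp: prod_zero_iff)
    ultimately show "of_bool (\<forall>w\<in>W. lost (curry x) w) = ?S x * (\<Prod>w\<in>W. ?G w x)"
      by (simp only: of_bool_conj)
  qed
  also have "\<dots> = mean I ?S * mean I (\<lambda>x. \<Prod>w\<in>W. ?G w x)"
  proof (rule mean_indep[OF fin_I, of "(\<lambda>u. (u, T)) ` cov W" "?e ` cov W"])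
    show "depends ((\<lambda>u. (u, T)) ` cov W) ?S"
      by (rule dependsI) (simp add: smp_curry)
    have "depends (\<Union>w\<in>W. ?e ` nbhd N (Suc g) w) (\<lambda>x. \<Prod>w\<in>W. ?G w x)"
      by (rule depends_prod) (rule dep)
    then show "depends (?e ` cov W) (\<lambda>x. \<Prod>w\<in>W. ?G w x)"
    proof (rule depends_mono)
      have "nbhd N (Suc g) w \<subseteq> nbhd N (2 * Suc g) w" for w by (rule nbhd_mono) simp
      then show "(\<Union>w\<in>W. ?e ` nbhd N (Suc g) w) \<subseteq> ?e ` cov W" by blast
    qed
  qed (use cov coord[of _ T] coord[of _ "Suc T"] T_pos in auto)
  also have "mean I (\<lambda>x. \<Prod>w\<in>W. ?G w x) = (\<Prod>w\<in>W. mean I (?G w))"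
    by (rule mean_prod[OF fin_I W sub dep disj])
  also have "mean I ?S * (\<Prod>w\<in>W. mean I (?G w)) \<le> exp (- (\<kappa> * 2 ^ T * sum \<nu> (cov W))) * (\<Prod>w\<in>W. 2 * p)"
  proof (intro mult_mono prod_mono conjI)
    show "mean I ?S \<le> exp (- (\<kappa> * 2 ^ T * sum \<nu> (cov W)))"
      by (rule pr_none_sampled[OF cov]) (use T_pos in simp)
    show "mean I (?G w) \<le> 2 * p" if "w \<in> W" for w
      by (rule geo_deleted[OF fin_I eI _ wV[OF that]]) (auto simp: inj_on_def)
  qed (auto intro!: avg_nonneg prod_nonneg)
  finally show ?thesis by (simp only: prod_constant mult.commute)
qed

definition heavy :: "('v \<times> nat \<Rightarrow> nat) \<Rightarrow> bool" where
  "heavy x \<longleftrightarrow> 3 * p * sum \<mu> V < (\<Sum>v | v \<in> V \<and> lost (curry x) v. \<mu> v)"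

text \<open>
  A tuple of lost vertices that are pairwise far apart is extended one vertex at a time. As long as
  its surroundings have small \<open>\<nu>\<close>-measure, most of the lost mass of a heavy outcome lies outside
  them, and averaging over the next vertex costs nothing; once the surroundings are large, the
  absence of samples in them is unlikely enough.
\<close>

lemma pr_heavy_lost:
  assumes mass: "0 < sum \<mu> V" and "W \<subseteq> V"
    and "\<And>w w'. w \<in> W \<Longrightarrow> w' \<in> W \<Longrightarrow> w \<noteq> w' \<Longrightarrow> w' \<notin> nbhd N (2 * Suc g) w"
  shows "pr I (\<lambda>x. (\<forall>w\<in>W. lost (curry x) w) \<and> heavy x) \<le> (2 * p) ^ card W * exp (- \<kappa>)"
  using assms(2,3)
proof (induction "card (V - cov W)" arbitrary: W rule: less_induct)
  case less
  have W: "finite W" by (rule finite_subset[OF less.prems(1) finite_V])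
  have cov: "cov W \<subseteq> V" using nbhd_sub less.prems(1) by blast
  show ?case
  proof (cases "p \<le> sum \<nu> (cov W)")
    \<comment> \<open>Since \<open>2 ^ T * p \<ge> 1\<close>, the rates of phase \<open>T\<close>
      add up to at least \<open>\<kappa>\<close> in the cover.\<close>
    case True
    have "2 ^ T * p \<le> 2 ^ T * sum \<nu> (cov W)" by (rule mult_left_mono[OF True]) simp
    then have "1 \<le> 2 ^ T * sum \<nu> (cov W)" using T_large by linarith
    then have "\<kappa> * 1 \<le> \<kappa> * (2 ^ T * sum \<nu> (cov W))"
      by (rule mult_left_mono) (use kappa_ge in simp)
    then have e: "exp (- (\<kappa> * 2 ^ T * sum \<nu> (cov W))) \<le> exp (- \<kappa>)" by (simp add: mult.assoc)
    have "pr I (\<lambda>x. (\<forall>w\<in>W. lost (curry x) w) \<and> heavy x) \<le> pr I (\<lambda>x. \<forall>w\<in>W. lost (curry x) w)"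
      by (rule avg_of_bool_mono) blast
    also have "\<dots> \<le> (2 * p) ^ card W * exp (- (\<kappa> * 2 ^ T * sum \<nu> (cov W)))"
      by (rule pr_all_lost[OF less.prems])
    also have "\<dots> \<le> (2 * p) ^ card W * exp (- \<kappa>)" using e p_pos by (intro mult_left_mono) auto
    finally show ?thesis .
  next
    case False
    let ?M = "sum \<mu> V"
    let ?R = "V - cov W"
    let ?A = "\<lambda>W x. (\<forall>w\<in>W. lost (curry x) w) \<and> heavy x"
    let ?b = "(2 * p) ^ card W * exp (- \<kappa>)"
    have R: "finite ?R" using finite_V by simp
    have "sum \<mu> (cov W) \<le> (\<Sum>v\<in>cov W. ?M * \<nu> v)"
      by (rule sum_mono) (use mu_le_nu cov in blast)
    also have "\<dots> \<le> ?M * p" unfolding sum_distrib_left[symmetric]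
      using False mass by (intro mult_left_mono) auto
    finally have small: "sum \<mu> (cov W) \<le> ?M * p" .
    \<comment> \<open>\<open>3 * p = p + 2 * p\<close>: at most \<open>p * ?M\<close> of the lost
      mass lies in the cover, so more than \<open>2 * p * ?M\<close> lies outside. The resulting
      weights sum to at most \<open>1 / (2 * p)\<close>, which the factor \<open>2 * p\<close> for
      one more lost vertex cancels.\<close>
    have pt: "of_bool (?A W x) \<le> (\<Sum>v\<in>?R. \<mu> v / (2 * p * ?M) * of_bool (?A (insert v W) x))" for x
    proof (cases "?A W x")
      case True
      let ?Lo = "{v \<in> V. lost (curry x) v}"
      have fLo: "finite ?Lo" using finite_V by simp
      have "3 * p * ?M < sum \<mu> ?Lo" using True by (simp add: heavy_def)
      also have "\<dots> = sum \<mu> (?Lo \<inter> cov W) + sum \<mu> (?Lo - cov W)"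
        by (rule sum.Int_Diff[OF fLo])
      also have "sum \<mu> (?Lo \<inter> cov W) \<le> sum \<mu> (cov W)"
        by (rule sum_mono2) (use cov finite_subset[OF cov finite_V] mu_nonneg in auto)
      finally have "3 * p * ?M < sum \<mu> (cov W) + sum \<mu> (?Lo - cov W)" by (simp add: curry_def)
      moreover have "3 * p * ?M = 2 * p * ?M + ?M * p" by (simp add: algebra_simps)
      ultimately have "2 * p * ?M \<le> sum \<mu> (?Lo - cov W)" using small by linarith
      moreover have "?Lo - cov W = {v \<in> ?R. lost (curry x) v}" by blast
      ultimately have "2 * p * ?M \<le> (\<Sum>v\<in>?R. if lost (curry x) v then \<mu> v else 0)"
        by (simp only: sum.inter_filter[OF R])
      then have "1 \<le> (\<Sum>v\<in>?R. if lost (curry x) v then \<mu> v else 0) / (2 * p * ?M)"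
        using mass p_pos by (simp add: pos_le_divide_eq)
      also have "\<dots> = (\<Sum>v\<in>?R. \<mu> v / (2 * p * ?M) * of_bool (?A (insert v W) x))"
        unfolding sum_divide_distrib using True by (intro sum.cong refl) auto
      finally show ?thesis using True by simp
    next
      case False
      have "0 \<le> (\<Sum>v\<in>?R. \<mu> v / (2 * p * ?M) * of_bool (?A (insert v W) x))"
        using mu_nonneg mass p_pos by (intro sum_nonneg mult_nonneg_nonneg divide_nonneg_nonneg) auto
      moreover have "of_bool (?A W x) = (0 :: real)" using False by simp
      ultimately show ?thesis by linarith
    qed
    have step: "pr I (?A (insert v W)) \<le> 2 * p * ?b" if v: "v \<in> ?R" for v
    proof -
      have v': "v \<notin> W" using v self_in_nbhd[of v N "2 * Suc g"] by blast
      have "card (V - cov (insert v W)) < card (V - cov W)"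
        by (rule psubset_card_mono[OF R]) (use v self_in_nbhd[of v N "2 * Suc g"] in blast)
      then have "pr I (?A (insert v W)) \<le> (2 * p) ^ card (insert v W) * exp (- \<kappa>)"
      proof (rule less.hyps)
        show "insert v W \<subseteq> V" using v less.prems(1) by blast
        show "w' \<notin> nbhd N (2 * Suc g) w" if "w \<in> insert v W" "w' \<in> insert v W" "w \<noteq> w'" for w w'
          using that less.prems(2) v nbhd_sym by blast
      qed
      then show ?thesis using v' W by (simp add: mult.assoc)
    qed
    have "pr I (?A W) \<le> mean I (\<lambda>x. \<Sum>v\<in>?R. \<mu> v / (2 * p * ?M) * of_bool (?A (insert v W) x))"
      by (rule avg_mono) (rule pt)
    also have "\<dots> = (\<Sum>v\<in>?R. \<mu> v / (2 * p * ?M) * pr I (?A (insert v W)))"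
      by (simp only: avg_sum avg_cmult)
    also have "\<dots> \<le> (\<Sum>v\<in>?R. \<mu> v / (2 * p * ?M) * (2 * p * ?b))"
      by (intro sum_mono mult_left_mono step) (use mu_nonneg mass p_pos in auto)
    also have "\<dots> = (sum \<mu> ?R / ?M) * ?b"
      using p_pos by (simp add: sum_distrib_right[symmetric] sum_divide_distrib[symmetric] field_simps)
    also have "\<dots> \<le> 1 * ?b"
    proof (rule mult_right_mono)
      have "sum \<mu> ?R \<le> ?M" by (rule sum_mono2[OF finite_V]) (use mu_nonneg in auto)
      then show "sum \<mu> ?R / ?M \<le> 1" using mass by simp
    qed (use p_pos in simp)
    finally show ?thesis by simp
  qed
qed

lemma pr_heavy: "pr I heavy \<le> exp (- \<kappa>)"
proof (cases "0 < sum \<mu> V")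
  case True
  then show ?thesis using pr_heavy_lost[of "{}"] by simp
next
  case False
  have "\<not> heavy x" for x
  proof -
    have "(\<Sum>v | v \<in> V \<and> lost (curry x) v. \<mu> v) \<le> sum \<mu> V"
      by (rule sum_mono2[OF finite_V]) (use mu_nonneg in auto)
    moreover have "0 \<le> sum \<mu> V" by (rule sum_nonneg) (rule mu_nonneg)
    ultimately show ?thesis using False by (simp add: heavy_def)
  qed
  then show ?thesis by (simp add: avg_def)
qed

lemma pr_deleted_mass:
  "pr I (\<lambda>x. \<not> (\<Sum>v | v \<in> V \<and> clu (curry x) v = None. \<mu> v)
       \<le> (7 * \<kappa> * real T / real L + 3 * p) * sum \<mu> V)
     \<le> (2 * real (card V) * real T + 1) * exp (- \<kappa>)"
proof -
  have "pr I (\<lambda>x. \<not> (\<Sum>v | v \<in> V \<and> clu (curry x) v = None. \<mu> v)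
       \<le> (7 * \<kappa> * real T / real L + 3 * p) * sum \<mu> V)
     \<le> pr I (\<lambda>x. (\<not> hits (curry x) \<or> \<not> sparse (curry x)) \<or> heavy x)"
  proof (rule avg_of_bool_mono, rule ccontr)
    fix x
    assume *: "\<not> (\<Sum>v | v \<in> V \<and> clu (curry x) v = None. \<mu> v)
        \<le> (7 * \<kappa> * real T / real L + 3 * p) * sum \<mu> V"
      "\<not> ((\<not> hits (curry x) \<or> \<not> sparse (curry x)) \<or> heavy x)"
    then show False using deleted_mass[of "curry x"] by (simp add: heavy_def distrib_right)
  qed
  also have "\<dots> \<le> pr I (\<lambda>x. \<not> hits (curry x)) + pr I (\<lambda>x. \<not> sparse (curry x)) + pr I heavy"
    by (rule order_trans[OF avg_of_bool_disj add_right_mono[OF avg_of_bool_disj]])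
  also have "\<dots> \<le> (2 * real (card V) * real T + 1) * exp (- \<kappa>)"
    using pr_not_hits pr_not_sparse pr_heavy by (simp add: algebra_simps)
  finally show ?thesis .
qed

end

section \<open>Averaging independent solutions\<close>

context alg_params begin

definition geo_sol :: "('v \<Rightarrow> 'v set) \<Rightarrow> ('v \<Rightarrow> tag) \<Rightarrow> ('v \<Rightarrow> nat) \<Rightarrow> 'v \<Rightarrow> bool" where
  "geo_sol N tg x = solve N (2 * Suc g) tg (geo_cluster N (\<lambda>u. fst (tg u)) x)"

text \<open>Layout of a seed: field 0 is the identifier, fields \<open>1..T\<close> decide the
  sampling, field \<open>Suc T\<close> is the geometric radius of the last phase, and field
  \<open>T + 2 + k\<close> is the radius in the \<open>k\<close>-th of the \<open>K\<close> averaged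
  runs.\<close>

definition avg_mass :: "('v \<Rightarrow> 'v set) \<Rightarrow> ('v \<Rightarrow> tag) \<Rightarrow> ('v \<Rightarrow> nat \<Rightarrow> nat) \<Rightarrow> 'v \<Rightarrow> real" where
  "avg_mass N tg s v = real (tag_weight (tg v)) *
     (real (card {k \<in> {..<K}. geo_sol N tg (\<lambda>u. s u (T + 2 + k)) v}) / real K)"

text \<open>The radius \<open>2 * scale 0\<close> is such that the ball around \<open>z\<close>
  contains every ball of radius \<open>scale 0\<close> to which \<open>z\<close> belongs; hence the
  measure of the latter is at most 1. If the denominator vanishes, so does the mass of
  \<open>v\<close>, and the quotient 0 is right.\<close>

definition rel_mass :: "('v \<Rightarrow> 'v set) \<Rightarrow> ('v \<Rightarrow> nat) \<Rightarrow> ('v \<Rightarrow> real) \<Rightarrow> 'v \<Rightarrow> real" where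
  "rel_mass N idt \<mu> v = \<mu> v / lsum N idt \<mu> (2 * scale 0) v"

definition decomposition ::
    "('v \<Rightarrow> 'v set) \<Rightarrow> ('v \<Rightarrow> tag) \<Rightarrow> ('v \<Rightarrow> nat \<Rightarrow> nat) \<Rightarrow> 'v \<Rightarrow> nat option" where
  "decomposition N tg s =
     (let idt = \<lambda>u. fst (tg u); \<mu> = avg_mass N tg s
      in carve_cluster N idt \<mu> (rel_mass N idt \<mu>) s)"

definition final_sol :: "('v \<Rightarrow> 'v set) \<Rightarrow> ('v \<Rightarrow> tag) \<Rightarrow> ('v \<Rightarrow> nat \<Rightarrow> nat) \<Rightarrow> 'v \<Rightarrow> bool" where
  "final_sol N tg s = solve N (2 * scale 0) tg (decomposition N tg s)"

lemma carve_cluster_cong: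
  assumes "\<And>u i. i \<in> {1..Suc T} \<Longrightarrow> s u i = s' u i"
  shows "carve_cluster N idt \<mu> \<nu> s = carve_cluster N idt \<mu> \<nu> s'"
proof -
  have "carve_centres N idt \<mu> \<nu> s = carve_centres N idt \<mu> \<nu> s'"
    unfolding carve_centres_def sampled_def using assms by (auto simp: fun_eq_iff)
  then show ?thesis by (simp add: carve_cluster_def)
qed

lemma avg_mass_cong:
  assumes "\<And>u k. k < K \<Longrightarrow> s u (T + 2 + k) = s' u (T + 2 + k)"
  shows "avg_mass N tg s = avg_mass N tg s'"
proof -
  have "{k \<in> {..<K}. geo_sol N tg (\<lambda>u. s u (T + 2 + k)) v} = {k \<in> {..<K}. geo_sol N tg (\<lambda>u. s' u (T + 2 + k)) v}" for v
    using assms by auto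
  then show ?thesis by (simp add: avg_mass_def fun_eq_iff)
qed

end

locale packing_instance = vgraph V N + alg_params p \<kappa> B T g L K + uniform_space "2 ^ B"
  for V :: "'v set" and N and p \<kappa> B T g L K +
  fixes w :: "'v \<Rightarrow> nat" and cs :: "'v \<Rightarrow> (nat \<times> real \<times> real) set"
  assumes cs_finite: "v \<in> V \<Longrightarrow> finite (cs v)"
    and cs_nonneg: "v \<in> V \<Longrightarrow> t \<in> cs v \<Longrightarrow> 0 \<le> fst (snd t)"
    and cs_shared: "u \<in> V \<Longrightarrow> v \<in> V \<Longrightarrow> u \<noteq> v \<Longrightarrow> t \<in> cs u \<Longrightarrow>
      t' \<in> cs v \<Longrightarrow> fst t = fst t' \<Longrightarrow> v \<in> N u"
    and p_pos: "0 < p" and p_small: "9 * p \<le> 1"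
    and tail: "real (card V) * real (thr g) \<le> p * 2 ^ B"
    and L_pos: "0 < L" and T_pos: "0 < T" and K_pos: "0 < K" and kappa_ge: "1 \<le> \<kappa>"
    and L_large: "7 * \<kappa> * real T \<le> p * real L"
    and T_large: "1 \<le> 2 ^ T * p"
    and card_le: "card V \<le> 2 ^ B"
begin

definition tags :: "('v \<times> nat \<Rightarrow> nat) \<Rightarrow> 'v \<Rightarrow> tag" where
  "tags x u = (x (u, 0), w u, cs u)"

text \<open>Feasibility without reference to the random identifiers: the zeros stand in for
  identifier and weight, neither of which \<open>tag_coeff\<close> reads.\<close>

definition base_feas :: "'v set \<Rightarrow> bool" where
  "base_feas X \<longleftrightarrow> (\<forall>y\<in>X. \<forall>t\<in>cs y. (\<Sum>z\<in>X. tag_coeff (0, 0, cs z) (fst t)) \<le> snd (snd t))"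

definition fields :: "('v \<times> nat) set" where "fields = V \<times> {..<T + 2 + K}"

text \<open>The fields that determine identifiers and averaged mass. Freezing them turns
  \<open>\<mu>\<close> and \<open>\<nu>\<close> into constants while the seeds of the carving stay
  random.\<close>

definition run_fields :: "('v \<times> nat) set" where "run_fields = V \<times> ({..<T + 2 + K} - {1..Suc T})"

definition distinct_ids :: "('v \<times> nat \<Rightarrow> nat) \<Rightarrow> bool" where
  "distinct_ids x \<longleftrightarrow> inj_on (\<lambda>u. x (u, 0)) V"

abbreviation "ids x \<equiv> \<lambda>u. x (u, 0 :: nat)"
abbreviation "am x \<equiv> avg_mass N (tags x) (curry x)"

definition good_mass :: "('v \<times> nat \<Rightarrow> nat) \<Rightarrow> bool" where
  "good_mass x \<longleftrightarrow> (\<forall>Z\<subseteq>V. base_feas Z \<longrightarrow> (1 - 5 * p) * real (sum w Z) \<le> sum (am x) V)"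

definition good_cut :: "('v \<times> nat \<Rightarrow> nat) \<Rightarrow> bool" where
  "good_cut x \<longleftrightarrow> (\<Sum>v | v \<in> V \<and> decomposition N (tags x) (curry x) v = None. am x v)
       \<le> 4 * p * sum (am x) V"

definition result :: "('v \<times> nat \<Rightarrow> nat) \<Rightarrow> 'v set" where
  "result x = {v \<in> V. final_sol N (tags x) (curry x) v}"

lemma fin_fields: "finite fields" "finite run_fields"
  using finite_V by (auto simp: fields_def run_fields_def)

lemma tag_coeff_tags: "tag_coeff (tags x z) l = tag_coeff (0, 0, cs z) l"
  by (simp add: tags_def tag_coeff_def)

lemma tags_fst: "(\<lambda>u. fst (tags x u)) = (ids x)"
  and tags_weight: "sum (\<lambda>v. tag_weight (tags x v)) Y = sum w Y"
  by (simp_all add: tags_def)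

lemma tagged: "distinct_ids x \<Longrightarrow> tagged_graph V N (tags x)"
  by unfold_locales
    (use cs_finite cs_nonneg cs_shared in \<open>auto simp: tags_def distinct_ids_def inj_on_def\<close>)

lemma labelled: "distinct_ids x \<Longrightarrow> labelled_graph V N (ids x)"
  by unfold_locales (simp add: distinct_ids_def)

lemma feas_eq_base: "distinct_ids x \<Longrightarrow> X \<subseteq> V \<Longrightarrow> tagged_graph.feas (tags x) X \<longleftrightarrow> base_feas X"
  using tagged_graph.feas_iff[OF tagged, of x X]
  by (simp add: tag_coeff_tags base_feas_def) (simp add: tags_def)

lemma geo_clustering:
  assumes "distinct_ids x"
  shows "clustering V N (tags x) (geo_cluster N (\<lambda>u. fst (tags x u)) f) (2 * Suc g)"
proof -
  interpret labelled_graph V N p \<kappa> B T g L K "ids x" by (rule labelled[OF assms])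
  interpret c: centres V N "geo_centres (ids x) f" "Suc g" by (rule geo_interp)
  interpret tagged_graph V N "tags x" by (rule tagged[OF assms])
  show ?thesis unfolding tags_fst geo_cluster_def
    by unfold_locales (use c.clab_adjacent c.clab_diameter in blast)+
qed

section \<open>Independent runs and their average\<close>

definition run_sol :: "('v \<times> nat \<Rightarrow> nat) \<Rightarrow> nat \<Rightarrow> 'v set" where
  "run_sol x k = {v \<in> V. geo_sol N (tags x) (\<lambda>u. x (u, T + 2 + k)) v}"

lemma run_sol_eq:
  "run_sol x k = clustering.sol V N (tags x)
     (geo_cluster N (\<lambda>u. fst (tags x u)) (\<lambda>u. x (u, T + 2 + k))) (2 * Suc g)"
  if "distinct_ids x"
  unfolding clustering.sol_def[OF geo_clustering[OF that]] run_sol_def geo_sol_def ..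

lemma run_sol_feas: "distinct_ids x \<Longrightarrow> C \<subseteq> run_sol x k \<Longrightarrow> base_feas C"
proof -
  assume x: "distinct_ids x" and C: "C \<subseteq> run_sol x k"
  interpret tagged_graph V N "tags x" by (rule tagged[OF x])
  have "run_sol x k \<subseteq> V" by (auto simp: run_sol_def)
  moreover have "feas (run_sol x k)"
    unfolding run_sol_eq[OF x] by (rule clustering.sol_feas[OF geo_clustering[OF x]])
  ultimately have "feas C" using feas_subset C by blast
  then show ?thesis using feas_eq_base[OF x] C \<open>run_sol x k \<subseteq> V\<close> by blast
qed

lemma base_feas_subset:
  assumes x: "distinct_ids x" and X: "X \<subseteq> V" "base_feas X" and Y: "Y \<subseteq> X"
  shows "base_feas Y"
proof -
  have "tagged_graph.feas (tags x) X" using X feas_eq_base[OF x] by blast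
  then have "tagged_graph.feas (tags x) Y" by (rule tagged_graph.feas_subset[OF tagged[OF x] X(1) _ Y])
  then show ?thesis using feas_eq_base[OF x order_trans[OF Y X(1)]] by blast
qed

text \<open>\<open>sol_mass\<close> for the measure that gives each vertex of \<open>Z\<close> its
  weight: the part of \<open>Z\<close> inside a cluster is feasible and competes with the local
  optimum.\<close>

lemma run_sol_weight:
  assumes x: "distinct_ids x" and Z: "Z \<subseteq> V" "base_feas Z"
  shows "real (sum w Z) \<le> real (sum w (run_sol x k)) +
    (\<Sum>v\<in>Z. real (w v) * of_bool (geo_cluster N (ids x) (\<lambda>u. x (u, T + 2 + k)) v = None))"
proof -
  let ?c = "geo_cluster N (\<lambda>u. fst (tags x u)) (\<lambda>u. x (u, T + 2 + k))"
  let ?\<mu> = "\<lambda>v. if v \<in> Z then real (w v) else 0"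
  have fZ: "finite Z" by (rule finite_subset[OF Z(1) finite_V])
  have "(\<Sum>v | v \<in> V \<and> ?c v \<noteq> None. ?\<mu> v) \<le> real (sum w (run_sol x k))"
    unfolding run_sol_eq[OF x] tags_weight[of x, symmetric]
  proof (rule clustering.sol_mass[OF geo_clustering[OF x]])
    fix C assume C: "C \<subseteq> V"
    have "sum ?\<mu> C = sum (\<lambda>v. real (w v)) (C \<inter> Z)"
      by (rule sum.inter_restrict[OF finite_subset[OF C finite_V], symmetric])
    moreover have "base_feas (C \<inter> Z)" by (rule base_feas_subset[OF x Z Int_lower2])
    ultimately show "\<exists>Z'\<subseteq>C. tagged_graph.feas (tags x) Z' \<and>
        sum ?\<mu> C \<le> real (sum (\<lambda>v. tag_weight (tags x v)) Z')"
      using feas_eq_base[OF x, of "C \<inter> Z"] C by (intro exI[of _ "C \<inter> Z"]) (auto simp: tags_weight)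
  qed
  moreover have "(\<Sum>v | v \<in> V \<and> ?c v \<noteq> None. ?\<mu> v) = (\<Sum>v\<in>Z. real (w v) * of_bool (?c v \<noteq> None))"
  proof -
    have "(\<Sum>v | v \<in> V \<and> ?c v \<noteq> None. ?\<mu> v) = (\<Sum>v | v \<in> V \<and> ?c v \<noteq> None \<and> v \<in> Z. real (w v))"
      using finite_V by (subst sum.inter_filter[symmetric]) (auto intro: arg_cong2[where f = sum])
    also have "{v. v \<in> V \<and> ?c v \<noteq> None \<and> v \<in> Z} = {v \<in> Z. ?c v \<noteq> None}" using Z by blast
    also have "(\<Sum>v | v \<in> Z \<and> ?c v \<noteq> None. real (w v)) = (\<Sum>v\<in>Z. if ?c v \<noteq> None then real (w v) else 0)"
      by (rule sum.inter_filter[OF fZ])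
    also have "\<dots> = (\<Sum>v\<in>Z. real (w v) * of_bool (?c v \<noteq> None))" by (intro sum.cong) auto
    finally show ?thesis .
  qed
  moreover have "real (sum w Z) = (\<Sum>v\<in>Z. real (w v) * of_bool (?c v \<noteq> None)) +
      (\<Sum>v\<in>Z. real (w v) * of_bool (?c v = None))"
    unfolding sum.distrib[symmetric] of_nat_sum by (intro sum.cong) auto
  ultimately show ?thesis unfolding tags_fst by linarith
qed

lemma sum_am: "C \<subseteq> V \<Longrightarrow> sum (am x) C = (\<Sum>k<K. real (sum w (run_sol x k \<inter> C))) / real K"
proof -
  assume C: "C \<subseteq> V"
  have fC: "finite C" by (rule finite_subset[OF C finite_V])
  have am: "am x v = (\<Sum>k<K. if v \<in> run_sol x k then real (w v) else 0) / real K" if "v \<in> C" for v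
  proof -
    have v: "v \<in> V" using that C by blast
    have "(\<Sum>k<K. if v \<in> run_sol x k then real (w v) else 0) = (\<Sum>k | k \<in> {..<K} \<and> v \<in> run_sol x k. real (w v))"
      by (rule sum.inter_filter[symmetric]) simp
    then show ?thesis using v by (simp add: avg_mass_def run_sol_def tags_def)
  qed
  have "sum (am x) C = (\<Sum>v\<in>C. \<Sum>k<K. if v \<in> run_sol x k then real (w v) else 0) / real K"
    unfolding sum_divide_distrib[of _ C] by (rule sum.cong[OF refl am])
  also have "(\<Sum>v\<in>C. \<Sum>k<K. if v \<in> run_sol x k then real (w v) else 0)
      = (\<Sum>k<K. \<Sum>v\<in>C. if v \<in> run_sol x k then real (w v) else 0)" by (rule sum.swap)
  also have "\<dots> = (\<Sum>k<K. real (sum w (run_sol x k \<inter> C)))"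
    unfolding of_nat_sum Int_commute[of _ C] by (intro sum.cong refl sum.inter_restrict[symmetric] fC)
  finally show ?thesis .
qed

text \<open>An average over the runs is at most the value of the best run, whose restriction to
  \<open>C\<close> is feasible. Which run is best may vary with \<open>C\<close>; no vertex ever has
  to know it.\<close>

lemma am_dominated:
  assumes x: "distinct_ids x" and C: "C \<subseteq> V"
  shows "\<exists>Z\<subseteq>C. base_feas Z \<and> sum (am x) C \<le> real (sum w Z)"
proof -
  obtain k where k: "\<forall>k'\<in>{..<K}. sum w (run_sol x k' \<inter> C) \<le> sum w (run_sol x k \<inter> C)"
    using ex_max[of "{..<K}" "\<lambda>k. sum w (run_sol x k \<inter> C)"] K_pos by blast
  have "(\<Sum>k<K. real (sum w (run_sol x k \<inter> C))) \<le> (\<Sum>k'<K. real (sum w (run_sol x k \<inter> C)))"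
    by (rule sum_mono) (use k in \<open>simp only: of_nat_le_iff\<close>)
  then have "sum (am x) C \<le> real (sum w (run_sol x k \<inter> C))"
    unfolding sum_am[OF C] using K_pos by (simp add: divide_le_eq mult.commute)
  moreover have "base_feas (run_sol x k \<inter> C)" by (rule run_sol_feas[OF x Int_lower1])
  ultimately show ?thesis by (intro exI[of _ "run_sol x k \<inter> C"] conjI Int_lower2)
qed

lemma am_nonneg: "0 \<le> am x v"
  by (simp add: avg_mass_def)

lemma carving_interp:
  assumes x: "distinct_ids x" and less: "\<And>u. u \<in> V \<Longrightarrow> x (u, 0) < 2 ^ B"
  shows "carving V N \<kappa> B T g L (ids x) (am x) (rel_mass N (ids x) (am x))"
proof -
  interpret labelled_graph V N p \<kappa> B T g L K "ids x" by (rule labelled[OF x])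
  let ?m = "\<lambda>r v. sum (am x) (nbhd N r v)"
  let ?r = "rel_mass N (ids x) (am x)"
  have rel: "?r u = am x u / ?m (2 * scale 0) u" if "u \<in> V" for u
    by (simp add: rel_mass_def lsum_eq[OF id_inj that])
  have m0: "0 \<le> ?m r v" for r v by (intro sum_nonneg am_nonneg)
  have own: "am x u \<le> ?m r u" if "u \<in> V" for u r
    by (rule member_le_sum[OF self_in_nbhd]) (auto intro: am_nonneg finite_nbhd[OF that])
  show ?thesis
  proof unfold_locales
    fix u assume u: "u \<in> V"
    show "x (u, 0) < 2 ^ B" by (rule less[OF u])
    show "0 \<le> am x u" by (rule am_nonneg)
    show "0 \<le> ?r u" unfolding rel[OF u] by (intro divide_nonneg_nonneg am_nonneg m0)
    show "sum ?r (nbhd N (scale 0) u) \<le> 1"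
    proof -
      let ?B = "nbhd N (scale 0) u"
      have "?r z \<le> am x z / sum (am x) ?B" if z: "z \<in> ?B" for z
      proof -
        have zV: "z \<in> V" using z nbhd_sub[OF u] by blast
        have "?B \<subseteq> nbhd N (2 * scale 0) z"
          using nbhd_trans[of u N "scale 0" z _ "scale 0"] nbhd_sym[OF z] by (auto simp: mult_2)
        then have le: "sum (am x) ?B \<le> ?m (2 * scale 0) z"
          by (intro sum_mono2 finite_nbhd[OF zV] am_nonneg)
        show ?thesis
        proof (cases "sum (am x) ?B = 0")
          case True
          have "am x z \<le> sum (am x) ?B"
            by (rule member_le_sum[OF z]) (auto intro: am_nonneg finite_nbhd[OF u])
          then have "am x z = 0" using True am_nonneg[of x z] by simp
          then show ?thesis by (simp add: rel[OF zV])
        next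
          case False
          then have "0 < sum (am x) ?B" using m0[of "scale 0" u] by simp
          then show ?thesis unfolding rel[OF zV] using le by (intro divide_left_mono am_nonneg mult_pos_pos) auto
        qed
      qed
      then have "sum ?r ?B \<le> (\<Sum>z\<in>?B. am x z / sum (am x) ?B)" by (rule sum_mono)
      also have "\<dots> \<le> 1" by (simp add: sum_divide_distrib[symmetric])
      finally show ?thesis .
    qed
    show "am x u \<le> sum (am x) V * ?r u"
    proof (cases "?m (2 * scale 0) u = 0")
      case True
      then show ?thesis using own[OF u, of "2 * scale 0"] am_nonneg[of x u] by (simp add: rel[OF u])
    next
      case False
      then have pos: "0 < ?m (2 * scale 0) u" using m0[of "2 * scale 0" u] by simp
      have "?m (2 * scale 0) u \<le> sum (am x) V"
        by (rule sum_mono2[OF finite_V nbhd_sub[OF u]]) (rule am_nonneg)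
      then have "?m (2 * scale 0) u * am x u \<le> sum (am x) V * am x u"
        by (rule mult_right_mono) (rule am_nonneg)
      then show ?thesis unfolding rel[OF u] using pos by (simp add: pos_le_divide_eq mult.commute)
    qed
  qed (use L_pos T_pos kappa_ge in auto)
qed

lemma result_good:
  assumes x: "distinct_ids x" and less: "\<And>u. u \<in> V \<Longrightarrow> x (u, 0) < 2 ^ B"
    and good: "good_mass x" "good_cut x"
  shows "base_feas (result x)"
    and "Z \<subseteq> V \<Longrightarrow> base_feas Z \<Longrightarrow> (1 - 9 * p) * real (sum w Z) \<le> real (sum w (result x))"
proof -
  interpret carving V N p \<kappa> B T g L K "ids x" "am x" "rel_mass N (ids x) (am x)"
    by (rule carving_interp[OF x less])
  interpret c: centres V N "carve_centres N (ids x) (am x) (rel_mass N (ids x) (am x)) (curry x)" "scale 0"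
    by (rule carve_interp)
  interpret t: tagged_graph V N "tags x" by (rule tagged[OF x])
  let ?d = "decomposition N (tags x) (curry x)"
  interpret cl: clustering V N "tags x" ?d "2 * scale 0"
    unfolding decomposition_def tags_fst Let_def carve_cluster_def
    by unfold_locales (use c.clab_adjacent c.clab_diameter in blast)+
  have res: "result x = cl.sol" unfolding result_def cl.sol_def final_sol_def ..
  show "base_feas (result x)" using cl.sol_feas feas_eq_base[OF x cl.sol_sub] res by simp
  assume Z: "Z \<subseteq> V" "base_feas Z"
  have "(\<Sum>v | v \<in> V \<and> ?d v \<noteq> None. am x v) \<le> real (sum w (result x))"
    unfolding res tags_weight[of x, symmetric]
  proof (rule cl.sol_mass)
    fix C assume "C \<subseteq> V"
    then show "\<exists>Z'\<subseteq>C. t.feas Z' \<and> sum (am x) C \<le> real (sum (\<lambda>v. tag_weight (tags x v)) Z')"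
      using am_dominated[OF x] feas_eq_base[OF x] unfolding tags_weight by (meson order_trans)
  qed
  moreover have "sum (am x) V = (\<Sum>v | v \<in> V \<and> ?d v \<noteq> None. am x v) + (\<Sum>v | v \<in> V \<and> ?d v = None. am x v)"
    by (subst sum.union_disjoint[symmetric]) (use finite_V in \<open>auto intro: arg_cong2[where f = sum]\<close>)
  ultimately have 1: "(1 - 4 * p) * sum (am x) V \<le> real (sum w (result x))"
    using good(2) unfolding good_cut_def by (simp add: algebra_simps)
  \<comment> \<open>The source of the 9: the product of the two factors exceeds
    \<open>1 - 9 * p\<close> by \<open>20 * p ^ 2\<close>.\<close>
  have "(1 - 9 * p) * real (sum w Z) \<le> (1 - 4 * p) * ((1 - 5 * p) * real (sum w Z))"
  proof -
    have "0 \<le> 20 * p\<^sup>2 * real (sum w Z)" by (intro mult_nonneg_nonneg of_nat_0_le_iff) auto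
    then show ?thesis by (simp add: algebra_simps power2_eq_square)
  qed
  also have "\<dots> \<le> (1 - 4 * p) * sum (am x) V"
    using good(1) Z p_small p_pos unfolding good_mass_def by (intro mult_left_mono) auto
  finally show "(1 - 9 * p) * real (sum w Z) \<le> real (sum w (result x))" using 1 by linarith
qed

section \<open>Failure probabilities of identifiers, averaging and cutting\<close>

lemma pr_collision: "pr fields (\<lambda>x. \<not> distinct_ids x) \<le> (real (card V))\<^sup>2 / 2 ^ B"
proof -
  let ?P = "\<lambda>e x. x (fst e, 0) = x (snd e, 0 :: nat)"
  let ?E = "{e \<in> V \<times> V. fst e \<noteq> snd e}"
  have fE: "finite ?E" using finite_V by simp
  have each: "pr fields (?P e) \<le> 1 / 2 ^ B" if e: "e \<in> ?E" for e
  proof -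
    let ?i = "(fst e, 0 :: nat)" and ?j = "(snd e, 0 :: nat)"
    have ij: "?i \<in> fields" "?j \<in> fields - {?i}" using e by (auto simp: fields_def)
    show ?thesis
    proof (rule mean_conditional_le[OF fin_fields(1), of "{?i}"])
      fix y assume "y \<in> outcomes {?i}"
      have g: "glue {?i} y z ?i = y ?i" "glue {?i} y z ?j = z ?j" for z using ij by (auto simp: glue_def)
      have "pr (fields - {?i}) (\<lambda>z. y ?i = z ?j) = avg {..<2 ^ B} (\<lambda>a. of_bool (y ?i = a))"
        by (rule mean_coordinate[OF _ ij(2)]) (use fin_fields in simp)
      also have "\<dots> \<le> 1 / 2 ^ B"
      proof -
        have "card ({..<2 ^ B} \<inter> {a. y ?i = a}) \<le> card {y ?i}" by (rule card_mono) auto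
        then show ?thesis by (simp add: avg_def divide_right_mono)
      qed
      finally show "pr (fields - {?i}) (\<lambda>z. ?P e (glue {?i} y z)) \<le> 1 / 2 ^ B" unfolding g .
    qed (use ij in auto)
  qed
  have "pr fields (\<lambda>x. \<not> distinct_ids x) \<le> pr fields (\<lambda>x. \<exists>e\<in>?E. ?P e x)"
    by (rule avg_of_bool_mono) (auto simp: distinct_ids_def inj_on_def)
  also have "\<dots> \<le> (\<Sum>e\<in>?E. pr fields (?P e))" by (rule avg_of_bool_Ex[OF fE])
  also have "\<dots> \<le> (\<Sum>e\<in>?E. 1 / 2 ^ B)" by (rule sum_mono) (rule each)
  also have "\<dots> = real (card ?E) / 2 ^ B" by simp
  also have "\<dots> \<le> (real (card V))\<^sup>2 / 2 ^ B"
  proof (rule divide_right_mono)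
    have "card ?E \<le> card (V \<times> V)" by (rule card_mono) (use finite_V in auto)
    then show "real (card ?E) \<le> (real (card V))\<^sup>2"
      by (simp add: card_cartesian_product power2_eq_square flip: of_nat_mult)
  qed simp
  finally show ?thesis .
qed

text \<open>All runs share the identifiers, so these are frozen first; afterwards the runs read
  disjoint fields. The fraction of one optimal \<open>Z\<close>, fixed in advance, that a run
  deletes lies in \<open>[0, 1]\<close> and has mean at most \<open>2 * p\<close>, and the Chernoff
  exponent is \<open>4 * p * K - 5 * p * K\<close>.\<close>

lemma pr_bad_mass: "pr fields (\<lambda>x. distinct_ids x \<and> \<not> good_mass x) \<le> exp (- (p * real K))"
proof (rule mean_conditional_le[OF fin_fields(1), of "V \<times> {0}"])
  show "V \<times> {0} \<subseteq> fields" by (auto simp: fields_def)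
  fix y assume y: "y \<in> outcomes (V \<times> {0 :: nat})"
  let ?I = "fields - V \<times> {0}"
  let ?x = "glue (V \<times> {0}) y"
  have fI: "finite ?I" using fin_fields by simp
  show "pr ?I (\<lambda>z. distinct_ids (?x z) \<and> \<not> good_mass (?x z)) \<le> exp (- (p * real K))"
  proof (cases "distinct_ids y")
    case False
    have "distinct_ids (?x z) = distinct_ids y" for z
      unfolding distinct_ids_def by (rule inj_on_cong) (simp add: glue_def)
    then show ?thesis using False by (simp add: avg_def)
  next
    case True
    have ids: "distinct_ids (?x z)" for z
      using True unfolding distinct_ids_def by (subst inj_on_cong[where g = "ids y"]) (auto simp: glue_def)
    interpret labelled_graph V N p \<kappa> B T g L K "ids y" by (rule labelled[OF True])
    interpret geo_space V N p \<kappa> B T g L K "ids y"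
      by unfold_locales (use p_pos p_small tail in auto)
    obtain Z where Z: "Z \<subseteq> V" "base_feas Z" "\<And>Z'. Z' \<subseteq> V \<Longrightarrow> base_feas Z' \<Longrightarrow> sum w Z' \<le> sum w Z"
    proof -
      have "base_feas {}" by (simp add: base_feas_def)
      then have "{Z. Z \<subseteq> V \<and> base_feas Z} \<noteq> {}" by blast
      moreover have "finite {Z. Z \<subseteq> V \<and> base_feas Z}"
        by (rule finite_subset[of _ "Pow V"]) (use finite_V in auto)
      ultimately show ?thesis using ex_max[of "{Z. Z \<subseteq> V \<and> base_feas Z}" "sum w"] that by auto
    qed
    have fZ: "finite Z" by (rule finite_subset[OF Z(1) finite_V])
    have fK: "finite {..<K}" by simp
    let ?W = "real (sum w Z)"
    let ?e = "\<lambda>k u. (u, T + 2 + k)"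
    let ?c = "\<lambda>k z v. geo_cluster N (ids y) (\<lambda>u. z (?e k u)) v = None"
    let ?f = "\<lambda>k z. (\<Sum>v\<in>Z. real (w v) * of_bool (?c k z v)) / ?W"
    have eI: "?e k ` V \<subseteq> ?I" if "k < K" for k using that by (auto simp: fields_def)
    have chern: "pr ?I (\<lambda>z. 5 * p * real K \<le> (\<Sum>k<K. ?f k z)) \<le> exp (2 * (2 * p * real K) - 5 * p * real K)"
    proof (rule chernoff[OF fI fK, of "\<lambda>k. ?e k ` V"])
      show "depends (?e k ` V) (?f k)" for k
      proof -
        have "depends (?e k ` V) (\<lambda>z. geo_cluster N (ids y) (\<lambda>u. z (?e k u)) v)" if "v \<in> Z" for v
          by (rule depends_mono[OF geo_depends]) (use nbhd_sub Z(1) that in blast)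
        then show ?thesis unfolding depends_def
          by (intro allI impI arg_cong2[where f = divide] sum.cong refl arg_cong2[where f = times])
            (metis (no_types, lifting))
      qed
      show "0 \<le> ?f k z \<and> ?f k z \<le> 1" for k z
      proof
        show "0 \<le> ?f k z" by (intro divide_nonneg_nonneg sum_nonneg mult_nonneg_nonneg of_nat_0_le_iff) simp
        have "(\<Sum>v\<in>Z. real (w v) * of_bool (?c k z v)) \<le> (\<Sum>v\<in>Z. real (w v))"
          by (rule sum_mono) auto
        then have "(\<Sum>v\<in>Z. real (w v) * of_bool (?c k z v)) \<le> ?W" by simp
        then show "?f k z \<le> 1" by (simp add: divide_le_eq_1 flip: of_nat_sum) linarith
      qed
      have "mean ?I (?f k) \<le> 2 * p" if k: "k \<in> {..<K}" for k
      proof -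
        have "mean ?I (?f k) = (\<Sum>v\<in>Z. real (w v) * pr ?I (\<lambda>z. ?c k z v)) / ?W"
        proof -
          have "mean ?I (?f k) = mean ?I (\<lambda>z. \<Sum>v\<in>Z. real (w v) * of_bool (?c k z v)) * (1 / ?W)"
            by (subst avg_mult_right[symmetric]) simp
          then show ?thesis by (simp only: avg_sum avg_cmult) simp
        qed
        also have "\<dots> \<le> (\<Sum>v\<in>Z. real (w v) * (2 * p)) / ?W"
        proof (intro divide_right_mono sum_mono mult_left_mono)
          fix v assume v: "v \<in> Z"
          show "pr ?I (\<lambda>z. ?c k z v) \<le> 2 * p"
            by (rule geo_deleted[OF fI]) (use eI k v Z(1) in \<open>auto simp: inj_on_def\<close>)
        qed (simp_all only: of_nat_0_le_iff)
        also have "\<dots> \<le> 2 * p" using p_pos by (simp add: sum_distrib_right[symmetric])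
        finally show ?thesis .
      qed
      then have "(\<Sum>k\<in>{..<K}. mean ?I (?f k)) \<le> (\<Sum>k\<in>{..<K}. 2 * p)" by (rule sum_mono)
      then show "(\<Sum>k<K. mean ?I (?f k)) \<le> 2 * p * real K" by (simp add: mult.commute)
    qed (use eI in auto)
    have "pr ?I (\<lambda>z. distinct_ids (?x z) \<and> \<not> good_mass (?x z)) \<le> pr ?I (\<lambda>z. 5 * p * real K \<le> (\<Sum>k<K. ?f k z))"
    proof (rule avg_of_bool_mono, rule ccontr)
      fix z assume z: "z \<in> outcomes ?I" and bad: "distinct_ids (?x z) \<and> \<not> good_mass (?x z)"
        and "\<not> 5 * p * real K \<le> (\<Sum>k<K. ?f k z)"
      then have less: "(\<Sum>k<K. ?f k z) \<le> 5 * p * real K" by simp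
      have id: "ids (?x z) = (ids y)"
      proof
        fix u show "?x z (u, 0) = y (u, 0)"
          using y z by (cases "u \<in> V") (auto simp: glue_def outcomes_def PiE_def extensional_def fields_def)
      qed
      have run: "(\<lambda>u. ?x z (?e k u)) = (\<lambda>u. z (?e k u))" for k by (auto simp: glue_def)
      have "?W \<le> real (sum w (run_sol (?x z) k)) + ?f k z * ?W" for k
      proof -
        have "(\<Sum>v\<in>Z. real (w v) * of_bool (?c k z v)) = ?f k z * ?W"
        proof (cases "?W = 0")
          \<comment> \<open>For a weightless \<open>Z\<close> the quotient is 0 by convention, and
            the numerator vanishes too.\<close>
          case True
          then have "sum w Z = 0" by (simp only: of_nat_eq_0_iff)
          then have "\<forall>v\<in>Z. w v = 0" using fZ by simp
          then show ?thesis using True by simp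
        qed simp
        then show ?thesis using run_sol_weight[OF ids Z(1,2), of z k] unfolding id run by simp
      qed
      then have "(\<Sum>k<K. ?W) \<le> (\<Sum>k<K. real (sum w (run_sol (?x z) k)) + ?f k z * ?W)"
        by (rule sum_mono)
      also have "\<dots> = (\<Sum>k<K. real (sum w (run_sol (?x z) k \<inter> V))) + (\<Sum>k<K. ?f k z) * ?W"
      proof -
        have "run_sol (?x z) k \<inter> V = run_sol (?x z) k" for k by (auto simp: run_sol_def)
        then show ?thesis by (simp add: sum.distrib sum_distrib_right)
      qed
      also have "\<dots> \<le> (\<Sum>k<K. real (sum w (run_sol (?x z) k \<inter> V))) + (5 * p * real K) * ?W"
        by (intro add_left_mono mult_right_mono less of_nat_0_le_iff)
      finally have "(1 - 5 * p) * ?W * real K \<le> (\<Sum>k<K. real (sum w (run_sol (?x z) k \<inter> V)))"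
        by (simp add: algebra_simps)
      then have "(1 - 5 * p) * ?W \<le> sum (am (?x z)) V"
        unfolding sum_am[OF order_refl] using K_pos by (simp add: pos_le_divide_eq)
      moreover have "(1 - 5 * p) * real (sum w Z') \<le> (1 - 5 * p) * ?W" if "Z' \<subseteq> V" "base_feas Z'" for Z'
        by (rule mult_left_mono[OF of_nat_mono[OF Z(3)[OF that]]]) (use p_small p_pos in simp)
      ultimately have "good_mass (?x z)" unfolding good_mass_def by (meson order_trans)
      then show False using bad by blast
    qed
    also note chern
    finally show ?thesis by (simp add: algebra_simps)
  qed
qed

text \<open>Once \<open>run_fields\<close> are frozen, \<open>pr_deleted_mass\<close> applies to the
  remaining fields. \<open>L_large\<close> reduces the cost of the layers to \<open>p\<close>, which
  together with the \<open>3 * p\<close> of the last phase makes \<open>4 * p\<close>.\<close>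

lemma pr_bad_cut:
  "pr fields (\<lambda>x. distinct_ids x \<and> \<not> good_cut x) \<le> (2 * real (card V) * real T + 1) * exp (- \<kappa>)"
proof (rule mean_conditional_le[OF fin_fields(1), of run_fields])
  show "run_fields \<subseteq> fields" by (auto simp: fields_def run_fields_def)
  fix y assume y: "y \<in> outcomes run_fields"
  let ?I = "fields - run_fields"
  let ?x = "glue run_fields y"
  have fI: "finite ?I" using fin_fields by simp
  have id: "?x z (u, 0) = y (u, 0)" if "z \<in> outcomes ?I" for z u
    using y that by (cases "u \<in> V") (auto simp: glue_def outcomes_def PiE_def extensional_def fields_def run_fields_def)
  have run: "?x z (u, T + 2 + k) = y (u, T + 2 + k)" if "z \<in> outcomes ?I" "k < K" for z u k
    using y that by (cases "u \<in> V") (auto simp: glue_def outcomes_def PiE_def extensional_def fields_def run_fields_def)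
  have ph: "?x z (u, i) = z (u, i)" if "i \<in> {1..Suc T}" for z u i
    using that by (auto simp: glue_def run_fields_def)
  have tags: "tags (?x z) = tags y" if "z \<in> outcomes ?I" for z
    using id[OF that] by (simp add: tags_def fun_eq_iff)
  have am: "am (?x z) = am y" if "z \<in> outcomes ?I" for z
    unfolding tags[OF that] by (rule avg_mass_cong) (simp only: curry_conv run[OF that])
  have di: "distinct_ids (?x z) = distinct_ids y" if "z \<in> outcomes ?I" for z
    unfolding distinct_ids_def id[OF that] ..
  show "pr ?I (\<lambda>z. distinct_ids (?x z) \<and> \<not> good_cut (?x z)) \<le> (2 * real (card V) * real T + 1) * exp (- \<kappa>)"
  proof (cases "distinct_ids y")
    case False
    have "pr ?I (\<lambda>z. distinct_ids (?x z) \<and> \<not> good_cut (?x z)) = mean ?I (\<lambda>_. 0)"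
      by (rule avg_cong) (use False di in simp)
    then show ?thesis by (simp add: mean_const[OF fI])
  next
    case True
    have less: "y (u, 0) < 2 ^ B" if "u \<in> V" for u
    proof -
      have "(u, 0) \<in> run_fields" using that by (simp add: run_fields_def)
      then show ?thesis using y by (auto simp: outcomes_def)
    qed
    interpret carving V N p \<kappa> B T g L K "ids y" "am y" "rel_mass N (ids y) (am y)"
      by (rule carving_interp[OF True less])
    interpret random_carving V N p \<kappa> B T g L K "ids y" "am y" "rel_mass N (ids y) (am y)" ?I
      by unfold_locales
        (use p_pos p_small tail fI card_le T_large in \<open>auto simp: fields_def run_fields_def\<close>)
    have dec: "decomposition N (tags (?x z)) (curry (?x z)) = clu (curry z)" if "z \<in> outcomes ?I" for z
    proof -
      have "decomposition N (tags (?x z)) (curry (?x z)) = clu (curry (?x z))"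
        unfolding decomposition_def Let_def am[OF that] by (simp add: tags_def id[OF that])
      also have "\<dots> = clu (curry z)" by (rule carve_cluster_cong) (simp only: curry_conv ph)
      finally show ?thesis .
    qed
    have "7 * \<kappa> * real T / real L + 3 * p \<le> 4 * p"
      using L_large L_pos by (simp add: pos_divide_le_eq)
    then have coef: "(7 * \<kappa> * real T / real L + 3 * p) * sum (am y) V \<le> 4 * p * sum (am y) V"
      by (rule mult_right_mono) (intro sum_nonneg am_nonneg)
    have "pr ?I (\<lambda>z. distinct_ids (?x z) \<and> \<not> good_cut (?x z))
      \<le> pr ?I (\<lambda>z. \<not> (\<Sum>v | v \<in> V \<and> clu (curry z) v = None. am y v)
          \<le> (7 * \<kappa> * real T / real L + 3 * p) * sum (am y) V)"
    proof (rule avg_of_bool_mono)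
      fix z assume z: "z \<in> outcomes ?I" and "distinct_ids (?x z) \<and> \<not> good_cut (?x z)"
      then have "\<not> good_cut (?x z)" by blast
      then show "\<not> (\<Sum>v | v \<in> V \<and> clu (curry z) v = None. am y v)
          \<le> (7 * \<kappa> * real T / real L + 3 * p) * sum (am y) V"
        unfolding good_cut_def dec[OF z] am[OF z] using coef by linarith
    qed
    also have "\<dots> \<le> (2 * real (card V) * real T + 1) * exp (- \<kappa>)" by (rule pr_deleted_mass)
    finally show ?thesis .
  qed
qed

definition success :: "('v \<times> nat \<Rightarrow> nat) \<Rightarrow> bool" where
  "success x \<longleftrightarrow> base_feas (result x) \<and>
     (\<forall>Z\<subseteq>V. base_feas Z \<longrightarrow> (1 - 9 * p) * real (sum w Z) \<le> real (sum w (result x)))"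

lemma pr_success:
  "1 - ((real (card V))\<^sup>2 / 2 ^ B + exp (- (p * real K)) + (2 * real (card V) * real T + 1) * exp (- \<kappa>))
     \<le> pr fields success"
proof -
  have "1 - pr fields success = pr fields (\<lambda>x. \<not> success x)"
    by (rule avg_of_bool_not[symmetric]) (use fin_fields finite_outcomes outcomes_nonempty in auto)
  also have "\<dots> \<le> pr fields (\<lambda>x. (\<not> distinct_ids x \<or> distinct_ids x \<and> \<not> good_mass x) \<or>
      distinct_ids x \<and> \<not> good_cut x)"
  proof (rule avg_of_bool_mono, rule ccontr)
    fix x assume x: "x \<in> outcomes fields" "\<not> success x"
      "\<not> ((\<not> distinct_ids x \<or> distinct_ids x \<and> \<not> good_mass x) \<or> distinct_ids x \<and> \<not> good_cut x)"
    have "x (u, 0) < 2 ^ B" if "u \<in> V" for u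
    proof -
      have "(u, 0) \<in> fields" using that by (simp add: fields_def)
      then show ?thesis using x(1) by (auto simp: outcomes_def)
    qed
    then have "success x" using result_good[of x] x(3) unfolding success_def by blast
    then show False using x(2) by blast
  qed
  also have "\<dots> \<le> pr fields (\<lambda>x. \<not> distinct_ids x) + pr fields (\<lambda>x. distinct_ids x \<and> \<not> good_mass x) +
      pr fields (\<lambda>x. distinct_ids x \<and> \<not> good_cut x)"
    by (rule order_trans[OF avg_of_bool_disj add_right_mono[OF avg_of_bool_disj]])
  finally show ?thesis using pr_collision pr_bad_mass pr_bad_cut by linarith
qed

end

section \<open>Locality\<close>

text \<open>Messages arrive as a multiset, while \<open>datum\<close> offers lists. An arbitrary
  listing will do: only injectivity matters.\<close>

definition bag :: "datum multiset \<Rightarrow> datum" where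
  "bag M = Tuple (SOME xs. mset xs = M)"

lemma bag_inject: "bag M = bag M' \<Longrightarrow> M = M'"
proof -
  have *: "mset (SOME xs. mset xs = M) = M" for M :: "datum multiset"
    by (rule someI_ex) (rule ex_mset)
  assume "bag M = bag M'"
  then have "(SOME xs. mset xs = M) = (SOME xs. mset xs = M')" unfolding bag_def by (rule datum.inject(4)[THEN iffD1])
  then have "mset (SOME xs. mset xs = M) = mset (SOME xs. mset xs = M')" by (rule arg_cong)
  then show "M = M'" unfolding * .
qed

text \<open>The truncated universal cover of the network at \<open>v\<close>, that is, all an
  anonymous vertex can learn in \<open>r\<close> rounds. Repeating the previous view as first
  component makes shorter views recoverable (\<open>view_shorten\<close>).\<close>

primrec view :: "(nat \<Rightarrow> nat set) \<Rightarrow> (nat \<Rightarrow> datum) \<Rightarrow> nat \<Rightarrow> nat \<Rightarrow> datum" where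
  "view N s 0 v = s v"
| "view N s (Suc r) v = Tuple [view N s r v, bag (image_mset (view N s r) (mset_set (N v)))]"

text \<open>
  Two arbitrary networks are compared through the views of their vertices. A quantity computed from
  radius \<open>r\<close> is one that agrees on any two vertices with equal views of depth \<open>r\<close>; nothing else is
  needed to obtain it as a function of the view.
\<close>

locale two_networks =
  fixes V V' :: "nat set" and N N' :: "nat \<Rightarrow> nat set" and s s' :: "nat \<Rightarrow> datum"
  assumes closed: "v \<in> V \<Longrightarrow> N v \<subseteq> V" "v \<in> V' \<Longrightarrow> N' v \<subseteq> V'"
    and finite_N: "finite (N v)" "finite (N' v)"
begin

definition agree :: "nat \<Rightarrow> (nat \<Rightarrow> 'a) \<Rightarrow> (nat \<Rightarrow> 'a) \<Rightarrow> bool" where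
  "agree r q q' \<longleftrightarrow> (\<forall>v\<in>V. \<forall>v'\<in>V'. view N s r v = view N' s' r v' \<longrightarrow> q v = q' v')"

lemma agreeD: "agree r q q' \<Longrightarrow> v \<in> V \<Longrightarrow> v' \<in> V' \<Longrightarrow> view N s r v = view N' s' r v' \<Longrightarrow> q v = q' v'"
  unfolding agree_def by blast

lemma view_shorten: "view N s r v = view N' s' r v' \<Longrightarrow> r0 \<le> r \<Longrightarrow> view N s r0 v = view N' s' r0 v'"
  by (induction r) (auto simp: le_Suc_eq)

lemma agree_mono: "agree r q q' \<Longrightarrow> r \<le> t \<Longrightarrow> agree t q q'"
  unfolding agree_def using view_shorten by blast

lemma agree_map: "agree r q q' \<Longrightarrow> agree r (\<lambda>v. f (q v)) (\<lambda>v. f (q' v))"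
  unfolding agree_def by metis

lemma agree_map2:
  "agree r q q' \<Longrightarrow> agree r h h' \<Longrightarrow> agree r (\<lambda>v. f (q v) (h v)) (\<lambda>v. f (q' v) (h' v))"
  unfolding agree_def by metis

lemma agree_fun: "(\<And>j. agree r (q j) (q' j)) \<Longrightarrow> agree r (\<lambda>v j. q j v) (\<lambda>v j. q' j v)"
  unfolding agree_def by blast

text \<open>Equal views contain equal multisets of neighbour views, and their sets of values of
  \<open>q\<close> therefore coincide. Multiplicities are given up here, which is why sums over
  balls go through identifiers in \<open>lsum\<close>.\<close>

lemma agree_neighbours:
  assumes "agree r q q'"
  shows "agree (Suc r) (\<lambda>v. q ` N v) (\<lambda>v. q' ` N' v)"
  unfolding agree_def
proof (intro ballI impI)
  fix v v' assume v: "v \<in> V" "v' \<in> V'" and "view N s (Suc r) v = view N' s' (Suc r) v'"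
  then have "image_mset (view N s r) (mset_set (N v)) = image_mset (view N' s' r) (mset_set (N' v'))"
    using bag_inject by simp
  from arg_cong[OF this, of set_mset] have eq: "view N s r ` N v = view N' s' r ` N' v'"
    using finite_N by simp
  have V: "u \<in> V" if "u \<in> N v" for u using closed(1)[OF v(1)] that by blast
  have V': "u \<in> V'" if "u \<in> N' v'" for u using closed(2)[OF v(2)] that by blast
  have "\<exists>u'\<in>N' v'. q u = q' u'" if u: "u \<in> N v" for u
  proof -
    have "view N s r u \<in> view N' s' r ` N' v'" using eq u by blast
    then obtain u' where "u' \<in> N' v'" "view N s r u = view N' s' r u'" by blast
    then show ?thesis using agreeD[OF assms V[OF u] V'] by blast
  qed
  moreover have "\<exists>u\<in>N v. q u = q' u'" if u': "u' \<in> N' v'" for u'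
  proof -
    have "view N' s' r u' \<in> view N s r ` N v" using eq u' by blast
    then obtain u where "u \<in> N v" "view N s r u = view N' s' r u'" by (metis imageE)
    then show ?thesis using agreeD[OF assms V V'[OF u']] by blast
  qed
  ultimately show "q ` N v = q' ` N' v'" by (auto simp: image_iff) metis
qed

lemma agree_nbhd: "agree r q q' \<Longrightarrow> agree (r + j) (\<lambda>v. q ` nbhd N j v) (\<lambda>v. q' ` nbhd N' j v)"
proof (induction j)
  case 0
  then show ?case using agree_map[of r q q' "\<lambda>a. {a}"] by (simp add: nbhd.simps)
next
  case (Suc j)
  have IH: "agree (r + j) (\<lambda>v. q ` nbhd N j v) (\<lambda>v. q' ` nbhd N' j v)" by (rule Suc.IH[OF Suc.prems])
  have "agree (r + Suc j) (\<lambda>v. (\<lambda>u. q ` nbhd N j u) ` N v) (\<lambda>v. (\<lambda>u. q' ` nbhd N' j u) ` N' v)"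
    using agree_neighbours[OF IH] by simp
  moreover have "agree (r + Suc j) (\<lambda>v. q ` nbhd N j v) (\<lambda>v. q' ` nbhd N' j v)"
    by (rule agree_mono[OF IH]) simp
  ultimately have "agree (r + Suc j) (\<lambda>v. q ` nbhd N j v \<union> \<Union> ((\<lambda>u. q ` nbhd N j u) ` N v))
      (\<lambda>v. q' ` nbhd N' j v \<union> \<Union> ((\<lambda>u. q' ` nbhd N' j u) ` N' v))"
    by (rule agree_map2[of _ _ _ _ _ "\<lambda>A B. B \<union> \<Union> A"])
  then show ?case by (simp add: nbhd.simps image_Un image_UN)
qed

lemma agree_scan:
  assumes "agree r q q'"
  shows "agree (r + \<rho>) (scan N \<rho> q) (scan N' \<rho> q')"
proof -
  have "agree (r + \<rho>) (\<lambda>v. if j \<le> \<rho> then q ` nbhd N j v else {}) (\<lambda>v. if j \<le> \<rho> then q' ` nbhd N' j v else {})" for j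
  proof (cases "j \<le> \<rho>")
    case True
    then show ?thesis using agree_mono[OF agree_nbhd[OF assms, of j], of "r + \<rho>"] by simp
  next
    case False
    then show ?thesis by (simp add: agree_def)
  qed
  from agree_fun[OF this] show ?thesis unfolding scan_def .
qed

lemma agree_cluster: "agree r cd cd' \<Longrightarrow> agree (r + \<rho>) (cluster N \<rho> cd) (cluster N' \<rho> cd')"
  unfolding cluster_def[abs_def] by (rule agree_map[OF agree_scan])

lemma agree_solve:
  assumes "agree r tg tg'" "agree r c c'"
  shows "agree (r + \<rho>) (solve N \<rho> tg c) (solve N' \<rho> tg' c')"
  unfolding agree_def
proof (intro ballI impI)
  fix v v' assume v: "v \<in> V" "v' \<in> V'" and eq: "view N s (r + \<rho>) v = view N' s' (r + \<rho>) v'"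
  have "tg v = tg' v'" "c v = c' v'"
    using agreeD[OF agree_mono[OF assms(1)] v eq] agreeD[OF agree_mono[OF assms(2)] v eq] by simp_all
  moreover have "(\<lambda>u. (tg u, c u)) ` nbhd N \<rho> v = (\<lambda>u. (tg' u, c' u)) ` nbhd N' \<rho> v'"
    by (rule agreeD[OF agree_nbhd[OF agree_map2[OF assms]] v eq])
  ultimately show "solve N \<rho> tg c v = solve N' \<rho> tg' c' v'" by (simp add: solve_def)
qed

lemma agree_lsum:
  assumes "agree r0 idt idt'" "agree r0 q q'"
  shows "agree (r0 + r) (lsum N idt q r) (lsum N' idt' q' r)"
  using agree_map[OF agree_nbhd[OF agree_map2[OF assms, of Pair], of r], of "\<lambda>Y. sum snd Y"]
  unfolding lsum_def[abs_def] .

end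

text \<open>Ties are broken by a choice operator that sees the function on \<open>S\<close> only; so
  corresponding vertices of two networks choose the same layer.\<close>

lemma arg_min_on_cong: "(\<And>r. r \<in> S \<Longrightarrow> f r = h r) \<Longrightarrow> arg_min_on f S = arg_min_on h S"
  unfolding arg_min_on_def arg_min_def is_arg_min_def by (rule arg_cong[of _ _ Eps]) auto

locale two_networks_alg = two_networks V V' N N' s s' + alg_params p \<kappa> B T g L K
  for V V' N N' s s' p \<kappa> B T g L K +
  fixes tg tg' :: "nat \<Rightarrow> tag" and sd sd' :: "nat \<Rightarrow> nat \<Rightarrow> nat"
  assumes agree_tg: "agree 0 tg tg'" and agree_sd: "agree 0 sd sd'"
begin

abbreviation "idt \<equiv> \<lambda>u. fst (tg u)"
abbreviation "idt' \<equiv> \<lambda>u. fst (tg' u)"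
abbreviation "\<mu> \<equiv> avg_mass N tg sd"
abbreviation "\<mu>' \<equiv> avg_mass N' tg' sd'"
abbreviation "\<nu> \<equiv> rel_mass N idt \<mu>"
abbreviation "\<nu>' \<equiv> rel_mass N' idt' \<mu>'"

lemma agree_id: "agree r idt idt'"
  by (rule agree_map[OF agree_mono[OF agree_tg]]) simp

lemma agree_seed: "agree r (\<lambda>u. sd u i) (\<lambda>u. sd' u i)"
  by (rule agree_map[OF agree_mono[OF agree_sd]]) simp

lemma agree_geo_sol:
  "agree (3 * Suc g) (geo_sol N tg (\<lambda>u. sd u i)) (geo_sol N' tg' (\<lambda>u. sd' u i))"
proof -
  have "agree 0 (geo_centres idt (\<lambda>u. sd u i)) (geo_centres idt' (\<lambda>u. sd' u i))"
    unfolding geo_centres_def[abs_def] by (rule agree_map2[OF agree_id agree_seed])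
  from agree_cluster[OF this, of "Suc g"]
  have "agree (Suc g) (geo_cluster N idt (\<lambda>u. sd u i)) (geo_cluster N' idt' (\<lambda>u. sd' u i))"
    unfolding geo_cluster_def add_0 .
  from agree_solve[OF agree_mono[OF agree_tg le0] this, of "2 * Suc g"] show ?thesis
    unfolding geo_sol_def by (rule agree_mono) simp
qed

lemma agree_mu: "agree (3 * Suc g) \<mu> \<mu>'"
proof -
  have "agree (3 * Suc g) (\<lambda>v k. geo_sol N tg (\<lambda>u. sd u (T + 2 + k)) v) (\<lambda>v k. geo_sol N' tg' (\<lambda>u. sd' u (T + 2 + k)) v)"
    by (rule agree_fun) (rule agree_geo_sol)
  then show ?thesis unfolding avg_mass_def[abs_def]
    by (rule agree_map2[OF agree_mono[OF agree_tg], of "3 * Suc g" _ _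
      "\<lambda>t G. real (tag_weight t) * (real (card {k \<in> {..<K}. G k}) / real K)", OF le0])
qed

definition r\<nu> :: nat where "r\<nu> = 3 * Suc g + 2 * scale 0"

lemma agree_nu: "agree r\<nu> \<nu> \<nu>'"
proof -
  have "agree r\<nu> (lsum N idt \<mu> (2 * scale 0)) (lsum N' idt' \<mu>' (2 * scale 0))"
    unfolding r\<nu>_def by (rule agree_lsum[OF agree_id agree_mu])
  moreover have "agree r\<nu> \<mu> \<mu>'" by (rule agree_mono[OF agree_mu]) (simp add: r\<nu>_def)
  ultimately show ?thesis unfolding rel_mass_def[abs_def] by (rule agree_map2[rotated])
qed

lemma agree_active: "agree (r\<nu> + scale 0) (active N idt \<nu> i) (active N' idt' \<nu>' i)"
proof -
  have "agree (r\<nu> + scale 0) (\<lambda>v j. lsum N idt \<nu> (scale j) v) (\<lambda>v j. lsum N' idt' \<nu>' (scale j) v)"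
  proof (rule agree_fun)
    fix j
    have "scale j \<le> scale 0" by (rule scale_antimono) simp
    then show "agree (r\<nu> + scale 0) (lsum N idt \<nu> (scale j)) (lsum N' idt' \<nu>' (scale j))"
      by (intro agree_mono[OF agree_lsum[OF agree_id agree_nu]]) simp
  qed
  then show ?thesis unfolding active_def[abs_def]
    by (rule agree_map[of _ _ _ "\<lambda>G. \<forall>j\<in>{1..<i}. G j < 1 / 2 ^ j"])
qed

lemma agree_carve_radius:
  "agree (r\<nu> + 2 * scale 0) (carve_radius N idt \<mu> \<nu> i) (carve_radius N' idt' \<mu>' \<nu>' i)"
  unfolding agree_def
proof (intro ballI impI)
  fix v v' assume v: "v \<in> V" "v' \<in> V'"
    and eq: "view N s (r\<nu> + 2 * scale 0) v = view N' s' (r\<nu> + 2 * scale 0) v'"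
  let ?q = "\<lambda>v. if active N idt \<nu> i v then \<mu> v else 0"
  let ?q' = "\<lambda>v. if active N' idt' \<nu>' i v then \<mu>' v else 0"
  have "agree (r\<nu> + scale 0) \<mu> \<mu>'" by (rule agree_mono[OF agree_mu]) (simp add: r\<nu>_def)
  from agree_map2[OF agree_active[of i] this, of "\<lambda>P a. if P then a else 0"]
  have q: "agree (r\<nu> + scale 0) ?q ?q'" .
  have ls: "lsum N idt ?q r v = lsum N' idt' ?q' r v'" if "r \<le> scale 0" for r
    by (rule agreeD[OF agree_mono[OF agree_lsum[OF agree_id q]] v eq]) (use that in simp)
  show "carve_radius N idt \<mu> \<nu> i v = carve_radius N' idt' \<mu>' \<nu>' i v'"
    unfolding carve_radius_def
  proof (rule arg_min_on_cong)
    fix r assume "r \<in> {scale i..<scale (i - 1)}"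
    then have "Suc r \<le> scale 0" using scale_antimono[of 0 "i - 1"] by simp
    then show "layer_mass N idt \<mu> \<nu> i v r = layer_mass N' idt' \<mu>' \<nu>' i v' r"
      unfolding layer_mass_def using ls[of r] ls[of "Suc r"] by simp
  qed
qed

lemma agree_carve_centres:
  "agree (r\<nu> + 2 * scale 0) (carve_centres N idt \<mu> \<nu> sd) (carve_centres N' idt' \<mu>' \<nu>' sd')"
  unfolding agree_def
proof (intro ballI impI)
  fix v v' assume v: "v \<in> V" "v' \<in> V'"
    and eq: "view N s (r\<nu> + 2 * scale 0) v = view N' s' (r\<nu> + 2 * scale 0) v'"
  have "idt v = idt' v'" by (rule agreeD[OF agree_id v eq])
  moreover have "sd v i = sd' v' i" for i by (rule agreeD[OF agree_seed v eq])
  moreover have "\<nu> v = \<nu>' v'" by (rule agreeD[OF agree_mono[OF agree_nu] v eq]) simp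
  moreover have "carve_radius N idt \<mu> \<nu> i v = carve_radius N' idt' \<mu>' \<nu>' i v'" for i
    by (rule agreeD[OF agree_carve_radius v eq])
  ultimately show "carve_centres N idt \<mu> \<nu> sd v = carve_centres N' idt' \<mu>' \<nu>' sd' v'"
    by (simp add: carve_centres_def sampled_def)
qed

text \<open>Distances add up: \<open>Suc g\<close> for the geometric clusters and
  \<open>2 * Suc g\<close> for solving them give \<open>\<mu>\<close>; then, in units of
  \<open>scale 0\<close>, 2 for \<open>\<nu>\<close>, 1 for activity, 1 for the layers, 1 for the
  clustering and 2 for the final solutions.\<close>

lemma agree_final_sol:
  "agree (3 * Suc g + 7 * scale 0) (final_sol N tg sd) (final_sol N' tg' sd')"
proof -
  have "agree (r\<nu> + 3 * scale 0) (decomposition N tg sd) (decomposition N' tg' sd')"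
    unfolding decomposition_def carve_cluster_def Let_def
    by (rule agree_mono[OF agree_cluster[OF agree_carve_centres]]) simp
  from agree_solve[OF agree_mono[OF agree_tg le0] this, of "2 * scale 0"]
  show ?thesis unfolding final_sol_def by (rule agree_mono) (simp add: r\<nu>_def)
qed

end

section \<open>Random bits\<close>

text \<open>Which bijection is taken does not matter, since only the uniformity of the resulting
  number is used.\<close>

definition block_code :: "nat \<Rightarrow> (nat \<Rightarrow> bool) \<Rightarrow> nat" where
  "block_code B = (SOME \<phi>. bij_betw \<phi> ({..<B} \<rightarrow>\<^sub>E UNIV) {..<2 ^ B})"

definition bit_field :: "nat \<Rightarrow> (nat \<Rightarrow> bool) \<Rightarrow> nat \<Rightarrow> nat" where
  "bit_field B \<beta> f = block_code B (restrict (\<lambda>j. \<beta> (f * B + j)) {..<B})"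

definition bit_fields :: "nat \<Rightarrow> nat \<Rightarrow> nat \<Rightarrow> (nat \<Rightarrow> nat \<Rightarrow> bool) \<Rightarrow> nat \<times> nat \<Rightarrow> nat" where
  "bit_fields n F B \<omega> = restrict (\<lambda>(u, f). bit_field B (\<omega> u) f) ({..<n} \<times> {..<F})"

lemma block_code_bij: "bij_betw (block_code B) ({..<B} \<rightarrow>\<^sub>E UNIV) {..<2 ^ B}"
proof -
  have "finite ({..<B} \<rightarrow>\<^sub>E (UNIV :: bool set))" by (rule finite_PiE) auto
  moreover have "card ({..<B} \<rightarrow>\<^sub>E (UNIV :: bool set)) = 2 ^ B" by (simp add: card_PiE)
  ultimately have "\<exists>\<phi>. bij_betw \<phi> ({..<B} \<rightarrow>\<^sub>E (UNIV :: bool set)) {..<2 ^ B :: nat}"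
    by (intro finite_same_card_bij) auto
  then show ?thesis unfolding block_code_def by (rule someI_ex)
qed

lemma bit_field_less: "bit_field B \<beta> f < 2 ^ B"
proof -
  have "block_code B (restrict (\<lambda>j. \<beta> (f * B + j)) {..<B}) \<in> {..<2 ^ B}"
    by (rule bij_betwE[OF block_code_bij, rule_format]) auto
  then show ?thesis by (simp add: bit_field_def)
qed

lemma PiM_cylinder:
  assumes "\<And>i. prob_space (M i)" "J \<subseteq> I" "finite J" "\<And>i. i \<in> J \<Longrightarrow> X i \<in> sets (M i)"
  shows "{x \<in> space (PiM I M). \<forall>i\<in>J. x i \<in> X i} \<in> sets (PiM I M)"
    and "measure (PiM I M) {x \<in> space (PiM I M). \<forall>i\<in>J. x i \<in> X i} = (\<Prod>i\<in>J. measure (M i) (X i))"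
proof -
  interpret product_prob_space M I by (rule product_prob_spaceI) (rule assms(1))
  have eq: "{x \<in> space (PiM I M). \<forall>i\<in>J. x i \<in> X i} = prod_emb I M J (Pi\<^sub>E J X)"
    unfolding prod_emb_def using assms(2) by (auto simp: space_PiM Pi_iff)
  show "{x \<in> space (PiM I M). \<forall>i\<in>J. x i \<in> X i} \<in> sets (PiM I M)"
    unfolding eq by (rule sets_PiM_I) (use assms in auto)
  show "measure (PiM I M) {x \<in> space (PiM I M). \<forall>i\<in>J. x i \<in> X i} = (\<Prod>i\<in>J. measure (M i) (X i))"
    unfolding eq by (rule measure_PiM_emb) (use assms in auto)
qed

lemma coin_flips_space: "space coin_flips = UNIV" "prob_space coin_flips"
proof -
  show "space coin_flips = UNIV" by (simp add: coin_flips_def space_PiM)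
  show "prob_space coin_flips" unfolding coin_flips_def
    by (rule prob_space_PiM) (rule measure_pmf.prob_space_axioms)
qed

text \<open>Fields are consecutive blocks of \<open>B\<close> flips. By division with remainder,
  prescribing the first \<open>F\<close> fields amounts to prescribing each of the first
  \<open>F * B\<close> flips.\<close>

lemma coin_flips_fields:
  assumes "\<And>f. f < F \<Longrightarrow> y f < 2 ^ B"
  shows "{\<beta>. \<forall>f<F. bit_field B \<beta> f = y f} \<in> sets coin_flips"
    and "measure coin_flips {\<beta>. \<forall>f<F. bit_field B \<beta> f = y f} = (1 / 2) ^ (F * B)"
proof -
  define \<rho> where "\<rho> f = the_inv_into ({..<B} \<rightarrow>\<^sub>E UNIV) (block_code B) (y f)" for f
  note inj = bij_betw_imp_inj_on[OF block_code_bij[of B]]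
  have \<rho>: "\<rho> f \<in> {..<B} \<rightarrow>\<^sub>E UNIV" "block_code B (\<rho> f) = y f" if "f < F" for f
  proof -
    have y: "y f \<in> block_code B ` ({..<B} \<rightarrow>\<^sub>E UNIV)"
      using assms[OF that] bij_betw_imp_surj_on[OF block_code_bij] by simp
    show "\<rho> f \<in> {..<B} \<rightarrow>\<^sub>E UNIV" unfolding \<rho>_def by (rule the_inv_into_into[OF inj y order_refl])
    show "block_code B (\<rho> f) = y f" unfolding \<rho>_def by (rule f_the_inv_into_f[OF inj y])
  qed
  have field: "bit_field B \<beta> f = y f \<longleftrightarrow> (\<forall>j<B. \<beta> (f * B + j) = \<rho> f j)" if "f < F" for \<beta> f
  proof -
    have "bit_field B \<beta> f = y f \<longleftrightarrow> restrict (\<lambda>j. \<beta> (f * B + j)) {..<B} = \<rho> f"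
      unfolding bit_field_def \<rho>(2)[OF that, symmetric] by (rule inj_on_eq_iff[OF inj]) (use \<rho>(1)[OF that] in auto)
    also have "\<dots> \<longleftrightarrow> (\<forall>j<B. \<beta> (f * B + j) = \<rho> f j)"
      using \<rho>(1)[OF that] by (auto simp: fun_eq_iff restrict_def PiE_def extensional_def)
    finally show ?thesis .
  qed
  let ?c = "\<lambda>i. \<rho> (i div B) (i mod B)"
  have digits: "(\<forall>f<F. \<forall>j<B. \<beta> (f * B + j) = \<rho> f j) \<longleftrightarrow> (\<forall>i<F * B. \<beta> i = ?c i)" for \<beta>
  proof (rule iffI)
    assume *: "\<forall>f<F. \<forall>j<B. \<beta> (f * B + j) = \<rho> f j"
    show "\<forall>i<F * B. \<beta> i = ?c i"
    proof (rule allI, rule impI)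
      fix i assume i: "i < F * B"
      then have "i div B < F" by (rule less_mult_imp_div_less)
      moreover have "i mod B < B" using i by (intro mod_less_divisor gr0I) simp
      ultimately have "\<beta> (i div B * B + i mod B) = ?c i" using * by blast
      then show "\<beta> i = ?c i" by simp
    qed
  next
    assume *: "\<forall>i<F * B. \<beta> i = ?c i"
    show "\<forall>f<F. \<forall>j<B. \<beta> (f * B + j) = \<rho> f j"
    proof (rule allI, rule impI, rule allI, rule impI)
      fix f j assume f: "f < F" and j: "j < B"
      have "f * B + j < Suc f * B" using j by simp
      also have "\<dots> \<le> F * B" using f by (intro mult_le_mono1) simp
      finally have "\<beta> (f * B + j) = ?c (f * B + j)" using * by blast
      then show "\<beta> (f * B + j) = \<rho> f j" using j by simp
    qed
  qed
  have E: "{\<beta>. \<forall>f<F. bit_field B \<beta> f = y f}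
      = {\<beta> \<in> space coin_flips. \<forall>i\<in>{..<F * B}. \<beta> i \<in> {?c i}}"
    using field digits by (simp add: coin_flips_space Ball_def)
  show "{\<beta>. \<forall>f<F. bit_field B \<beta> f = y f} \<in> sets coin_flips"
    unfolding E coin_flips_def
    by (rule PiM_cylinder) (auto intro: measure_pmf.prob_space_axioms)
  have "measure coin_flips {\<beta>. \<forall>f<F. bit_field B \<beta> f = y f}
      = (\<Prod>i\<in>{..<F * B}. measure (measure_pmf (bernoulli_pmf (1 / 2))) {?c i})"
    unfolding E coin_flips_def
    by (rule PiM_cylinder) (auto intro: measure_pmf.prob_space_axioms)
  also have "\<dots> = (\<Prod>i\<in>{..<F * B}. 1 / 2)"
  proof (intro prod.cong refl)
    show "measure (measure_pmf (bernoulli_pmf (1 / 2))) {b} = 1 / 2" for b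
      by (cases b) (simp_all add: measure_pmf_single)
  qed
  finally show "measure coin_flips {\<beta>. \<forall>f<F. bit_field B \<beta> f = y f} = (1 / 2) ^ (F * B)" by simp
qed

text \<open>\<open>Q\<close> may be arbitrary, without measurability: \<open>bit_fields\<close>
  takes finitely many values, and each is attained on a measurable cylinder of probability
  \<open>1 / card \<Omega>\<close>.\<close>

lemma prob_bit_fields:
  fixes n F B :: nat
  defines "\<Omega> \<equiv> ({..<n} \<times> {..<F}) \<rightarrow>\<^sub>E {..<2 ^ B}"
  shows "\<P>(\<omega> in random_bits n. Q (bit_fields n F B \<omega>)) = avg \<Omega> (\<lambda>x. of_bool (Q x))"
proof -
  let ?M = "random_bits n"
  let ?E = "\<lambda>x. {\<omega> \<in> space ?M. bit_fields n F B \<omega> = x}"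
  interpret prob_space ?M unfolding random_bits_def
    by (rule prob_space_PiM) (rule coin_flips_space)
  have fin: "finite \<Omega>" unfolding \<Omega>_def by (rule finite_PiE) auto
  have card: "card \<Omega> = 2 ^ (n * F * B)"
    by (simp add: \<Omega>_def card_PiE power_mult[symmetric] mult.commute)
  have E: "?E x \<in> sets ?M" "measure ?M (?E x) = 1 / real (card \<Omega>)" if x: "x \<in> \<Omega>" for x
  proof -
    have less: "x (u, f) < 2 ^ B" if "u < n" "f < F" for u f
    proof -
      have "x (u, f) \<in> {..<2 ^ B}" using x unfolding \<Omega>_def by (rule PiE_mem) (use that in simp)
      then show ?thesis by simp
    qed
    have "bit_fields n F B \<omega> = x \<longleftrightarrow> (\<forall>u\<in>{..<n}. \<omega> u \<in> {\<beta>. \<forall>f<F. bit_field B \<beta> f = x (u, f)})" for \<omega>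
    proof -
      have "bit_fields n F B \<omega> = x \<longleftrightarrow> (\<forall>i\<in>{..<n} \<times> {..<F}. bit_fields n F B \<omega> i = x i)"
        using x unfolding \<Omega>_def bit_fields_def by (auto simp: fun_eq_iff restrict_def PiE_def extensional_def)
      then show ?thesis by (auto simp: bit_fields_def)
    qed
    then have eq: "?E x = {\<omega> \<in> space (PiM {..<n} (\<lambda>_. coin_flips)). \<forall>u\<in>{..<n}. \<omega> u \<in> {\<beta>. \<forall>f<F. bit_field B \<beta> f = x (u, f)}}"
      by (simp add: random_bits_def)
    have s: "{\<beta>. \<forall>f<F. bit_field B \<beta> f = x (u, f)} \<in> sets coin_flips" if "u \<in> {..<n}" for u
      by (rule coin_flips_fields(1)) (use less that in simp)
    show "?E x \<in> sets ?M" unfolding eq unfolding random_bits_def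
      by (rule PiM_cylinder(1)[OF coin_flips_space(2) order_refl _ s]) auto
    have "measure ?M (?E x) = (\<Prod>u\<in>{..<n}. measure coin_flips {\<beta>. \<forall>f<F. bit_field B \<beta> f = x (u, f)})"
      unfolding eq unfolding random_bits_def
      by (rule PiM_cylinder(2)[OF coin_flips_space(2) order_refl _ s]) auto
    also have "\<dots> = (\<Prod>u\<in>{..<n}. (1 / 2) ^ (F * B))"
      by (intro prod.cong refl coin_flips_fields(2)) (use less in simp)
    also have "\<dots> = 1 / real (card \<Omega>)"
      by (simp add: card power_mult[symmetric] power_one_over mult.commute mult.left_commute)
    finally show "measure ?M (?E x) = 1 / real (card \<Omega>)" .
  qed
  have in_\<Omega>: "bit_fields n F B \<omega> \<in> \<Omega>" for \<omega>
    unfolding bit_fields_def \<Omega>_def using bit_field_less by auto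
  let ?G = "{x \<in> \<Omega>. Q x}"
  have fG: "finite ?G" using fin by simp
  have "{\<omega> \<in> space ?M. Q (bit_fields n F B \<omega>)} = (\<Union>x\<in>?G. ?E x)"
    using in_\<Omega> by blast
  then have "\<P>(\<omega> in ?M. Q (bit_fields n F B \<omega>)) = measure ?M (\<Union>x\<in>?G. ?E x)" by simp
  also have "\<dots> = (\<Sum>x\<in>?G. measure ?M (?E x))"
  proof (rule finite_measure_finite_Union[OF fG])
    show "?E ` ?G \<subseteq> sets ?M" using E(1) by blast
    show "disjoint_family_on ?E ?G" by (auto simp: disjoint_family_on_def)
  qed
  also have "\<dots> = (\<Sum>x\<in>?G. 1 / real (card \<Omega>))" by (intro sum.cong refl E(2)) blast
  also have "\<dots> = avg \<Omega> (\<lambda>x. of_bool (Q x))"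
    using fin by (simp add: avg_def Collect_conj_eq Int_commute)
  finally show ?thesis .
qed

section \<open>The algorithm\<close>

definition encode_triple :: "nat \<times> real \<times> real \<Rightarrow> datum" where
  "encode_triple t = Tuple [Natural (fst t), Real (fst (snd t)), Real (snd (snd t))]"

definition encode :: "nat \<times> (nat \<times> real \<times> real) set \<times> (nat \<Rightarrow> bool) \<Rightarrow> datum" where
  "encode i = Tuple [Natural (fst i), Tuple (SOME xs. set xs = encode_triple ` fst (snd i)), Bits (snd (snd i))]"

text \<open>Only finite sets of constraints are the set of a list, so \<open>encode\<close> can be
  inverted on these alone.\<close>

definition decode :: "datum \<Rightarrow> nat \<times> (nat \<times> real \<times> real) set \<times> (nat \<Rightarrow> bool)" where
  "decode d = (SOME i. finite (fst (snd i)) \<and> encode i = d)"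

lemma decode_encode:
  assumes "finite (fst (snd i))"
  shows "decode (encode i) = i"
proof -
  have inj: "inj encode_triple" by (auto simp: inj_def encode_triple_def prod_eq_iff)
  have set: "set (SOME xs. set xs = encode_triple ` C) = encode_triple ` C" if "finite C" for C
    by (rule someI_ex) (use that in \<open>simp add: finite_list\<close>)
  have "i' = i" if *: "finite (fst (snd i')) \<and> encode i' = encode i" for i'
  proof -
    have "(SOME xs. set xs = encode_triple ` fst (snd i')) = (SOME xs. set xs = encode_triple ` fst (snd i))"
      using * by (simp add: encode_def)
    then have "encode_triple ` fst (snd i') = encode_triple ` fst (snd i)"
      using set[OF assms] set[of "fst (snd i')"] * by metis
    then have "fst (snd i') = fst (snd i)" by (simp only: inj_image_eq_iff[OF inj])
    then show ?thesis using * by (simp add: encode_def prod_eq_iff)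
  qed
  then show ?thesis unfolding decode_def using assms by (intro some_equality) auto
qed

text \<open>Full-information algorithm: every vertex broadcasts its view and halts after
  \<open>R\<close> rounds. As \<open>R\<close> depends on globally known parameters only, all
  vertices halt together, and the freezing of states never cuts off a neighbour.\<close>

definition view_alg :: "(real \<Rightarrow> real \<Rightarrow> nat) \<Rightarrow> (real \<Rightarrow> real \<Rightarrow> datum \<Rightarrow> nat) \<Rightarrow> local_alg" where
  "view_alg R F =
     \<lparr>initial = \<lambda>nt \<epsilon> w C \<beta>. Tuple [Natural 0, Real nt, Real \<epsilon>, encode (w, C, \<beta>)],
      message = \<lambda>st. (case st of Tuple [_, _, _, vw] \<Rightarrow> vw | _ \<Rightarrow> st),
      update = \<lambda>st M. (case st of Tuple [Natural t, a, b, vw] \<Rightarrow>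
        Tuple [Natural (Suc t), a, b, Tuple [vw, bag M]] | _ \<Rightarrow> st),
      answer = \<lambda>st. (case st of Tuple [Natural t, Real nt, Real \<epsilon>, vw] \<Rightarrow>
        if R nt \<epsilon> \<le> t then Some (F nt \<epsilon> vw) else None | _ \<Rightarrow> None)\<rparr>"

lemma local_run_view_alg:
  fixes R F nt \<epsilon>
  defines "alg \<equiv> view_alg R F"
  shows "local_run alg N (\<lambda>u. initial alg nt \<epsilon> (w u) (C u) (\<beta> u)) t v =
    Tuple [Natural (min t (R nt \<epsilon>)), Real nt, Real \<epsilon>,
      view N (\<lambda>u. encode (w u, C u, \<beta> u)) (min t (R nt \<epsilon>)) v]"
proof (induction t arbitrary: v)
  case 0
  then show ?case by (simp add: alg_def view_alg_def)
next
  case (Suc t)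
  show ?case
  proof (cases "R nt \<epsilon> \<le> t")
    case True
    then show ?thesis using Suc by (simp add: alg_def view_alg_def min_def)
  next
    case False
    then have "min t (R nt \<epsilon>) = t" "min (Suc t) (R nt \<epsilon>) = Suc t" by auto
    then show ?thesis using Suc False
      by (simp add: alg_def view_alg_def)
  qed
qed

lemma run_output_view_alg:
  assumes "R nt \<epsilon> \<le> t"
  shows "run_output (view_alg R F) A b w lab nt \<epsilon> \<omega> t v =
    Some (F nt \<epsilon> (view (neighbours A)
      (\<lambda>u. encode (w $ u, incident_constraints A b lab u, \<omega> u)) (R nt \<epsilon>) v))"
  unfolding run_output_def local_run_view_alg using assms by (simp add: view_alg_def min_def)

section \<open>Answers as functions of views\<close>

context alg_params begin

text \<open>Beyond the last field the value \<open>undefined\<close> copies what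
  \<open>restrict\<close> yields in \<open>bit_fields\<close>, so that both seeds are equal as
  functions.\<close>

definition view_seed :: "datum \<Rightarrow> nat \<Rightarrow> nat" where
  "view_seed d f = (if f < T + 2 + K then bit_field B (snd (snd (decode d))) f else undefined)"

definition view_tag :: "datum \<Rightarrow> tag" where
  "view_tag d = (view_seed d 0, fst (decode d), fst (snd (decode d)))"

definition radius :: nat where "radius = 3 * Suc g + 7 * scale 0"

definition view_of :: "nat set \<Rightarrow> (nat \<Rightarrow> nat set) \<Rightarrow> (nat \<Rightarrow> datum) \<Rightarrow> (nat \<Rightarrow> tag) \<Rightarrow> (nat \<Rightarrow> nat \<Rightarrow> nat) \<Rightarrow> bool" where
  "view_of V N s tg sd \<longleftrightarrow> (\<forall>v\<in>V. N v \<subseteq> V) \<and> (\<forall>v. finite (N v)) \<and>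
     (\<forall>u\<in>V. tg u = view_tag (s u) \<and> sd u = view_seed (s u))"

text \<open>Instead of evaluating a view, this asks whether some network with this view selects the
  vertex. By \<open>agree_final_sol\<close> all networks with the same view give the same verdict,
  the actual one included.\<close>

definition view_answer :: "datum \<Rightarrow> bool" where
  "view_answer vw \<longleftrightarrow> (\<exists>V N s tg sd v. view_of V N s tg sd \<and> v \<in> V \<and>
     view N s radius v = vw \<and> final_sol N tg sd v)"

lemma view_answer:
  assumes V: "view_of V N s tg sd" "v \<in> V"
  shows "view_answer (view N s radius v) \<longleftrightarrow> final_sol N tg sd v"
proof
  assume "view_answer (view N s radius v)"
  then obtain V' N' s' tg' sd' v' where *: "view_of V' N' s' tg' sd'" "v' \<in> V'"
    "view N' s' radius v' = view N s radius v" "final_sol N' tg' sd' v'"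
    unfolding view_answer_def by blast
  interpret two_networks V' V N' N s' s
    by unfold_locales (use V(1) *(1) in \<open>auto simp: view_of_def\<close>)
  have "agree 0 tg' tg" "agree 0 sd' sd"
    using V(1) *(1) by (auto simp: agree_def view_of_def)
  then interpret two_networks_alg V' V N' N s' s p \<kappa> B T g L K tg' tg sd' sd
    by unfold_locales
  show "final_sol N tg sd v"
    using agreeD[OF agree_final_sol *(2) V(2)] *(3,4) by (simp add: radius_def)
next
  assume "final_sol N tg sd v"
  then show "view_answer (view N s radius v)" using V unfolding view_answer_def by blast
qed

end

section \<open>Vertex sets in place of 0/1 vectors\<close>

locale packing_setting =
  fixes m n :: nat and A :: "real mat" and b :: "real Matrix.vec" and w :: "nat Matrix.vec"
    and lab :: "nat \<Rightarrow> nat"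
  assumes prob: "packing_problem m n A b w" and lab_inj: "inj_on lab {..<m}"
begin

abbreviation "W u \<equiv> w $ u"
abbreviation "cons u \<equiv> incident_constraints A b lab u"

lemma dims: "dim_row A = m" "dim_col A = n" "dim_vec b = m" "dim_vec w = n"
  using prob by (auto simp: packing_problem_def)

lemma A_nonneg: "j < m \<Longrightarrow> i < n \<Longrightarrow> 0 \<le> A $$ (j, i)"
  and b_nonneg: "j < m \<Longrightarrow> 0 \<le> b $ j"
  using prob by (auto simp: packing_problem_def)

lemma cons_iff: "t \<in> cons u \<longleftrightarrow>
    (\<exists>j<m. u < n \<and> A $$ (j, u) \<noteq> 0 \<and> t = (lab j, A $$ (j, u), b $ j))"
  by (auto simp: incident_constraints_def hyperedge_def dims)

lemma finite_cons: "finite (cons u)"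
proof -
  have "cons u \<subseteq> (\<lambda>j. (lab j, A $$ (j, u), b $ j)) ` {..<m}" using cons_iff by auto
  then show ?thesis by (rule finite_subset) simp
qed

lemma neighbours_iff: "v \<in> neighbours A u \<longleftrightarrow>
    v \<noteq> u \<and> u < n \<and> v < n \<and> (\<exists>j<m. A $$ (j, u) \<noteq> 0 \<and> A $$ (j, v) \<noteq> 0)"
  by (auto simp: neighbours_def hyperedge_def dims)

lemma finite_neighbours: "finite (neighbours A u)"
  by (rule finite_subset[of _ "{..<n}"]) (auto simp: neighbours_iff)

lemma coeff: "j < m \<Longrightarrow> u < n \<Longrightarrow> tag_coeff (0, 0, cons u) (lab j) = A $$ (j, u)"
proof -
  assume j: "j < m" and u: "u < n"
  have "{t \<in> cons u. fst t = lab j} = (if A $$ (j, u) \<noteq> 0 then {(lab j, A $$ (j, u), b $ j)} else {})"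
  proof -
    have only: "t = (lab j, A $$ (j, u), b $ j) \<and> A $$ (j, u) \<noteq> 0" if h: "t \<in> cons u" "fst t = lab j" for t
    proof -
      obtain j' where j': "j' < m" "A $$ (j', u) \<noteq> 0" "t = (lab j', A $$ (j', u), b $ j')"
        using h(1) cons_iff by blast
      then have "j' = j" using lab_inj h(2) j by (auto dest: inj_onD)
      then show ?thesis using j' by blast
    qed
    show ?thesis
    proof (cases "A $$ (j, u) = 0")
      case True
      then have "{t \<in> cons u. fst t = lab j} = {}" using only by blast
      then show ?thesis using True by simp
    next
      case False
      then have "(lab j, A $$ (j, u), b $ j) \<in> cons u" using j u cons_iff by blast
      moreover have "fst (lab j, A $$ (j, u), b $ j) = lab j" by simp
      ultimately have "{t \<in> cons u. fst t = lab j} = {(lab j, A $$ (j, u), b $ j)}"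
        using only by blast
      then show ?thesis using False by simp
    qed
  qed
  then show ?thesis by (simp add: tag_coeff_def)
qed

definition ind :: "nat set \<Rightarrow> nat Matrix.vec" where
  "ind X = Matrix.vec n (\<lambda>i. of_bool (i \<in> X))"

definition row_feas :: "nat set \<Rightarrow> bool" where
  "row_feas X \<longleftrightarrow> (\<forall>y\<in>X. \<forall>t\<in>cons y. (\<Sum>z\<in>X. tag_coeff (0, 0, cons z) (fst t)) \<le> snd (snd t))"

lemma sum_ind: "X \<subseteq> {..<n} \<Longrightarrow> (\<Sum>i<n. f i * of_bool (i \<in> X)) = (sum f X :: 'a :: semiring_1)"
proof -
  assume X: "X \<subseteq> {..<n}"
  have "(\<Sum>i<n. f i * of_bool (i \<in> X)) = (\<Sum>i<n. if i \<in> X then f i else 0)"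
    by (intro sum.cong) auto
  also have "\<dots> = sum f ({..<n} \<inter> X)" by (rule sum.inter_restrict[symmetric]) simp
  also have "{..<n} \<inter> X = X" using X by blast
  finally show ?thesis .
qed

lemma weight_ind: "X \<subseteq> {..<n} \<Longrightarrow> scalar_prod w (ind X) = sum W X"
  using sum_ind[of X W] by (simp add: scalar_prod_def ind_def atLeast0LessThan)

lemma feasible_ind:
  assumes X: "X \<subseteq> {..<n}"
  shows "feasible A b (ind X) \<longleftrightarrow> row_feas X"
proof -
  have row: "(A *\<^sub>v map_vec real (ind X)) $ j = (\<Sum>i\<in>X. A $$ (j, i))" if "j < m" for j
    using sum_ind[OF X, of "\<lambda>i. A $$ (j, i)"] that
    by (simp add: scalar_prod_def ind_def dims atLeast0LessThan)
  have coeffs: "(\<Sum>z\<in>X. tag_coeff (0, 0, cons z) (lab j)) = (\<Sum>z\<in>X. A $$ (j, z))" if "j < m" for j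
    by (intro sum.cong refl coeff that) (use X in auto)
  have "feasible A b (ind X) \<longleftrightarrow> (\<forall>j<m. (\<Sum>i\<in>X. A $$ (j, i)) \<le> b $ j)"
    using row by (auto simp: feasible_def dims ind_def less_eq_vec_def)
  also have "\<dots> \<longleftrightarrow> row_feas X"
  proof
    assume *: "\<forall>j<m. (\<Sum>i\<in>X. A $$ (j, i)) \<le> b $ j"
    show "row_feas X" unfolding row_feas_def
    proof (intro ballI)
      fix y t assume "y \<in> X" "t \<in> cons y"
      then obtain j where j: "j < m" "t = (lab j, A $$ (j, y), b $ j)" using cons_iff by blast
      then show "(\<Sum>z\<in>X. tag_coeff (0, 0, cons z) (fst t)) \<le> snd (snd t)" using * coeffs by simp
    qed
  next
    assume *: "row_feas X"
    show "\<forall>j<m. (\<Sum>i\<in>X. A $$ (j, i)) \<le> b $ j"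
    proof (intro allI impI)
      fix j assume j: "j < m"
      show "(\<Sum>i\<in>X. A $$ (j, i)) \<le> b $ j"
      proof (cases "\<exists>y\<in>X. A $$ (j, y) \<noteq> 0")
        case True
        then obtain y where y: "y \<in> X" "A $$ (j, y) \<noteq> 0" by blast
        then have "(lab j, A $$ (j, y), b $ j) \<in> cons y" using X j cons_iff by blast
        then show ?thesis using * y(1) coeffs[OF j] unfolding row_feas_def by fastforce
      next
        case False
        then have "(\<Sum>i\<in>X. A $$ (j, i)) = 0" by simp
        then show ?thesis using b_nonneg[OF j] by simp
      qed
    qed
  qed
  finally show ?thesis .
qed

lemma feasible_is_ind:
  assumes "feasible A b x"
  shows "\<exists>X\<subseteq>{..<n}. x = ind X"
proof (intro exI conjI)
  show "x = ind {i. i < n \<and> x $ i = 1}"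
  proof (rule eq_vecI)
    show "dim_vec x = dim_vec (ind {i. i < n \<and> x $ i = 1})"
      using assms by (simp add: feasible_def dims ind_def)
    fix i assume "i < dim_vec (ind {i. i < n \<and> x $ i = 1})"
    then have i: "i < n" by (simp add: ind_def)
    then have "x $ i \<in> {0, 1}" using assms by (simp add: feasible_def dims)
    then show "x $ i = ind {i. i < n \<and> x $ i = 1} $ i" using i by (auto simp: ind_def)
  qed
qed auto

text \<open>\<open>Max\<close> is meaningful here: there are finitely many 0/1 vectors, and the zero
  vector is feasible because \<open>b\<close> is nonnegative.\<close>

lemma OPT_attained: "\<exists>Z\<subseteq>{..<n}. row_feas Z \<and> OPT A b w = sum W Z"
proof -
  let ?S = "{scalar_prod w x | x. feasible A b x}"
  have sub: "?S \<subseteq> sum W ` Pow {..<n}"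
  proof
    fix a assume "a \<in> ?S"
    then obtain x where x: "a = scalar_prod w x" "feasible A b x" by blast
    then obtain X where "X \<subseteq> {..<n}" "x = ind X" using feasible_is_ind by blast
    then show "a \<in> sum W ` Pow {..<n}" using weight_ind x by auto
  qed
  have "finite ?S" by (rule finite_subset[OF sub]) simp
  moreover have "feasible A b (ind {})" using feasible_ind[of "{}"] by (simp add: row_feas_def)
  then have "?S \<noteq> {}" by blast
  ultimately have "Max ?S \<in> ?S" by (rule Max_in)
  then obtain x where x: "OPT A b w = scalar_prod w x" "feasible A b x" unfolding OPT_def by blast
  then obtain X where X: "X \<subseteq> {..<n}" "x = ind X" using feasible_is_ind by blast
  then show ?thesis using x weight_ind feasible_ind by auto
qed

lemma OPT_le_norm1: "OPT A b w \<le> norm1 w"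
proof -
  obtain Z where Z: "Z \<subseteq> {..<n}" "OPT A b w = sum W Z" using OPT_attained by blast
  have "sum W Z \<le> sum W {..<n}" by (rule sum_mono2) (use Z in auto)
  then show ?thesis using Z by (simp add: norm1_def dims)
qed

lemma approx_ind:
  assumes "X \<subseteq> {..<n}" "row_feas X" "\<epsilon> \<le> 1"
    and "\<And>Z. Z \<subseteq> {..<n} \<Longrightarrow> row_feas Z \<Longrightarrow> (1 - \<epsilon>) * real (sum W Z) \<le> real (sum W X)"
  shows "approx_solution \<epsilon> A b w (ind X)"
proof -
  obtain Z where "Z \<subseteq> {..<n}" "row_feas Z" "OPT A b w = sum W Z" using OPT_attained by blast
  then show ?thesis using assms feasible_ind weight_ind by (simp add: approx_solution_def)
qed

end

locale packing_params = packing_setting m n A b w lab + alg_params p \<kappa> B T g L K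
  for m n A b w lab p \<kappa> B T g L K +
  assumes p_pos: "0 < p" and p_small: "9 * p \<le> 1"
    and tail: "real n * real (thr g) \<le> p * 2 ^ B"
    and L_pos: "0 < L" and T_pos: "0 < T" and K_pos: "0 < K" and kappa_ge: "1 \<le> \<kappa>"
    and L_large: "7 * \<kappa> * real T \<le> p * real L"
    and T_large: "1 \<le> 2 ^ T * p"
    and card_le: "n \<le> 2 ^ B"
begin

sublocale packing_instance "{..<n}" "neighbours A" p \<kappa> B T g L K "\<lambda>u. w $ u" "\<lambda>u. cons u"
proof unfold_locales
  show "0 \<le> fst (snd t)" if h: "v \<in> {..<n}" "t \<in> cons v" for v t
  proof -
    obtain j where "j < m" "v < n" "t = (lab j, A $$ (j, v), b $ j)" using h(2) cons_iff by blast
    then show ?thesis using A_nonneg by simp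
  qed
  show "v \<in> neighbours A u" if h: "u \<in> {..<n}" "v \<in> {..<n}" "u \<noteq> v" "t \<in> cons u" "t' \<in> cons v" "fst t = fst t'"
    for u v t t'
  proof -
    obtain j where j: "j < m" "A $$ (j, u) \<noteq> 0" "fst t = lab j" using h(4) cons_iff by auto
    obtain j' where j': "j' < m" "A $$ (j', v) \<noteq> 0" "fst t' = lab j'" using h(5) cons_iff by auto
    have "j = j'" using lab_inj j j' h(6) by (auto dest: inj_onD)
    then show ?thesis using j j' h by (auto simp: neighbours_iff)
  qed
  show "v \<in> neighbours A u" if "u \<in> neighbours A v" for u v
    using that by (auto simp: neighbours_iff)
  show "neighbours A v \<subseteq> {..<n}" for v
    by (auto simp: neighbours_iff)
qed (simp_all add: finite_cons p_pos p_small tail L_pos T_pos K_pos kappa_ge L_large T_large card_le)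

lemma base_feas_eq: "base_feas X \<longleftrightarrow> row_feas X"
  by (simp add: base_feas_def row_feas_def)

text \<open>All outputs depend on \<open>\<omega>\<close> through \<open>bit_fields\<close> alone,
  so success is an event about a uniform finite outcome and the counting bound
  \<open>pr_success\<close> applies.\<close>

lemma prob_solves:
  assumes R: "R nt \<epsilon> = radius" "F nt \<epsilon> = (\<lambda>vw. of_bool (view_answer vw))" and t: "R nt \<epsilon> \<le> t"
    and \<epsilon>: "9 * p \<le> \<epsilon>" "\<epsilon> \<le> 1"
  shows "1 - ((real n)\<^sup>2 / 2 ^ B + exp (- (p * real K)) + (2 * real n * real T + 1) * exp (- \<kappa>))
    \<le> \<P>(\<omega> in random_bits n. solves_within (view_alg R F) A b w lab nt \<epsilon> \<omega> t)"
proof -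
  let ?x = "bit_fields n (T + 2 + K) B"
  let ?Q = "\<lambda>x. approx_solution \<epsilon> A b w (ind (result x))"
  have out: "run_output (view_alg R F) A b w lab nt \<epsilon> \<omega> t v = Some (of_bool (v \<in> result (?x \<omega>)))"
    if v: "v < n" for \<omega> v
  proof -
    let ?s = "\<lambda>u. encode (w $ u, cons u, \<omega> u)"
    have dec: "decode (?s u) = (w $ u, cons u, \<omega> u)" for u
      by (rule decode_encode) (simp add: finite_cons)
    have seed: "curry (?x \<omega>) u = view_seed (?s u)" if "u < n" for u
      using that by (auto simp: bit_fields_def view_seed_def dec fun_eq_iff)
    have "tags (?x \<omega>) u = view_tag (?s u)" if "u < n" for u
      using fun_cong[OF seed[OF that], of 0] unfolding tags_def view_tag_def dec curry_conv by simp
    then have "view_of {..<n} (neighbours A) ?s (tags (?x \<omega>)) (curry (?x \<omega>))"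
      unfolding view_of_def
      using seed finite_neighbours N_sub by simp
    then have "view_answer (view (neighbours A) ?s radius v)
        \<longleftrightarrow> final_sol (neighbours A) (tags (?x \<omega>)) (curry (?x \<omega>)) v"
      by (rule view_answer) (use v in simp)
    also have "\<dots> \<longleftrightarrow> v \<in> result (?x \<omega>)" using v by (simp add: result_def)
    finally show ?thesis using run_output_view_alg[of R nt \<epsilon> t F, OF t] R by simp
  qed
  have "solves_within (view_alg R F) A b w lab nt \<epsilon> \<omega> t \<longleftrightarrow> ?Q (?x \<omega>)" for \<omega>
  proof -
    let ?y = "ind (result (?x \<omega>))"
    have y: "dim_vec ?y = n" "\<forall>v<n. run_output (view_alg R F) A b w lab nt \<epsilon> \<omega> t v = Some (?y $ v)"
      using out by (auto simp: ind_def)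
    \<comment> \<open>The outputs determine the vector in \<open>solves_within\<close>, so its
      existential quantifier can be replaced by the indicator of \<open>result\<close>.\<close>
    have uniq: "x = ?y" if x: "dim_vec x = n"
      "\<forall>v<n. run_output (view_alg R F) A b w lab nt \<epsilon> \<omega> t v = Some (x $ v)" for x
    proof (rule eq_vecI)
      fix v assume "v < dim_vec ?y"
      then have "Some (x $ v) = Some (?y $ v)" using x(2) y by metis
      then show "x $ v = ?y $ v" by simp
    qed (use x(1) y(1) in simp)
    show ?thesis
    proof (rule iffI)
      assume "solves_within (view_alg R F) A b w lab nt \<epsilon> \<omega> t"
      then obtain x where "dim_vec x = n" "approx_solution \<epsilon> A b w x"
        "\<forall>v<n. run_output (view_alg R F) A b w lab nt \<epsilon> \<omega> t v = Some (x $ v)"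
        unfolding solves_within_def dims by blast
      then show "?Q (?x \<omega>)" using uniq[of x] by simp
    next
      assume "?Q (?x \<omega>)"
      then show "solves_within (view_alg R F) A b w lab nt \<epsilon> \<omega> t"
        unfolding solves_within_def dims using y by blast
    qed
  qed
  then have "\<P>(\<omega> in random_bits n. solves_within (view_alg R F) A b w lab nt \<epsilon> \<omega> t) = pr fields ?Q"
    using prob_bit_fields[of n ?Q "T + 2 + K" B] by (simp add: outcomes_def fields_def)
  moreover have "pr fields success \<le> pr fields ?Q"
  proof (rule avg_of_bool_mono)
    fix x assume s: "success x"
    show "?Q x"
    proof (rule approx_ind)
      show "result x \<subseteq> {..<n}" by (auto simp: result_def)
      show "row_feas (result x)" using s by (simp add: success_def base_feas_eq)
      show "(1 - \<epsilon>) * real (sum W Z) \<le> real (sum W (result x))" if "Z \<subseteq> {..<n}" "row_feas Z" for Z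
      proof -
        have "(1 - \<epsilon>) * real (sum W Z) \<le> (1 - 9 * p) * real (sum W Z)"
          by (rule mult_right_mono[OF _ of_nat_0_le_iff]) (use \<epsilon> in simp)
        also have "\<dots> \<le> real (sum W (result x))" using s that unfolding success_def base_feas_eq by blast
        finally show ?thesis .
      qed
    qed (rule \<epsilon>(2))
  qed
  ultimately show ?thesis using pr_success by simp
qed

end

section \<open>Choice of the parameters\<close>

text \<open>The algorithm is fixed before the exponent in the bound on \<open>ntilde\<close> and the
  polynomial bounding \<open>norm1 w\<close>. The parameters below therefore use only
  \<open>ntilde\<close>, \<open>\<epsilon>\<close> and \<open>c\<close>, the exponent of the failure
  probability.\<close>

definition par_p :: "real \<Rightarrow> real" where
  "par_p \<epsilon> = \<epsilon> / 9"

definition par_T :: "real \<Rightarrow> nat" where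
  "par_T \<epsilon> = nat \<lceil>log 2 (9 / \<epsilon>)\<rceil>"

text \<open>The logarithmic part of the exponent outweighs the union bound over vertices, the
  summand \<open>T\<close> that over phases, by \<open>2 * T \<le> exp T\<close>.\<close>

definition par_kappa :: "real \<Rightarrow> real \<Rightarrow> real \<Rightarrow> real" where
  "par_kappa c nt \<epsilon> = (c + 3) * ln nt + real (par_T \<epsilon>)"

definition par_L :: "real \<Rightarrow> real \<Rightarrow> real \<Rightarrow> nat" where
  "par_L c nt \<epsilon> = nat \<lceil>7 * par_kappa c nt \<epsilon> * real (par_T \<epsilon>) / par_p \<epsilon>\<rceil>"

definition par_K :: "real \<Rightarrow> real \<Rightarrow> real \<Rightarrow> nat" where
  "par_K c nt \<epsilon> = nat \<lceil>(c + 2) * ln nt / par_p \<epsilon>\<rceil>"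

definition par_g :: "real \<Rightarrow> real \<Rightarrow> nat" where
  "par_g nt \<epsilon> = nat \<lceil>ln (2 * nt / par_p \<epsilon>) / par_p \<epsilon>\<rceil>"

text \<open>What is needed is that \<open>2 ^ B\<close> exceeds this number; making \<open>B\<close>
  itself so large costs random bits but no rounds. The first summand pays for the roundings in
  \<open>thr\<close>, the second for collisions of identifiers.\<close>

definition par_B :: "real \<Rightarrow> real \<Rightarrow> real \<Rightarrow> nat" where
  "par_B c nt \<epsilon> = nat \<lceil>2 * nt / (par_p \<epsilon>)\<^sup>2 + nt powr (c + 4)\<rceil>"

definition par_radius :: "real \<Rightarrow> real \<Rightarrow> real \<Rightarrow> nat" where
  "par_radius c nt \<epsilon> = alg_params.radius (par_T \<epsilon>) (par_g nt \<epsilon>) (par_L c nt \<epsilon>)"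

definition par_answer :: "real \<Rightarrow> real \<Rightarrow> real \<Rightarrow> datum \<Rightarrow> nat" where
  "par_answer c nt \<epsilon> = (\<lambda>vw. of_bool (alg_params.view_answer (par_p \<epsilon>) (par_kappa c nt \<epsilon>)
     (par_B c nt \<epsilon>) (par_T \<epsilon>) (par_g nt \<epsilon>) (par_L c nt \<epsilon>) (par_K c nt \<epsilon>) vw))"

text \<open>Each ceiling adds at most 1, and later steps shrink it by the factor
  \<open>1 - p\<close>, so the rounding errors form a geometric series bounded by
  \<open>1 / p\<close>.\<close>

lemma thr_bound:
  assumes "0 < p" "p \<le> 1"
  shows "real (alg_params.thr p B j) \<le> (1 - p) ^ j * 2 ^ B + 1 / p"
proof (induction j)
  case 0
  then show ?case using assms by (simp add: alg_params.thr.simps)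
next
  case (Suc j)
  let ?t = "alg_params.thr p B"
  have "real (?t (Suc j)) \<le> (1 - p) * real (?t j) + 1"
  proof -
    have "0 \<le> (1 - p) * real (?t j)" using assms by simp
    then show ?thesis unfolding alg_params.thr.simps using of_int_ceiling_le_add_one[of "(1 - p) * real (?t j)"]
      by (simp add: of_nat_nat)
  qed
  also have "\<dots> \<le> (1 - p) * ((1 - p) ^ j * 2 ^ B + 1 / p) + 1"
    using Suc assms by (intro add_right_mono mult_left_mono) auto
  also have "\<dots> = (1 - p) ^ Suc j * 2 ^ B + 1 / p"
    using assms by (simp add: field_simps)
  finally show ?case .
qed

lemma half_le_ln: "2 \<le> x \<Longrightarrow> 1 / 2 \<le> ln (x :: real)"
  using ln2_ge_two_thirds ln_le_cancel_iff[of 2 x] by linarith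

section \<open>The chosen parameters meet all requirements\<close>

locale par_setting =
  fixes c nt \<epsilon> :: real and n :: nat
  assumes c_pos: "0 < c" and eps: "0 < \<epsilon>" "\<epsilon> < 1" and n_ge: "2 \<le> n" and nt: "real n \<le> nt"
begin

abbreviation "p \<equiv> par_p \<epsilon>"
abbreviation "T \<equiv> par_T \<epsilon>"
abbreviation "\<kappa> \<equiv> par_kappa c nt \<epsilon>"
abbreviation "L \<equiv> par_L c nt \<epsilon>"
abbreviation "K \<equiv> par_K c nt \<epsilon>"
abbreviation "g \<equiv> par_g nt \<epsilon>"
abbreviation "B \<equiv> par_B c nt \<epsilon>"

lemma p: "0 < p" "9 * p = \<epsilon>" "p < 1"
  using eps by (auto simp: par_p_def)

lemma nt_ge: "2 \<le> nt"
  using nt n_ge by linarith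

lemma ln_nt: "1 / 2 \<le> ln nt" "0 < ln nt"
  using half_le_ln[OF nt_ge] by simp_all

lemma T_ge: "log 2 (9 / \<epsilon>) \<le> real T" "0 < T"
proof -
  have "1 < 9 / \<epsilon>" using eps by simp
  then have l: "0 < log 2 (9 / \<epsilon>)" using eps by (subst zero_less_log_cancel_iff) auto
  show "log 2 (9 / \<epsilon>) \<le> real T" unfolding par_T_def by (rule real_nat_ceiling_ge)
  then show "0 < T" using l by (metis less_le_trans of_nat_0_less_iff)
qed

lemma T_large: "1 \<le> 2 ^ T * p"
proof -
  have "9 / \<epsilon> = 2 powr log 2 (9 / \<epsilon>)" using eps by simp
  also have "\<dots> \<le> 2 powr real T" using T_ge by (intro powr_mono) auto
  also have "\<dots> = 2 ^ T" by (simp add: powr_realpow)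
  finally show ?thesis using eps by (simp add: par_p_def field_simps)
qed

lemma kappa_ge: "1 \<le> \<kappa>"
proof -
  have "0 \<le> (c + 3) * ln nt" using c_pos ln_nt by simp
  then show ?thesis using T_ge(2) unfolding par_kappa_def by linarith
qed

lemma L_ge: "7 * \<kappa> * real T / p \<le> real L"
  unfolding par_L_def by (rule real_nat_ceiling_ge)

lemma B_ge: "2 * nt / p\<^sup>2 \<le> 2 ^ B" "nt powr (c + 4) \<le> 2 ^ B"
proof -
  have "2 * nt / p\<^sup>2 + nt powr (c + 4) \<le> real B" unfolding par_B_def by (rule real_nat_ceiling_ge)
  also have "\<dots> \<le> 2 ^ B" by (rule less_imp_le[OF of_nat_less_two_power])
  finally have *: "2 * nt / p\<^sup>2 + nt powr (c + 4) \<le> 2 ^ B" .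
  have "0 \<le> 2 * nt / p\<^sup>2" "0 \<le> nt powr (c + 4)" using nt_ge by auto
  then show "2 * nt / p\<^sup>2 \<le> 2 ^ B" "nt powr (c + 4) \<le> 2 ^ B" using * by linarith+
qed

text \<open>Half of the budget \<open>p * 2 ^ B\<close> covers the geometric tail, the other half
  the rounding error \<open>1 / p\<close> of \<open>thr_bound\<close>; hence the factors 2 in
  \<open>par_g\<close> and \<open>par_B\<close>.\<close>

lemma tail: "real n * real (alg_params.thr p B g) \<le> p * 2 ^ B"
proof -
  have pg: "ln (2 * nt / p) \<le> p * real g"
  proof -
    have "ln (2 * nt / p) / p \<le> real g" unfolding par_g_def by (rule real_nat_ceiling_ge)
    then show ?thesis using p by (simp add: field_simps)
  qed
  have "(1 - p) ^ g \<le> exp (- p) ^ g"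
    using exp_ge_add_one_self[of "- p"] p by (intro power_mono) auto
  also have "\<dots> = exp (- (p * real g))" by (simp add: exp_of_nat_mult[symmetric] mult.commute)
  also have "\<dots> \<le> exp (- ln (2 * nt / p))" using pg by simp
  also have "\<dots> = p / (2 * nt)" using p nt_ge by (simp add: exp_minus)
  finally have e: "(1 - p) ^ g \<le> p / (2 * nt)" .
  have "real n * real (alg_params.thr p B g) \<le> nt * ((1 - p) ^ g * 2 ^ B + 1 / p)"
    using thr_bound[of p B g] p nt nt_ge by (intro mult_mono) auto
  also have "\<dots> \<le> nt * (p / (2 * nt) * 2 ^ B + 1 / p)"
    using e nt_ge by (intro mult_left_mono add_right_mono mult_right_mono) auto
  also have "\<dots> = p * 2 ^ B / 2 + nt / p" using nt_ge by (simp add: field_simps)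
  also have "nt / p \<le> p * 2 ^ B / 2"
  proof -
    have "2 * nt \<le> p\<^sup>2 * 2 ^ B" using B_ge(1) p by (simp add: pos_divide_le_eq mult.commute)
    then show ?thesis using p by (simp add: field_simps power2_eq_square)
  qed
  finally show ?thesis by simp
qed

lemma card_le: "n \<le> 2 ^ B"
proof -
  have "real n \<le> nt powr 1" using nt nt_ge by simp
  also have "\<dots> \<le> nt powr (c + 4)" using nt_ge c_pos by (intro powr_mono) auto
  also have "\<dots> \<le> 2 ^ B" by (rule B_ge)
  finally show ?thesis by (metis of_nat_le_iff of_nat_numeral of_nat_power)
qed

lemma L_pos: "0 < L"
proof -
  have "0 < 7 * \<kappa> * real T / p" using kappa_ge T_ge(2) p by simp
  then have "0 < real L" using L_ge by (rule less_le_trans)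
  then show ?thesis by simp
qed

lemma K_ge: "(c + 2) * ln nt \<le> p * real K"
proof -
  have "(c + 2) * ln nt / p \<le> real K" unfolding par_K_def by (rule real_nat_ceiling_ge)
  then show ?thesis using p by (simp add: field_simps)
qed

lemma K_pos: "0 < K"
proof -
  have "0 < (c + 2) * ln nt" using c_pos ln_nt by simp
  then have "0 < p * real K" using K_ge by (rule less_le_trans)
  then show ?thesis using p by (simp add: zero_less_mult_iff)
qed

text \<open>Everything is measured in \<open>q\<close>, which is \<open>nt\<close> to the power
  \<open>- (c + 2)\<close>: one \<open>q\<close> for collisions, one for the averaging, two for the
  carving. The two spare powers of \<open>nt \<ge> 2\<close> absorb the factor 4.\<close>

lemma failure:
  "(real n)\<^sup>2 / 2 ^ B + exp (- (p * real K)) + (2 * real n * real T + 1) * exp (- \<kappa>) \<le> real n powr (- c)"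
proof -
  define q where "q = nt powr (- (c + 2))"
  have q_exp: "q = exp (- ((c + 2) * ln nt))" using nt_ge by (simp add: q_def powr_def algebra_simps)
  have q0: "0 \<le> q" by (simp add: q_def)
  have "(real n)\<^sup>2 \<le> nt\<^sup>2" using nt by (intro power_mono) auto
  then have "(real n)\<^sup>2 / 2 ^ B \<le> nt powr 2 / nt powr (c + 4)"
    using B_ge(2) nt_ge by (intro frac_le) (auto simp: powr_numeral)
  also have "\<dots> = q"
  proof -
    have "2 - (c + 4) = - (c + 2)" by simp
    then show ?thesis unfolding q_def powr_diff[symmetric] by (simp only:)
  qed
  finally have 1: "(real n)\<^sup>2 / 2 ^ B \<le> q" .
  have 2: "exp (- (p * real K)) \<le> q" unfolding q_exp using K_ge by simp
  have TT: "2 * real T \<le> exp (real T)"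
  proof -
    have "0 \<le> (real T - 1)\<^sup>2" by simp
    then have "2 * real T \<le> 1 + real T + (real T)\<^sup>2 / 2"
      by (simp add: power2_eq_square algebra_simps)
    also have "1 + real T + (real T)\<^sup>2 / 2 \<le> exp (real T)"
      by (rule exp_lower_Taylor_quadratic) simp
    finally show ?thesis .
  qed
  have "(2 * real n * real T + 1) * exp (- \<kappa>) = (real n * (2 * real T) + 1) * exp (- real T) * exp (- ((c + 3) * ln nt))"
    by (simp add: par_kappa_def exp_add[symmetric] algebra_simps)
  also have "(real n * (2 * real T) + 1) * exp (- real T) \<le> real n * 1 + 1"
  proof -
    have "2 * real T * exp (- real T) \<le> 1" using TT by (simp add: exp_minus field_simps)
    then have "real n * (2 * real T * exp (- real T)) \<le> real n * 1" by (intro mult_left_mono) auto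
    moreover have "exp (- real T) \<le> 1" by simp
    moreover have "(real n * (2 * real T) + 1) * exp (- real T) = real n * (2 * real T * exp (- real T)) + exp (- real T)"
      by (simp add: algebra_simps)
    ultimately show ?thesis by linarith
  qed
  also have "(real n * 1 + 1) * exp (- ((c + 3) * ln nt)) \<le> (2 * nt) * exp (- ((c + 3) * ln nt))"
    using nt nt_ge by (intro mult_right_mono) auto
  also have "\<dots> = 2 * q"
  proof -
    have "nt * exp (- ((c + 3) * ln nt)) = exp (ln nt) * exp (- ((c + 3) * ln nt))" using nt_ge by simp
    also have "\<dots> = q" unfolding q_exp exp_add[symmetric] by (simp add: algebra_simps)
    finally show ?thesis by simp
  qed
  finally have 3: "(2 * real n * real T + 1) * exp (- \<kappa>) \<le> 2 * q" by simp
  have "4 * q \<le> nt powr (- c)"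
  proof -
    have "nt powr (- c) = q * nt powr 2" by (simp add: q_def powr_add[symmetric])
    moreover have "4 \<le> nt powr 2" using nt_ge power_mono[of 2 nt 2] by (simp add: powr_numeral)
    then have "q * 4 \<le> q * nt powr 2" by (rule mult_left_mono) (rule q0)
    ultimately show ?thesis by simp
  qed
  also have "\<dots> \<le> real n powr (- c)" using nt n_ge c_pos by (intro powr_mono2') auto
  finally show ?thesis using 1 2 3 by linarith
qed

text \<open>All terms are compared with \<open>U\<close>, the target scale. The bounds
  \<open>1 \<le> l\<close>, \<open>1 \<le> 2 * x\<close> and \<open>1 \<le> e\<close> absorb
  lower-order terms; in particular the \<open>T\<close> inside \<open>\<kappa>\<close> turns into a
  multiple of \<open>x * l\<close>, which brings in the third logarithm.\<close>

lemma radius_le: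
  "real (par_radius c nt \<epsilon>) \<le> (22000 * (c + 18)) * ((max 1 (ln (1 / \<epsilon>))) ^ 3 * ln nt / \<epsilon>)"
proof -
  define l where "l = max 1 (ln (1 / \<epsilon>))"
  define x where "x = ln nt"
  define e where "e = 1 / \<epsilon>"
  have l: "1 \<le> l" "ln (1 / \<epsilon>) \<le> l" by (auto simp: l_def)
  have x: "1 \<le> 2 * x" using ln_nt by (simp add: x_def)
  have e: "1 \<le> e" using eps by (simp add: e_def)
  \<comment> \<open>The quadratic Taylor bound for \<open>exp (2 / 3)\<close>, raised to the fourth
    power. The value \<open>8 / 3\<close> is small enough for
    \<open>ln (9 / \<epsilon>) \<le> 4 * l\<close>.\<close>
  have ln9: "ln 9 \<le> (8 / 3 :: real)"
  proof -
    have "(9 :: real) \<le> (1 + 1 / 3 * 2 + (1 / 3 * 2)\<^sup>2 / 2) ^ 4" by (simp add: power2_eq_square eval_nat_numeral)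
    also have "\<dots> \<le> exp (1 / 3 * 2) ^ 4"
      by (intro power_mono exp_lower_Taylor_quadratic) auto
    also have "\<dots> = exp (8 / 3)" by (simp add: exp_of_nat_mult[symmetric])
    finally have "ln 9 \<le> ln (exp (8 / 3 :: real))" by (subst ln_le_cancel_iff) auto
    then show ?thesis by simp
  qed
  have lne: "ln (9 / \<epsilon>) \<le> 4 * l"
  proof -
    have "ln (9 / \<epsilon>) = ln 9 + ln (1 / \<epsilon>)" using eps ln_mult[of 9 "1 / \<epsilon>"] by simp
    then show ?thesis using ln9 l by linarith
  qed
  have T: "real T \<le> 7 * l"
  proof -
    have "0 \<le> log 2 (9 / \<epsilon>)" using eps by simp
    then have "real T \<le> log 2 (9 / \<epsilon>) + 1" unfolding par_T_def
      using of_int_ceiling_le_add_one[of "log 2 (9 / \<epsilon>)"] by (simp add: of_nat_nat)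
    also have "log 2 (9 / \<epsilon>) \<le> 6 * l"
    proof -
      have "log 2 (9 / \<epsilon>) = ln (9 / \<epsilon>) / ln 2" by (simp add: log_def)
      also have "\<dots> \<le> 4 * l / (2 / 3)"
        using lne ln2_ge_two_thirds l by (intro frac_le) auto
      finally show ?thesis by simp
    qed
    finally show ?thesis using l by linarith
  qed
  have xl: "x \<le> x * l" "l \<le> 2 * (x * l)" "0 \<le> x * l" "1 \<le> 2 * (x * l)"
  proof -
    show "x \<le> x * l" using x l by simp
    show "l \<le> 2 * (x * l)" using mult_right_mono[OF x, of l] l by simp
    then show "1 \<le> 2 * (x * l)" using l by linarith
    show "0 \<le> x * l" using x l by simp
  qed
  have kap: "\<kappa> \<le> (c + 17) * (x * l)"
  proof -
    have "\<kappa> = (c + 3) * x + real T" by (simp add: par_kappa_def x_def)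
    also have "\<dots> \<le> (c + 3) * (x * l) + 7 * (2 * (x * l))"
      using T xl c_pos by (intro add_mono mult_left_mono) auto
    finally show ?thesis by (simp add: algebra_simps)
  qed
  have kap0: "0 \<le> \<kappa>" using kappa_ge by simp
  have l2: "x * l \<le> x * l ^ 3"
    using x l power_increasing[of 1 3 l] by (intro mult_left_mono) auto
  define U where "U = x * l ^ 3 * e"
  have xle: "x * l * e \<le> U" unfolding U_def using l2 e by (intro mult_right_mono) auto
  have one: "1 \<le> 2 * U"
  proof -
    have "1 * 1 \<le> (2 * (x * l)) * e" using xl e by (intro mult_mono) auto
    then show ?thesis using xle by simp
  qed
  have pe: "1 / p = 9 * e" by (simp add: par_p_def e_def)
  have TL: "real T * real L \<le> 3087 * (c + 17) * U + 14 * U"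
  proof -
    have L: "real L \<le> 7 * \<kappa> * real T * (9 * e) + 1"
    proof -
      have "0 \<le> 7 * \<kappa> * real T / p" using kap0 p by simp
      then have "real L \<le> 7 * \<kappa> * real T / p + 1" unfolding par_L_def
        using of_int_ceiling_le_add_one[of "7 * \<kappa> * real T / p"] by (simp add: of_nat_nat)
      also have "7 * \<kappa> * real T / p = 7 * \<kappa> * real T * (1 / p)" by simp
      finally show ?thesis unfolding pe .
    qed
    have "real T * real L \<le> real T * (7 * \<kappa> * real T * (9 * e) + 1)"
      by (rule mult_left_mono[OF L]) simp
    also have "\<dots> = 63 * (real T * real T) * \<kappa> * e + real T" by (simp add: algebra_simps)
    also have "63 * (real T * real T) * \<kappa> * e \<le> 63 * ((7 * l) * (7 * l)) * ((c + 17) * (x * l)) * e"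
      using T l kap kap0 e by (intro mult_right_mono mult_mono mult_left_mono) auto
    also have "\<dots> = 3087 * (c + 17) * U" by (simp add: U_def power3_eq_cube algebra_simps)
    also have "real T \<le> 14 * U"
    proof -
      have "real T \<le> 14 * (x * l)" using T xl by linarith
      also have "x * l \<le> x * l * e" using mult_left_mono[OF e xl(3)] by simp
      finally show ?thesis using xle by linarith
    qed
    finally show ?thesis by simp
  qed
  have G: "real (Suc g) \<le> 110 * U"
  proof -
    have "0 \<le> ln (2 * nt / p)" using nt_ge p by (simp add: field_simps)
    then have "0 \<le> ln (2 * nt / p) / p" using p by simp
    then have "real g \<le> ln (2 * nt / p) / p + 1" unfolding par_g_def
      using of_int_ceiling_le_add_one[of "ln (2 * nt / p) / p"] by (simp add: of_nat_nat)
    also have "ln (2 * nt / p) / p = ln (2 * nt / p) * (9 * e)" unfolding pe[symmetric] by simp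
    also have "ln (2 * nt / p) = ln 2 + x + ln (9 / \<epsilon>)"
    proof -
      have "2 * nt / p = 2 * (nt * (9 / \<epsilon>))" by (simp add: par_p_def)
      moreover have "ln (2 * (nt * (9 / \<epsilon>))) = ln 2 + ln (nt * (9 / \<epsilon>))"
        by (subst ln_mult) (use nt_ge eps in auto)
      moreover have "ln (nt * (9 / \<epsilon>)) = ln nt + ln (9 / \<epsilon>)"
        by (subst ln_mult) (use nt_ge eps in auto)
      ultimately show ?thesis by (simp only: x_def)
    qed
    also have "ln 2 + x + ln (9 / \<epsilon>) \<le> 11 * (x * l)"
      using lne xl l ln_2_less_1 by linarith
    finally have "real g \<le> 11 * (x * l) * (9 * e) + 1" using e by (simp add: mult_right_mono)
    also have "\<dots> = 99 * (x * l * e) + 1" by simp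
    finally have "real (Suc g) \<le> 99 * (x * l * e) + 2" by simp
    then show ?thesis using xle one by linarith
  qed
  \<comment> \<open>\<open>17 = 3 + 7 * 2\<close>, as \<open>scale 0\<close> contains
    \<open>2 * Suc g\<close>.\<close>
  have "real (par_radius c nt \<epsilon>) = 17 * real (Suc g) + 7 * (real T * real L)"
    by (simp add: par_radius_def alg_params.radius_def alg_params.scale_def algebra_simps)
  also have "\<dots> \<le> 17 * (110 * U) + 7 * (3087 * (c + 17) * U + 14 * U)"
    using G TL by (intro add_mono mult_left_mono) auto
  also have "\<dots> = (21609 * c + 369321) * U" by (simp add: algebra_simps)
  also have "\<dots> \<le> (22000 * (c + 18)) * U"
    using c_pos one by (intro mult_right_mono) auto
  also have "U = l ^ 3 * x / \<epsilon>" by (simp add: U_def e_def)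
  finally show ?thesis by (simp add: l_def x_def)
qed

end

theorem theorem1p6:
  fixes c' :: real
  assumes "c' > 0"
  shows "\<exists>alg :: local_alg. \<forall>(c :: real) \<ge> 1. \<forall>(K :: real) (k :: nat). \<exists>C :: real.
    \<forall>(m :: nat) (n :: nat) (A :: real mat) (b :: real vec) (w :: nat vec)
      (lab :: nat \<Rightarrow> nat) (\<epsilon> :: real) (ntilde :: real).
      packing_problem m n A b w \<longrightarrow>
      real (norm1 w) \<le> K * real n ^ k \<longrightarrow>
      inj_on lab {..<m} \<longrightarrow>
      0 < \<epsilon> \<longrightarrow> \<epsilon> < 1 \<longrightarrow>
      real (max n (OPT A b w)) \<le> ntilde \<longrightarrow>
      ntilde \<le> real (max n (OPT A b w)) powr c \<longrightarrow>
      \<P>(\<omega> in random_bits n.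
          solves_within alg A b w lab ntilde \<epsilon> \<omega> (nat \<lfloor>C * round_scale n \<epsilon>\<rfloor>))
        \<ge> 1 - real n powr (- c')"
proof -
  let ?alg = "view_alg (par_radius c') (par_answer c')"
  \<comment> \<open>\<open>?D\<close> comes from \<open>radius_le\<close>, and
    \<open>c * ?E K k\<close> bounds \<open>ln nt / ln n\<close>. The factor 2 in \<open>?E\<close>
    absorbs the constant \<open>ln (1 + \<bar>K\<bar>)\<close> by means of
    \<open>ln n \<ge> 1 / 2\<close>.\<close>
  let ?D = "22000 * (c' + 18)" and ?E = "\<lambda>(K :: real) (k :: nat). ln (1 + \<bar>K\<bar>) * 2 + real k + 1"
  have main: "\<P>(\<omega> in random_bits n.
        solves_within ?alg A b w lab nt \<epsilon> \<omega> (nat \<lfloor>?D * (c * ?E K k) * round_scale n \<epsilon>\<rfloor>))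
      \<ge> 1 - real n powr (- c')"
    if c: "1 \<le> c" and P: "packing_problem m n A b w" and K: "real (norm1 w) \<le> K * real n ^ k"
      and lab: "inj_on lab {..<m}" and eps: "0 < \<epsilon>" "\<epsilon> < 1"
      and bounds: "real (max n (OPT A b w)) \<le> nt" "nt \<le> real (max n (OPT A b w)) powr c"
    for c K :: real and k m n :: nat and A b w lab \<epsilon> nt
  proof -
    interpret packing_setting m n A b w lab by unfold_locales (rule P, rule lab)
    interpret prob_space "random_bits n"
      unfolding random_bits_def by (rule prob_space_PiM) (rule coin_flips_space)
    let ?t = "nat \<lfloor>?D * (c * ?E K k) * round_scale n \<epsilon>\<rfloor>"
    consider "n = 0" | "n = 1" | "2 \<le> n" by linarith
    then show ?thesis
    proof cases
      case 1
      have "approx_solution \<epsilon> A b w (ind {})"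
      proof (rule approx_ind)
        show "row_feas {}" by (simp add: row_feas_def)
        show "(1 - \<epsilon>) * real (sum W Z) \<le> real (sum W {})" if "Z \<subseteq> {..<n}" "row_feas Z" for Z
          using that 1 by simp
      qed (use eps in auto)
      moreover have "dim_vec (ind {}) = dim_col A" by (simp add: ind_def dims)
      moreover have "dim_col A = 0" using 1 dims by simp
      ultimately have "solves_within ?alg A b w lab nt \<epsilon> \<omega> ?t" for \<omega>
        unfolding solves_within_def by (intro exI[of _ "ind {}"]) simp
      then show ?thesis using prob_space 1 by simp
    next
      \<comment> \<open>For \<open>n = 1\<close> both \<open>round_scale\<close> and the required
        probability are 0.\<close>
      case 2
      then show ?thesis by simp
    next
      case 3
      interpret par_setting c' nt \<epsilon> n
        by unfold_locales (use assms eps 3 bounds(1) in auto)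
      interpret packing_params m n A b w lab p \<kappa> B T g L "par_K c' nt \<epsilon>"
      proof unfold_locales
        show "7 * \<kappa> * real T \<le> p * real L"
          using L_ge p by (simp add: pos_divide_le_eq mult.commute)
      qed (use p eps tail L_pos T_ge(2) K_pos kappa_ge T_large card_le in auto)
      have ln_n: "1 / 2 \<le> ln (real n)" by (rule half_le_ln) (use 3 in simp)
      have "real (max n (OPT A b w)) \<le> (1 + \<bar>K\<bar>) * real n ^ (k + 1)"
      proof -
        have n1: "1 \<le> real n ^ k" using 3 by simp
        have "real (OPT A b w) \<le> K * real n ^ k" using OPT_le_norm1 K by linarith
        also have "\<dots> \<le> \<bar>K\<bar> * real n ^ (k + 1)"
          using 3 by (intro mult_mono power_increasing) auto
        finally have a: "real (OPT A b w) \<le> \<bar>K\<bar> * real n ^ (k + 1)" .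
        have b: "real n \<le> 1 * real n ^ (k + 1)" using power_increasing[of 1 "k + 1" "real n"] 3 by simp
        have "0 \<le> real n ^ (k + 1)" "0 \<le> \<bar>K\<bar> * real n ^ (k + 1)" by auto
        then show ?thesis using a b unfolding of_nat_max distrib_right by linarith
      qed
      then have "ln (real (max n (OPT A b w))) \<le> ln ((1 + \<bar>K\<bar>) * real n ^ (k + 1))"
        using 3 by (subst ln_le_cancel_iff) (auto intro!: mult_pos_pos)
      also have "\<dots> = ln (1 + \<bar>K\<bar>) + real (k + 1) * ln (real n)"
        using 3 ln_mult[of "1 + \<bar>K\<bar>" "real n ^ (k + 1)"] ln_realpow[of "real n" "k + 1"] by simp
      also have "ln (1 + \<bar>K\<bar>) \<le> ln (1 + \<bar>K\<bar>) * (2 * ln (real n))"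
        using ln_n by (intro mult_le_cancel_left1[THEN iffD2]) auto
      finally have lnmax: "ln (real (max n (OPT A b w))) \<le> ?E K k * ln (real n)"
        by (simp add: algebra_simps)
      have "ln nt \<le> ln (real (max n (OPT A b w)) powr c)"
        using bounds(2) nt_ge 3 by (subst ln_le_cancel_iff) auto
      also have "\<dots> = c * ln (real (max n (OPT A b w)))" using 3 by (simp add: ln_powr)
      also have "\<dots> \<le> c * (?E K k * ln (real n))"
        using lnmax c by (intro mult_left_mono) auto
      finally have lnnt: "ln nt \<le> c * ?E K k * ln (real n)" by simp
      have "real (par_radius c' nt \<epsilon>) \<le> ?D * ((max 1 (ln (1 / \<epsilon>))) ^ 3 * ln nt / \<epsilon>)"
        by (rule radius_le)
      also have "\<dots> \<le> ?D * ((max 1 (ln (1 / \<epsilon>))) ^ 3 * (c * ?E K k * ln (real n)) / \<epsilon>)"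
        using lnnt eps assms by (intro mult_left_mono divide_right_mono) auto
      also have "\<dots> = ?D * (c * ?E K k) * round_scale n \<epsilon>"
        by (simp add: round_scale_def)
      finally have "par_radius c' nt \<epsilon> \<le> ?t" by (simp add: le_nat_floor)
      then show ?thesis
        using prob_solves[of "par_radius c'" nt \<epsilon> "par_answer c'" ?t] failure p eps
        by (simp add: par_radius_def par_answer_def)
    qed
  qed
  show ?thesis
    by (rule exI[of _ ?alg]) (use main in blast)
qed

end
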